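(* Assume that the GCH holds above a measurable cardinal $\delta$ and $\kappa\geq\delta$ is a cardinal with the property that there is a good $\Sigma_1(\kappa)$-wellordering of $\mathcal{P}(\kappa)$. Then the following statements hold: (i) There is a cardinal $\nu$ with $\mathrm{cof}(\nu)=\delta$ and $\nu\leq\kappa\leq\nu^+$. (ii) There are no measurable cardinals in the interval $(\delta,\kappa]$.
   Context: We work in ZFC. The GCH at an infinite cardinal $\lambda$ is the statement $2^\lambda=\lambda^+$. $\mathcal{P}(\kappa)$ denotes the power set of $\kappa$ and $\mathrm{cof}(\nu)$ the cofinality of $\nu$. For sets $y_0,\ldots,y_{n-1}$, a set $X$ is $\Sigma_1(y_0,\ldots,y_{n-1})$-definable if there is a $\Sigma_1$-formula $\varphi(v_0,\ldots,v_n)$ (in the Lévy hierarchy, in the language of set theory) with $X=\{x\mid\varphi(x,y_0,\ldots,y_{n-1})\}$. A wellordering $\lhd$ of a set $X$ is a good $\Sigma_1(y_0,\ldots,y_{n-1})$-wellordering of $X$ if the set $I(\lhd)=\{\{x\in X\mid x\lhd y\}\mid y\in X\}$ of all proper initial segments of $\lhd$ is $\Sigma_1(y_0,\ldots,y_{n-1})$-definable. *)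

theory Defs
  imports Main
begin

text \<open>
  HOL has no universe of sets, so ``in ZFC'' is rendered semantically: a statement is asserted of
  an arbitrary structure (V, E), with V a type and E a binary relation on it, that satisfies the
  first-order axioms of ZFC.  By soundness and completeness, a sentence holds in all such
  structures iff ZFC proves it.  Every set-theoretic notion below is interpreted inside the
  structure: it is expressed by quantification over elements of V only, so subsets, functions,
  ultrafilters and wellorderings are always elements of V.
\<close>

section \<open>The language of set theory and the Levy hierarchy\<close>

datatype fm =
    Mem nat nat
  | Equal nat nat
  | Neg fm
  | Conj fm fm
  | Ex nat fm

fun sat :: "('v \<Rightarrow> 'v \<Rightarrow> bool) \<Rightarrow> fm \<Rightarrow> (nat \<Rightarrow> 'v) \<Rightarrow> bool" where
  "sat E (Mem i j) s \<longleftrightarrow> E (s i) (s j)"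
| "sat E (Equal i j) s \<longleftrightarrow> s i = s j"
| "sat E (Neg \<phi>) s \<longleftrightarrow> \<not> sat E \<phi> s"
| "sat E (Conj \<phi> \<psi>) s \<longleftrightarrow> sat E \<phi> s \<and> sat E \<psi> s"
| "sat E (Ex i \<phi>) s \<longleftrightarrow> (\<exists>x. sat E \<phi> (s(i := x)))"

fun free_vars :: "fm \<Rightarrow> nat set" where
  "free_vars (Mem i j) = {i, j}"
| "free_vars (Equal i j) = {i, j}"
| "free_vars (Neg \<phi>) = free_vars \<phi>"
| "free_vars (Conj \<phi> \<psi>) = free_vars \<phi> \<union> free_vars \<psi>"
| "free_vars (Ex i \<phi>) = free_vars \<phi> - {i}"

text \<open>In the last rule, the formula is the bounded quantification of the variable i over the
  elements of j; bounded universal quantification is obtained with negations.\<close>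

inductive Delta0 :: "fm \<Rightarrow> bool" where
  "Delta0 (Mem i j)"
| "Delta0 (Equal i j)"
| "Delta0 \<phi> \<Longrightarrow> Delta0 (Neg \<phi>)"
| "Delta0 \<phi> \<Longrightarrow> Delta0 \<psi> \<Longrightarrow> Delta0 (Conj \<phi> \<psi>)"
| "Delta0 \<phi> \<Longrightarrow> i \<noteq> j \<Longrightarrow> Delta0 (Ex i (Conj (Mem i j) \<phi>))"

inductive Sigma1 :: "fm \<Rightarrow> bool" where
  "Delta0 \<phi> \<Longrightarrow> Sigma1 \<phi>"
| "Sigma1 \<phi> \<Longrightarrow> Sigma1 (Ex i \<phi>)"


section \<open>Set-theoretic notions inside a structure\<close>

locale set_structure =
  fixes mem :: "'v \<Rightarrow> 'v \<Rightarrow> bool"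
begin

definition elts :: "'v \<Rightarrow> 'v set" where
  "elts x = {z. mem z x}"

text \<open>z is the Kuratowski pair of x and y.\<close>

definition opair :: "'v \<Rightarrow> 'v \<Rightarrow> 'v \<Rightarrow> bool" where
  "opair z x y \<longleftrightarrow> (\<exists>a b. elts a = {x} \<and> elts b = {x, y} \<and> elts z = {a, b})"

definition rel :: "'v \<Rightarrow> 'v \<Rightarrow> 'v \<Rightarrow> bool" where
  "rel r x y \<longleftrightarrow> (\<exists>p \<in> elts r. opair p x y)"

definition relation_between :: "'v \<Rightarrow> 'v \<Rightarrow> 'v \<Rightarrow> bool" where
  "relation_between r A B \<longleftrightarrow> (\<forall>p \<in> elts r. \<exists>a \<in> elts A. \<exists>b \<in> elts B. opair p a b)"

definition function_between :: "'v \<Rightarrow> 'v \<Rightarrow> 'v \<Rightarrow> bool" where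
  "function_between f A B \<longleftrightarrow> relation_between f A B \<and> (\<forall>a \<in> elts A. \<exists>!b. rel f a b)"

definition bijection_between :: "'v \<Rightarrow> 'v \<Rightarrow> 'v \<Rightarrow> bool" where
  "bijection_between f A B \<longleftrightarrow> function_between f A B \<and> (\<forall>b \<in> elts B. \<exists>!a. rel f a b)"

definition equinumerous :: "'v \<Rightarrow> 'v \<Rightarrow> bool" where
  "equinumerous A B \<longleftrightarrow> (\<exists>f. bijection_between f A B)"

definition powerset :: "'v \<Rightarrow> 'v \<Rightarrow> bool" where
  "powerset P x \<longleftrightarrow> elts P = {z. elts z \<subseteq> elts x}"

text \<open>R is a strict wellordering of X, with minimal elements for those nonempty subsets of X that
  are elements of the structure.\<close>

definition wellorders :: "('v \<Rightarrow> 'v \<Rightarrow> bool) \<Rightarrow> 'v \<Rightarrow> bool" where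
  "wellorders R X \<longleftrightarrow>
     irreflp_on (elts X) R \<and> transp_on (elts X) R \<and> totalp_on (elts X) R \<and>
     (\<forall>S. elts S \<subseteq> elts X \<and> elts S \<noteq> {} \<longrightarrow> (\<exists>m \<in> elts S. \<forall>x \<in> elts S. \<not> R x m))"


subsection \<open>Ordinals and cardinals\<close>

definition ordinal :: "'v \<Rightarrow> bool" where
  "ordinal \<alpha> \<longleftrightarrow> (\<forall>\<beta> \<in> elts \<alpha>. elts \<beta> \<subseteq> elts \<alpha>) \<and> wellorders mem \<alpha>"

definition ord_le :: "'v \<Rightarrow> 'v \<Rightarrow> bool" where
  "ord_le \<alpha> \<beta> \<longleftrightarrow> mem \<alpha> \<beta> \<or> \<alpha> = \<beta>"

definition limit_ordinal :: "'v \<Rightarrow> bool" where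
  "limit_ordinal \<alpha> \<longleftrightarrow>
     ordinal \<alpha> \<and> elts \<alpha> \<noteq> {} \<and> (\<forall>\<beta> \<in> elts \<alpha>. \<exists>\<gamma> \<in> elts \<alpha>. mem \<beta> \<gamma>)"

definition is_omega :: "'v \<Rightarrow> bool" where
  "is_omega w \<longleftrightarrow> limit_ordinal w \<and> (\<forall>\<alpha> \<in> elts w. \<not> limit_ordinal \<alpha>)"

definition cardinal :: "'v \<Rightarrow> bool" where
  "cardinal \<kappa> \<longleftrightarrow> ordinal \<kappa> \<and> (\<forall>\<alpha> \<in> elts \<kappa>. \<not> equinumerous \<alpha> \<kappa>)"

definition uncountable_cardinal :: "'v \<Rightarrow> bool" where
  "uncountable_cardinal \<kappa> \<longleftrightarrow> cardinal \<kappa> \<and> (\<exists>w. is_omega w \<and> mem w \<kappa>)"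

text \<open>\<mu> is the least cardinal greater than \<kappa>.\<close>

definition successor_cardinal :: "'v \<Rightarrow> 'v \<Rightarrow> bool" where
  "successor_cardinal \<mu> \<kappa> \<longleftrightarrow>
     cardinal \<mu> \<and> mem \<kappa> \<mu> \<and> (\<forall>\<theta>. cardinal \<theta> \<and> mem \<kappa> \<theta> \<longrightarrow> ord_le \<mu> \<theta>)"

definition GCH_at :: "'v \<Rightarrow> bool" where
  "GCH_at \<theta> \<longleftrightarrow> (\<exists>P \<mu>. powerset P \<theta> \<and> successor_cardinal \<mu> \<theta> \<and> equinumerous P \<mu>)"

definition cofinal_map :: "'v \<Rightarrow> 'v \<Rightarrow> 'v \<Rightarrow> bool" where
  "cofinal_map f \<gamma> \<nu> \<longleftrightarrow>
     function_between f \<gamma> \<nu> \<and>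
     (\<forall>\<alpha> \<in> elts \<nu>. \<exists>\<xi> \<in> elts \<gamma>. \<exists>\<beta>. rel f \<xi> \<beta> \<and> ord_le \<alpha> \<beta>)"

text \<open>\<gamma> is the cofinality of the ordinal \<nu>.\<close>

definition cofinality :: "'v \<Rightarrow> 'v \<Rightarrow> bool" where
  "cofinality \<nu> \<gamma> \<longleftrightarrow>
     ordinal \<gamma> \<and> (\<exists>f. cofinal_map f \<gamma> \<nu>) \<and> (\<forall>\<beta> \<in> elts \<gamma>. \<not> (\<exists>f. cofinal_map f \<beta> \<nu>))"


subsection \<open>Measurable cardinals\<close>

definition ultrafilter_on :: "'v \<Rightarrow> 'v \<Rightarrow> bool" where
  "ultrafilter_on U S \<longleftrightarrow>
     (\<forall>X \<in> elts U. elts X \<subseteq> elts S \<and> elts X \<noteq> {}) \<and>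
     S \<in> elts U \<and>
     (\<forall>X \<in> elts U. \<forall>Y \<in> elts U. \<forall>Z. elts Z = elts X \<inter> elts Y \<longrightarrow> Z \<in> elts U) \<and>
     (\<forall>X \<in> elts U. \<forall>Y. elts X \<subseteq> elts Y \<and> elts Y \<subseteq> elts S \<longrightarrow> Y \<in> elts U) \<and>
     (\<forall>X Y. elts X \<subseteq> elts S \<and> elts Y = elts S - elts X \<longrightarrow> X \<in> elts U \<or> Y \<in> elts U)"

definition nonprincipal_on :: "'v \<Rightarrow> 'v \<Rightarrow> bool" where
  "nonprincipal_on U S \<longleftrightarrow> \<not> (\<exists>a \<in> elts S. elts U = {X. elts X \<subseteq> elts S \<and> a \<in> elts X})"

text \<open>U is closed under intersections of fewer than \<kappa> of its members (\<kappa> a cardinal).\<close>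

definition complete_on :: "'v \<Rightarrow> 'v \<Rightarrow> 'v \<Rightarrow> bool" where
  "complete_on \<kappa> U S \<longleftrightarrow>
     (\<forall>\<A>. elts \<A> \<subseteq> elts U \<and> (\<exists>\<alpha> \<in> elts \<kappa>. equinumerous \<alpha> \<A>) \<longrightarrow>
        (\<exists>Y \<in> elts U. elts Y = {z \<in> elts S. \<forall>X \<in> elts \<A>. z \<in> elts X}))"

definition measurable_cardinal :: "'v \<Rightarrow> bool" where
  "measurable_cardinal \<kappa> \<longleftrightarrow>
     uncountable_cardinal \<kappa> \<and>
     (\<exists>U. ultrafilter_on U \<kappa> \<and> nonprincipal_on U \<kappa> \<and> complete_on \<kappa> U \<kappa>)"


subsection \<open>Good wellorderings\<close>

text \<open>Variable 0 stands for the defined object and the variables 1, ..., n for the parameters.  No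
  other variables may occur freely, so the out-of-range values of the list lookup are
  irrelevant.\<close>

definition Sigma1_definable :: "'v list \<Rightarrow> 'v set \<Rightarrow> bool" where
  "Sigma1_definable ys X \<longleftrightarrow>
     (\<exists>\<phi>. Sigma1 \<phi> \<and> free_vars \<phi> \<subseteq> {0..length ys} \<and>
          X = {x. sat mem \<phi> (\<lambda>i. (x # ys) ! i)})"

definition wellordering_of :: "'v \<Rightarrow> 'v \<Rightarrow> bool" where
  "wellordering_of r X \<longleftrightarrow> relation_between r X X \<and> wellorders (rel r) X"

definition initial_segments :: "'v \<Rightarrow> 'v \<Rightarrow> 'v set" where
  "initial_segments r X = {s. \<exists>y \<in> elts X. elts s = {x \<in> elts X. rel r x y}}"

definition good_Sigma1_wellordering :: "'v list \<Rightarrow> 'v \<Rightarrow> 'v \<Rightarrow> bool" where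
  "good_Sigma1_wellordering ys r X \<longleftrightarrow>
     wellordering_of r X \<and> Sigma1_definable ys (initial_segments r X)"

end


section \<open>Models of ZFC\<close>

text \<open>In the two schemas, the assignment s supplies arbitrary parameters.\<close>

locale ZFC_model = set_structure mem for mem :: "'v \<Rightarrow> 'v \<Rightarrow> bool" +
  assumes extensionality: "elts x = elts y \<Longrightarrow> x = y"
    and foundation: "elts x \<noteq> {} \<Longrightarrow> \<exists>y \<in> elts x. elts y \<inter> elts x = {}"
    and pairing: "\<exists>z. elts z = {x, y}"
    and union: "\<exists>z. elts z = (\<Union>y \<in> elts x. elts y)"
    and power: "\<exists>P. powerset P x"
    and infinity: "\<exists>I. (\<exists>e \<in> elts I. elts e = {}) \<and>
      (\<forall>x \<in> elts I. \<exists>y \<in> elts I. elts y = insert x (elts x))"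
    and separation: "\<exists>y. elts y = {z \<in> elts x. sat mem \<phi> (s(0 := z))}"
    and replacement: "(\<And>u v w. u \<in> elts x \<Longrightarrow>
        sat mem \<phi> (s(0 := u, 1 := v)) \<Longrightarrow> sat mem \<phi> (s(0 := u, 1 := w)) \<Longrightarrow> v = w) \<Longrightarrow>
      \<exists>y. elts y = {v. \<exists>u \<in> elts x. sat mem \<phi> (s(0 := u, 1 := v))}"
    and choice: "(\<And>u. u \<in> elts x \<Longrightarrow> elts u \<noteq> {}) \<Longrightarrow>
      (\<And>u v. u \<in> elts x \<Longrightarrow> v \<in> elts x \<Longrightarrow> u \<noteq> v \<Longrightarrow> elts u \<inter> elts v = {}) \<Longrightarrow>
      \<exists>c. \<forall>u \<in> elts x. \<exists>!z. z \<in> elts u \<inter> elts c"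

end

(* A measure on delta yields an ultrapower embedding j of the universe. If kappa > delta is neither of
   cofinality delta nor the successor of a cardinal of cofinality delta, then the GCH bounds the number of
   functions from delta into smaller cardinals and gives j(kappa) = kappa. By upward absoluteness of
   Sigma1-formulas, j then maps initial segments of a good Sigma1(kappa)-wellordering of the power set of kappa to
   initial segments, and since j is order preserving, every initial segment s is contained in j(s).
   Thus all subsets of kappa, except possibly the last one, lie in the ultrapower. But some subset of
   delta^+ diagonalises against it, and so does the complement in kappa. This is (i). Part (ii) follows
   by comparing the instances of (i) for two measurable cardinals.

   No class embedding is formed: it suffices to collapse the set of functions from delta into a
   transitive set T and to prove Los's theorem for Delta0-formulas. The collapse does not depend on
   T, so T can be chosen to contain the witnesses of a given Sigma1-statement. *)
theory Submission
  imports Defs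
begin

section \<open>Definability with parameters\<close>

text \<open>The model is an arbitrary relation, possibly illfounded from outside, so HOL predicates
  and functions on \<open>'v\<close> mean nothing to the axiom schemas. The obstacle that shapes the
  proof is that separation, replacement, induction, recursion and choice apply only to what is
  definable with parameters. \<open>dfn\<close> and \<open>trm\<close> are certificates for this,
  built by syntax-directed rules. The embedding \<open>J\<close> is an external function; wherever a
  definable one is required, it is replaced by \<open>PI T (cst x)\<close> for a fixed
  \<open>T\<close>.

  The GCH enters through |J \<alpha>| \<le> \<theta>^\<delta> \<le> 2^\<theta> = \<theta>^+, where
  |\<alpha>| \<le> \<theta> and \<delta> \<le> \<theta>. This bound alone leaves open the case
  \<kappa> = \<theta>^+, which is settled by continuity of \<open>J\<close> at \<theta>; hence
  \<theta> must not have cofinality \<delta> either.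

  The complement of the diagonal set y is used because a wellordering of P(\<kappa>) may have a last
  element, which lies in no proper initial segment. As y and its complement differ, one of them
  precedes the other and so is not last.\<close>

fun rename :: "(nat \<Rightarrow> nat) \<Rightarrow> fm \<Rightarrow> fm" where
  "rename r (Mem i j) = Mem (r i) (r j)"
| "rename r (Equal i j) = Equal (r i) (r j)"
| "rename r (Neg \<phi>) = Neg (rename r \<phi>)"
| "rename r (Conj \<phi> \<psi>) = Conj (rename r \<phi>) (rename r \<psi>)"
| "rename r (Ex i \<phi>) = Ex (r i) (rename r \<phi>)"

text \<open>Injectivity prevents capture: the update that a quantifier makes at \<open>r i\<close>
  must be seen by the original formula at \<open>i\<close> and nowhere else.\<close>

lemma sat_rename: "inj r \<Longrightarrow> sat E (rename r \<phi>) s \<longleftrightarrow> sat E \<phi> (s \<circ> r)"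
proof (induction \<phi> arbitrary: s)
  case (Ex i \<phi>)
  have "s(r i := x) \<circ> r = (s \<circ> r)(i := x)" for x
    using Ex.prems by (auto simp: fun_eq_iff inj_eq)
  then show ?case
    by (simp only: rename.simps sat.simps Ex.IH[OF Ex.prems])
qed auto

lemma sat_cong_free_vars:
  "(\<And>i. i \<in> free_vars \<phi> \<Longrightarrow> s i = t i) \<Longrightarrow> sat E \<phi> s \<longleftrightarrow> sat E \<phi> t"
proof (induction \<phi> arbitrary: s t)
  case (Ex i \<phi>)
  have "sat E \<phi> (s(i := x)) \<longleftrightarrow> sat E \<phi> (t(i := x))" for x
    by (rule Ex.IH) (simp add: Ex.prems)
  then show ?case by simp
next
  case (Conj \<phi> \<psi>)
  have "sat E \<phi> s \<longleftrightarrow> sat E \<phi> t" "sat E \<psi> s \<longleftrightarrow> sat E \<psi> t"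
    by (rule Conj.IH, simp add: Conj.prems)+
  then show ?case by simp
next
  case (Neg \<phi>)
  have "sat E \<phi> s \<longleftrightarrow> sat E \<phi> t"
    by (rule Neg.IH) (simp add: Neg.prems)
  then show ?case by simp
qed simp_all

context set_structure
begin

text \<open>In a formula, the even variables stand for the environment and the odd ones for parameters.
  Environments follow the de Bruijn convention: the innermost bound variable is entry 0, so that
  closure under quantifiers can be stated by higher-order patterns.\<close>

definition merge :: "(nat \<Rightarrow> 'v) \<Rightarrow> (nat \<Rightarrow> 'v) \<Rightarrow> nat \<Rightarrow> 'v" where
  "merge e s k = (if even k then e (k div 2) else s (k div 2))"

text \<open>The parameters \<open>s\<close> are quantified inside, so any fixed elements of the
  model may occur in \<open>P\<close>, just as in the schemas of separation and replacement.\<close>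

definition dfn :: "((nat \<Rightarrow> 'v) \<Rightarrow> bool) \<Rightarrow> bool" where
  "dfn P \<longleftrightarrow> (\<exists>\<phi> s. \<forall>e. P e \<longleftrightarrow> sat mem \<phi> (merge e s))"

text \<open>The language has no function symbols, so an operation counts as definable when its graph
  is; the value is entry 0 and the environment of \<open>t\<close> is shifted by one.\<close>

definition trm :: "((nat \<Rightarrow> 'v) \<Rightarrow> 'v) \<Rightarrow> bool" where
  "trm t \<longleftrightarrow> dfn (\<lambda>e. e 0 = t (\<lambda>i. e (Suc i)))"

abbreviation dfn1 :: "('v \<Rightarrow> bool) \<Rightarrow> bool" where
  "dfn1 P \<equiv> dfn (\<lambda>e. P (e 0))"

abbreviation dfn2 :: "('v \<Rightarrow> 'v \<Rightarrow> bool) \<Rightarrow> bool" where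
  "dfn2 R \<equiv> dfn (\<lambda>e. R (e 0) (e (Suc 0)))"

abbreviation trm1 :: "('v \<Rightarrow> 'v) \<Rightarrow> bool" where
  "trm1 F \<equiv> trm (\<lambda>e. F (e 0))"

abbreviation trm2 :: "('v \<Rightarrow> 'v \<Rightarrow> 'v) \<Rightarrow> bool" where
  "trm2 F \<equiv> trm (\<lambda>e. F (e 0) (e (Suc 0)))"

named_theorems dfn

section \<open>Closure of definability under connectives and quantifiers\<close>

lemma dfnI: "(\<And>e. P e \<longleftrightarrow> sat mem \<phi> (merge e s)) \<Longrightarrow> dfn P"
  unfolding dfn_def by blast

lemma dfn_const [dfn, simp]: "dfn (\<lambda>e. p)"
proof (cases p)
  case True
  then show ?thesis by (intro dfnI[of _ "Equal 0 0"]) simp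
next
  case False
  then show ?thesis by (intro dfnI[of _ "Neg (Equal 0 0)"]) simp
qed

lemma dfn_not [dfn, simp]: "dfn P \<Longrightarrow> dfn (\<lambda>e. \<not> P e)"
  unfolding dfn_def using sat.simps(3) by metis

lemma dfn_conj [dfn, simp]:
  assumes "dfn P" "dfn Q"
  shows "dfn (\<lambda>e. P e \<and> Q e)"
proof -
  obtain \<phi> s \<psi> t where P: "\<And>e. P e \<longleftrightarrow> sat mem \<phi> (merge e s)"
    and Q: "\<And>e. Q e \<longleftrightarrow> sat mem \<psi> (merge e t)"
    using assms unfolding dfn_def by blast
  \<comment> \<open>The two formulas come with different parameter assignments. Their odd variables
    are spread over the residues 1 and 3 modulo 4, where \<open>merge s t\<close> holds the entries
    of \<open>s\<close> and of \<open>t\<close>.\<close>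
  define r1 where "r1 k = (if even k then k else 4 * (k div 2) + 1)" for k :: nat
  define r2 where "r2 k = (if even k then k else 4 * (k div 2) + 3)" for k :: nat
  define u where "u = merge s t"
  have "inj r1" "inj r2"
    unfolding r1_def r2_def
    by (rule inj_on_inverseI[where g = "\<lambda>m. if even m then m else 2 * (m div 4) + 1"];
        auto; presburger)+
  moreover have "merge e u \<circ> r1 = merge e s" "merge e u \<circ> r2 = merge e t" for e
  proof -
    have "(4 * j + 3) div 2 = 2 * j + 1" for j :: nat
      by presburger
    then show "merge e u \<circ> r1 = merge e s" "merge e u \<circ> r2 = merge e t"
      by (auto simp: fun_eq_iff merge_def r1_def r2_def u_def elim!: oddE)
  qed
  ultimately show ?thesis
    by (intro dfnI[of _ "Conj (rename r1 \<phi>) (rename r2 \<psi>)" u]) (simp add: P Q sat_rename)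
qed

lemma dfn_ex [dfn, simp]:
  assumes "dfn (\<lambda>e. P (\<lambda>i. e (Suc i)) (e 0))"
  shows "dfn (\<lambda>e. \<exists>x. P e x)"
proof -
  obtain \<phi> s where P: "\<And>e. P (\<lambda>i. e (Suc i)) (e 0) \<longleftrightarrow> sat mem \<phi> (merge e s)"
    using assms unfolding dfn_def by blast
  \<comment> \<open>Entry 0 of the environment is to be quantified, so it moves to variable 1. The
    other even variables close the gap and the odd ones make room; the dummy head of
    \<open>case_nat c s\<close> is overwritten by the quantifier.\<close>
  define r where "r k = (if k = 0 then 1 else if even k then k - 2 else k + 2)" for k :: nat
  have "inj r"
    unfolding r_def
    by (rule inj_on_inverseI[where g = "\<lambda>k. if k = 1 then 0 else if even k then k + 2 else k - 2"])
      (auto elim!: oddE evenE; presburger)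
  moreover have "(merge e (case_nat c s))(1 := x) \<circ> r = merge (case_nat x e) s" for e c x
  proof
    fix k
    consider "k = 0" | j where "k = 2 * Suc j" | j where "k = 2 * j + 1"
    proof (cases "even k")
      case True
      then obtain i where "k = 2 * i" ..
      with that show thesis by (cases i) auto
    qed (use that in \<open>auto elim!: oddE\<close>)
    then show "((merge e (case_nat c s))(1 := x) \<circ> r) k = merge (case_nat x e) s k"
      by cases (auto simp: merge_def r_def)
  qed
  ultimately have "(\<exists>x. P e x) \<longleftrightarrow>
      sat mem (Ex 1 (rename r \<phi>)) (merge e (case_nat undefined s))" for e
    using P[of "case_nat _ e"] by (simp add: sat_rename)
  then show ?thesis by (rule dfnI)
qed

lemma dfn_rename:
  assumes "dfn P" "inj r"
  shows "dfn (\<lambda>e. P (\<lambda>i. e (r i)))"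
proof -
  obtain \<phi> s where P: "\<And>e. P e \<longleftrightarrow> sat mem \<phi> (merge e s)"
    using assms(1) unfolding dfn_def by blast
  define q where "q k = (if even k then 2 * r (k div 2) else k)" for k :: nat
  have "inj q"
  proof (rule injI)
    fix k l assume "q k = q l"
    then have "even k = even l" "even k \<Longrightarrow> k div 2 = l div 2" "odd k \<Longrightarrow> k = l"
      using \<open>inj r\<close> by (auto simp: q_def inj_eq split: if_splits)
    then show "k = l"
      by (cases "even k") (metis dvd_mult_div_cancel, simp)
  qed
  moreover have "merge e s \<circ> q = merge (\<lambda>i. e (r i)) s" for e
    by (auto simp: fun_eq_iff merge_def q_def)
  ultimately show ?thesis
    by (intro dfnI[of _ "rename q \<phi>" s]) (simp add: P sat_rename)
qed

lemma dfn_disj [dfn, simp]: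
  assumes "dfn P" "dfn Q"
  shows "dfn (\<lambda>e. P e \<or> Q e)"
proof -
  have "dfn (\<lambda>e. \<not> (\<not> P e \<and> \<not> Q e))"
    by (intro dfn_not dfn_conj assms)
  then show ?thesis by simp
qed

lemma dfn_imp [dfn, simp]: "dfn P \<Longrightarrow> dfn Q \<Longrightarrow> dfn (\<lambda>e. P e \<longrightarrow> Q e)"
  unfolding imp_conv_disj by (intro dfn_disj dfn_not)

lemma dfn_iff [dfn, simp]: "dfn P \<Longrightarrow> dfn Q \<Longrightarrow> dfn (\<lambda>e. P e \<longleftrightarrow> Q e)"
  unfolding iff_conv_conj_imp by (intro dfn_conj dfn_imp)

lemma dfn_all [dfn, simp]:
  assumes "dfn (\<lambda>e. P (\<lambda>i. e (Suc i)) (e 0))"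
  shows "dfn (\<lambda>e. \<forall>x. P e x)"
proof -
  have "dfn (\<lambda>e. \<not> (\<exists>x. \<not> P e x))"
    by (intro dfn_not dfn_ex assms)
  then show ?thesis by simp
qed

section \<open>Definable operations and substitution\<close>

lemma trm_var [dfn, simp]: "trm (\<lambda>e. e i)"
  unfolding trm_def
  by (intro dfnI[of _ "Equal 0 (2 * Suc i)"]) (simp add: merge_def)

lemma trm_const [dfn, simp]: "trm (\<lambda>e. c)"
  unfolding trm_def
  by (intro dfnI[of _ "Equal 0 1" "\<lambda>_. c"]) (simp add: merge_def)

text \<open>An operation is known only through its graph, so substitution quantifies over the
  value.\<close>

lemma dfn_subst:
  assumes "dfn (\<lambda>e. P (e 0) (\<lambda>i. e (Suc i)))" "trm t"
  shows "dfn (\<lambda>e. P (t e) e)"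
proof -
  have "dfn (\<lambda>e. \<exists>x. x = t e \<and> P x e)"
    using assms unfolding trm_def by (intro dfn_ex dfn_conj)
  then show ?thesis by simp
qed

lemma trm_shift: "trm t \<Longrightarrow> trm (\<lambda>e. t (\<lambda>i. e (Suc i)))"
  unfolding trm_def
  by (drule dfn_rename[where r = "\<lambda>i. if i = 0 then 0 else Suc i"]) (simp_all add: inj_def)

lemma dfn1_subst: "dfn1 P \<Longrightarrow> trm t \<Longrightarrow> dfn (\<lambda>e. P (t e))"
  using dfn_subst[of "\<lambda>x e. P x" t] by simp

lemma dfn2_subst:
  assumes "dfn2 R" "trm t" "trm u"
  shows "dfn (\<lambda>e. R (t e) (u e))"
proof -
  \<comment> \<open>The inner of the two quantifiers below, for the value of \<open>u\<close>, binds
    entry 0; the arguments of \<open>R\<close> are swapped to match.\<close>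
  have "dfn (\<lambda>e. R (e (Suc 0)) (e 0))"
    using dfn_rename[OF assms(1), of "\<lambda>i. if i = 0 then Suc 0 else if i = 1 then 0 else i"]
    by (simp add: inj_def)
  then have "dfn (\<lambda>e. \<exists>x. x = t e \<and> (\<exists>y. y = u e \<and> R x y))"
    using assms(2) trm_shift[OF assms(3)] unfolding trm_def by (intro dfn_ex dfn_conj)
  then show ?thesis by simp
qed

lemma dfn_eq [dfn, simp]: "trm t \<Longrightarrow> trm u \<Longrightarrow> dfn (\<lambda>e. t e = u e)"
  by (rule dfn2_subst[of "(=)"], rule dfnI[of _ "Equal 0 2"]) (simp_all add: merge_def)

lemma dfn_mem [dfn, simp]: "trm t \<Longrightarrow> trm u \<Longrightarrow> dfn (\<lambda>e. mem (t e) (u e))"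
  by (rule dfn2_subst[of mem], rule dfnI[of _ "Mem 0 2"]) (simp_all add: merge_def)

lemma dfn_elts [dfn, simp]: "trm t \<Longrightarrow> trm u \<Longrightarrow> dfn (\<lambda>e. t e \<in> elts (u e))"
  using dfn_mem by (simp add: elts_def)

lemma trm_subst:
  assumes "trm (\<lambda>e. F (e 0) (\<lambda>i. e (Suc i)))" "trm t"
  shows "trm (\<lambda>e. F (t e) e)"
proof -
  have "dfn (\<lambda>e. e (Suc 0) = F (e 0) (\<lambda>i. e (Suc (Suc i))))"
    using dfn_rename[OF assms(1)[unfolded trm_def],
        of "\<lambda>i. if i = 0 then Suc 0 else if i = 1 then 0 else i"]
    by (simp add: inj_def)
  from dfn_subst[of "\<lambda>x e. e 0 = F x (\<lambda>i. e (Suc i))", OF this trm_shift[OF assms(2)]]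
  show ?thesis by (simp add: trm_def)
qed

lemma trm1_subst: "trm1 F \<Longrightarrow> trm t \<Longrightarrow> trm (\<lambda>e. F (t e))"
  using trm_subst[of "\<lambda>x e. F x"] .

lemma trm2_subst:
  assumes "trm2 F" "trm t" "trm u"
  shows "trm (\<lambda>e. F (t e) (u e))"
proof (rule trm_subst[where F = "\<lambda>x e. F x (u e)"])
  have "trm (\<lambda>e. F (e (Suc 0)) (e 0))"
    unfolding trm_def
    using dfn_rename[OF assms(1)[unfolded trm_def],
        of "\<lambda>i. if i = 1 then Suc (Suc 0) else if i = 2 then Suc 0 else i"]
    by (simp add: inj_def numeral_2_eq_2)
  from trm_subst[of "\<lambda>x e. F (e 0) x", OF this trm_shift[OF assms(3)]]
  show "trm (\<lambda>e. F (e 0) (u (\<lambda>i. e (Suc i))))" .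
qed (rule assms)

lemma dfn_shift1:
  "dfn (\<lambda>e. P (\<lambda>i. e (Suc i)) (e 0)) \<Longrightarrow> dfn (\<lambda>e. P (\<lambda>i. e (Suc (Suc i))) (e 0))"
  by (drule dfn_rename[where r = "\<lambda>i. if i = 0 then 0 else Suc i"]) (simp_all add: inj_def)

lemma trm_shift1:
  "trm (\<lambda>e. F (\<lambda>i. e (Suc i)) (e 0)) \<Longrightarrow> trm (\<lambda>e. F (\<lambda>i. e (Suc (Suc i))) (e 0))"
  unfolding trm_def
  by (drule dfn_rename[where r = "\<lambda>i. if i = 0 then 0 else if i = 1 then 1 else Suc i"])
    (simp_all add: inj_def)

lemma dfn_bex [dfn, simp]:
  "trm t \<Longrightarrow> dfn (\<lambda>e. P (\<lambda>i. e (Suc i)) (e 0)) \<Longrightarrow> dfn (\<lambda>e. \<exists>x\<in>elts (t e). P e x)"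
  unfolding Bex_def by (intro dfn) (erule trm_shift)

lemma dfn_ball [dfn, simp]:
  "trm t \<Longrightarrow> dfn (\<lambda>e. P (\<lambda>i. e (Suc i)) (e 0)) \<Longrightarrow> dfn (\<lambda>e. \<forall>x\<in>elts (t e). P e x)"
  unfolding Ball_def by (intro dfn) (erule trm_shift)

lemma dfn_subset [dfn, simp]: "trm t \<Longrightarrow> trm u \<Longrightarrow> dfn (\<lambda>e. elts (t e) \<subseteq> elts (u e))"
  unfolding subset_iff by (intro dfn) (erule trm_shift)+

lemma trm_if [dfn, simp]:
  assumes "dfn P" "trm t" "trm u"
  shows "trm (\<lambda>e. if P e then t e else u e)"
proof -
  have "dfn (\<lambda>e. (P (\<lambda>i. e (Suc i)) \<longrightarrow> e 0 = t (\<lambda>i. e (Suc i))) \<and>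
    (\<not> P (\<lambda>i. e (Suc i)) \<longrightarrow> e 0 = u (\<lambda>i. e (Suc i))))"
    using dfn_rename[OF assms(1), of Suc] by (intro dfn trm_shift[OF assms(2)] trm_shift[OF assms(3)]) simp_all
  moreover have "(\<lambda>e. (P (\<lambda>i. e (Suc i)) \<longrightarrow> e 0 = t (\<lambda>i. e (Suc i))) \<and>
    (\<not> P (\<lambda>i. e (Suc i)) \<longrightarrow> e 0 = u (\<lambda>i. e (Suc i)))) =
    (\<lambda>e. e 0 = (if P (\<lambda>i. e (Suc i)) then t (\<lambda>i. e (Suc i)) else u (\<lambda>i. e (Suc i))))"
    by auto
  ultimately show ?thesis unfolding trm_def by simp
qed

text \<open>The formula is fixed outside the model, so induction on it suffices and no truth
  predicate arises. The theorem of Los relies on this to apply \<open>AE\<close> to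
  satisfaction.\<close>

lemma dfn_sat [dfn, simp]: "(\<And>i. trm (t i)) \<Longrightarrow> dfn (\<lambda>e. sat mem \<phi> (\<lambda>i. t i e))"
proof (induction \<phi> arbitrary: t)
  case (Ex k \<phi>)
  have "(\<lambda>i. t i e)(k := x) = (\<lambda>i. if i = k then x else t i e)" for e x
    by auto
  moreover have "dfn (\<lambda>e. \<exists>x. sat mem \<phi> (\<lambda>i. if i = k then x else t i e))"
    by (rule dfn_ex, rule Ex.IH) (intro dfn trm_shift[OF Ex.prems])
  ultimately show ?case
    by (simp only: sat.simps)
qed (simp_all add: dfn_mem dfn_eq dfn_not dfn_conj)

end

section \<open>Set operations in a model\<close>

context ZFC_model
begin

lemma elts_eq_iff: "elts x = elts y \<longleftrightarrow> x = y"
  using extensionality by blast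

definition small :: "'v set \<Rightarrow> bool" where
  "small S \<longleftrightarrow> (\<exists>x. elts x = S)"

definition mk :: "'v set \<Rightarrow> 'v" where
  "mk S = (if small S then THE x. elts x = S else undefined)"

lemma elts_mk [simp]: "small S \<Longrightarrow> elts (mk S) = S"
proof -
  assume "small S"
  moreover from this obtain x where "elts x = S" unfolding small_def ..
  moreover from this have "(THE y. elts y = S) = x"
    by (intro the_equality) (simp_all flip: elts_eq_iff)
  ultimately show ?thesis by (simp add: mk_def)
qed

lemma mk_elts [simp]: "mk (elts x) = x"
  by (metis elts_eq_iff elts_mk small_def)

lemma small_elts [simp]: "small (elts x)"
  unfolding small_def by blast

lemma mk_eqI: "elts x = S \<Longrightarrow> mk S = x"
  by auto

text \<open>\<open>mk\<close> is total, so the graph must also cover classes that are not sets;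
  there the value is the parameter \<open>undefined\<close>.\<close>

lemma trm_mk [dfn, simp]:
  assumes "dfn (\<lambda>e. P (\<lambda>i. e (Suc i)) (e 0))"
  shows "trm (\<lambda>e. mk {x. P e x})"
proof -
  note P = dfn_shift1[OF assms]
  note P' = dfn_shift1[of "\<lambda>e. P (\<lambda>i. e (Suc i))", OF P]
  have "dfn (\<lambda>e. (\<forall>z. z \<in> elts (e 0) \<longleftrightarrow> P (\<lambda>i. e (Suc i)) z) \<or>
      \<not> (\<exists>x. \<forall>z. z \<in> elts x \<longleftrightarrow> P (\<lambda>i. e (Suc i)) z) \<and> e 0 = undefined)"
    using P P' by (intro dfn)
  moreover have "(y = mk {x. P e x}) \<longleftrightarrow> (\<forall>z. z \<in> elts y \<longleftrightarrow> P e z) \<or>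
      \<not> (\<exists>x. \<forall>z. z \<in> elts x \<longleftrightarrow> P e z) \<and> y = undefined" for y e
  proof (cases "small {x. P e x}")
    case True
    then have "\<exists>x. \<forall>z. z \<in> elts x \<longleftrightarrow> P e z"
      unfolding small_def by blast
    moreover have "y = mk {x. P e x} \<longleftrightarrow> elts y = {x. P e x}"
      using True elts_eq_iff[of y "mk {x. P e x}"] by simp
    ultimately show ?thesis by auto
  next
    case False
    then have "\<not> (\<exists>x. \<forall>z. z \<in> elts x \<longleftrightarrow> P e z)"
      unfolding small_def by blast
    with False show ?thesis by (auto simp: mk_def)
  qed
  ultimately show ?thesis unfolding trm_def by simp
qed

lemma small_Collect:
  assumes "dfn1 P" "{x. P x} \<subseteq> elts a"
  shows "small {x. P x}"
proof -
  obtain \<phi> s where P: "\<And>e. P (e 0) \<longleftrightarrow> sat mem \<phi> (merge e s)"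
    using assms(1) unfolding dfn_def by blast
  define r where "r k = (if k = 0 then 0 else Suc k)" for k :: nat
  have "inj r" by (auto simp: r_def inj_def)
  define t where "t k = merge (\<lambda>i. undefined) s (k - 1)" for k
  have t: "(t(0 := z)) \<circ> r = merge (case_nat z (\<lambda>i. undefined)) s" for z
    by (auto simp: fun_eq_iff merge_def r_def t_def split: nat.split elim!: evenE)
  have "sat mem (rename r \<phi>) (t(0 := z)) \<longleftrightarrow> P z" for z
    using P[of "case_nat z (\<lambda>i. undefined)"]
    by (simp only: sat_rename[OF \<open>inj r\<close>] t nat.case)
  then have "\<exists>y. elts y = {z \<in> elts a. P z}"
    using separation[of a "rename r \<phi>" t] by (simp only:)
  moreover have "{z \<in> elts a. P z} = {x. P x}"
    using assms(2) by blast
  ultimately show ?thesis unfolding small_def by simp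
qed

lemma small_sep [simp]: "dfn1 P \<Longrightarrow> small {x \<in> elts a. P x}"
  by (intro small_Collect[of _ a]) (auto intro!: dfn)

lemma small_Int [simp]: "small (elts a \<inter> elts b)"
  using small_sep[of "\<lambda>x. x \<in> elts b" a] by (simp add: Int_def)

lemma small_Diff [simp]: "small (elts a - elts b)"
  using small_sep[of "\<lambda>x. x \<notin> elts b" a] by (simp add: set_diff_eq)

lemma small_empty [simp]: "small {}"
  using small_Diff[of undefined undefined] by simp

lemma small_insert [simp]: "small S \<Longrightarrow> small (insert x S)"
proof -
  assume "small S"
  then obtain s where s: "elts s = S" unfolding small_def by blast
  obtain x1 where "elts x1 = {x}" using pairing[of x x] by auto
  moreover obtain p where "elts p = {s, x1}" using pairing by blast
  moreover obtain u where "elts u = (\<Union>y\<in>elts p. elts y)" using union by blast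
  ultimately have "elts u = insert x S" using s by auto
  then show ?thesis unfolding small_def by blast
qed

lemma small_Union: "small S \<Longrightarrow> small (\<Union> (elts ` S))"
  unfolding small_def using union by metis

lemma small_Un [simp]: "small S \<Longrightarrow> small T \<Longrightarrow> small (S \<union> T)"
  using small_Union[of "{mk S, mk T}"] by simp

lemma small_finite: "finite S \<Longrightarrow> small S"
  by (induction rule: finite_induct) auto

lemma small_Pow [simp]: "small {x. elts x \<subseteq> elts a}"
  using power[of a] unfolding small_def powerset_def by blast

lemma small_image [simp]:
  assumes "trm1 F"
  shows "small (F ` elts a)"
proof -
  have "dfn (\<lambda>e. e (Suc 0) = F (e 0))"
    by (intro dfn trm1_subst[OF assms])
  then obtain \<phi> s where P: "\<And>e. e (Suc 0) = F (e 0) \<longleftrightarrow> sat mem \<phi> (merge e s)"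
    unfolding dfn_def by blast
  \<comment> \<open>In the graph of \<open>F\<close> the argument and the value are variables 0 and
    2; the replacement schema wants them at 0 and 1.\<close>
  define r where "r k = (if k = 0 then 0 else if k = 2 then 1 else k + 2)" for k :: nat
  have "inj r" by (auto simp: r_def inj_def)
  define t where "t k = merge (\<lambda>i. undefined) s (k - 2)" for k
  have t: "(t(0 := u, 1 := v)) \<circ> r = merge (case_nat u (case_nat v (\<lambda>i. undefined))) s" for u v
    by (auto simp: fun_eq_iff merge_def r_def t_def split: nat.split elim!: evenE)
  have *: "sat mem (rename r \<phi>) (t(0 := u, 1 := v)) \<longleftrightarrow> v = F u" for u v
    using P[of "case_nat u (case_nat v (\<lambda>i. undefined))"]
    by (simp only: sat_rename[OF \<open>inj r\<close>] t nat.case)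
  have "\<exists>y. elts y = {v. \<exists>u \<in> elts a. sat mem (rename r \<phi>) (t(0 := u, 1 := v))}"
    by (rule replacement) (simp only: *)
  then have "\<exists>y. elts y = {v. \<exists>u \<in> elts a. v = F u}"
    by (simp only: *)
  then show ?thesis
    by (simp only: small_def image_def)
qed

section \<open>The basic set operations\<close>

definition sep :: "'v \<Rightarrow> ('v \<Rightarrow> bool) \<Rightarrow> 'v" where
  "sep A P = mk {x. x \<in> elts A \<and> P x}"

definition rep :: "'v \<Rightarrow> ('v \<Rightarrow> 'v) \<Rightarrow> 'v" where
  "rep A F = mk {y. \<exists>x\<in>elts A. y = F x}"

definition zero :: 'v where "zero = mk {}"

definition upair :: "'v \<Rightarrow> 'v \<Rightarrow> 'v" where
  "upair x y = mk {z. z = x \<or> z = y}"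

definition vunion :: "'v \<Rightarrow> 'v" where
  "vunion x = mk {z. \<exists>y\<in>elts x. z \<in> elts y}"

definition vun :: "'v \<Rightarrow> 'v \<Rightarrow> 'v" where
  "vun x y = mk {z. z \<in> elts x \<or> z \<in> elts y}"

definition diff :: "'v \<Rightarrow> 'v \<Rightarrow> 'v" where
  "diff x y = mk {z. z \<in> elts x \<and> z \<notin> elts y}"

definition pow :: "'v \<Rightarrow> 'v" where
  "pow x = mk {z. elts z \<subseteq> elts x}"

definition suc :: "'v \<Rightarrow> 'v" where
  "suc x = mk {z. z = x \<or> z \<in> elts x}"

definition pair :: "'v \<Rightarrow> 'v \<Rightarrow> 'v" where
  "pair x y = upair (upair x x) (upair x y)"

text \<open>Collecting the elements of the component gives the component itself, without a
  description operator; the value is \<open>zero\<close> if \<open>p\<close> is not a pair.\<close>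

definition pfst :: "'v \<Rightarrow> 'v" where
  "pfst p = mk {z. \<exists>x y. p = pair x y \<and> z \<in> elts x}"

definition psnd :: "'v \<Rightarrow> 'v" where
  "psnd p = mk {z. \<exists>x y. p = pair x y \<and> z \<in> elts y}"

definition prod :: "'v \<Rightarrow> 'v \<Rightarrow> 'v" where
  "prod A B = mk {p. \<exists>x\<in>elts A. \<exists>y\<in>elts B. p = pair x y}"

text \<open>Taking the union of the values spares a description operator; the value is \<^term>\<open>zero\<close>
  outside the domain.\<close>

definition app :: "'v \<Rightarrow> 'v \<Rightarrow> 'v" where
  "app f x = mk {z. \<exists>y. pair x y \<in> elts f \<and> z \<in> elts y}"

definition lam :: "'v \<Rightarrow> ('v \<Rightarrow> 'v) \<Rightarrow> 'v" where
  "lam A F = mk {p. \<exists>x\<in>elts A. p = pair x (F x)}"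

text \<open>The equation says that \<open>f\<close> consists of pairs, is single-valued and has
  domain exactly \<open>A\<close>. Functions with the same values are therefore equal.\<close>

definition funs :: "'v \<Rightarrow> 'v \<Rightarrow> 'v" where
  "funs A B = mk {f. f = lam A (app f) \<and> (\<forall>x\<in>elts A. app f x \<in> elts B)}"

lemma trm_sep [dfn, simp]:
  "trm t \<Longrightarrow> dfn (\<lambda>e. P (\<lambda>i. e (Suc i)) (e 0)) \<Longrightarrow> trm (\<lambda>e. sep (t e) (P e))"
  unfolding sep_def by (intro dfn) (erule trm_shift)

lemma trm_upair [dfn, simp]: "trm t \<Longrightarrow> trm u \<Longrightarrow> trm (\<lambda>e. upair (t e) (u e))"
  unfolding upair_def by (intro dfn) (erule trm_shift)+

lemma trm_vunion [dfn, simp]: "trm t \<Longrightarrow> trm (\<lambda>e. vunion (t e))"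
  unfolding vunion_def by (intro dfn) (erule trm_shift)+

lemma trm_vun [dfn, simp]: "trm t \<Longrightarrow> trm u \<Longrightarrow> trm (\<lambda>e. vun (t e) (u e))"
  unfolding vun_def by (intro dfn) (erule trm_shift)+

lemma trm_diff [dfn, simp]: "trm t \<Longrightarrow> trm u \<Longrightarrow> trm (\<lambda>e. diff (t e) (u e))"
  unfolding diff_def by (intro dfn) (erule trm_shift)+

lemma trm_pow [dfn, simp]: "trm t \<Longrightarrow> trm (\<lambda>e. pow (t e))"
  unfolding pow_def by (intro dfn) (erule trm_shift)+

lemma trm_suc [dfn, simp]: "trm t \<Longrightarrow> trm (\<lambda>e. suc (t e))"
  unfolding suc_def by (intro dfn) (erule trm_shift)+

lemma trm_pair [dfn, simp]: "trm t \<Longrightarrow> trm u \<Longrightarrow> trm (\<lambda>e. pair (t e) (u e))"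
  unfolding pair_def by (intro dfn)

lemma trm_pfst [dfn, simp]: "trm t \<Longrightarrow> trm (\<lambda>e. pfst (t e))"
  by (rule trm1_subst[of pfst]) (unfold pfst_def, intro dfn)

lemma trm_psnd [dfn, simp]: "trm t \<Longrightarrow> trm (\<lambda>e. psnd (t e))"
  by (rule trm1_subst[of psnd]) (unfold psnd_def, intro dfn)

lemma trm_rep [dfn, simp]:
  "trm t \<Longrightarrow> trm (\<lambda>e. F (\<lambda>i. e (Suc i)) (e 0)) \<Longrightarrow> trm (\<lambda>e. rep (t e) (F e))"
  unfolding rep_def
  by (intro dfn) (erule trm_shift, erule trm_shift1)

lemma trm_lam [dfn, simp]:
  "trm t \<Longrightarrow> trm (\<lambda>e. F (\<lambda>i. e (Suc i)) (e 0)) \<Longrightarrow> trm (\<lambda>e. lam (t e) (F e))"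
  unfolding lam_def
  by (intro dfn) (erule trm_shift, erule trm_shift1)

lemma trm_prod [dfn, simp]: "trm t \<Longrightarrow> trm u \<Longrightarrow> trm (\<lambda>e. prod (t e) (u e))"
  by (rule trm2_subst[of prod]) (unfold prod_def, intro dfn)

lemma trm_app [dfn, simp]: "trm t \<Longrightarrow> trm u \<Longrightarrow> trm (\<lambda>e. app (t e) (u e))"
  by (rule trm2_subst[of app]) (unfold app_def, intro dfn)

lemma trm_funs [dfn, simp]: "trm t \<Longrightarrow> trm u \<Longrightarrow> trm (\<lambda>e. funs (t e) (u e))"
  by (rule trm2_subst[of funs]) (unfold funs_def, intro dfn)

lemma elts_sep [simp]: "dfn1 P \<Longrightarrow> elts (sep A P) = {x \<in> elts A. P x}"
  by (simp add: sep_def)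

lemma elts_rep [simp]: "trm1 F \<Longrightarrow> elts (rep A F) = F ` elts A"
  using small_image[of F A] by (simp add: rep_def image_def)

lemma elts_zero [simp]: "elts zero = {}"
  by (simp add: zero_def)

lemma elts_upair [simp]: "elts (upair x y) = {x, y}"
proof -
  have "{z. z = x \<or> z = y} = {x, y}" by auto
  then show ?thesis by (simp add: upair_def)
qed

lemma elts_vunion [simp]: "elts (vunion x) = (\<Union>y\<in>elts x. elts y)"
proof -
  have "{z. \<exists>y\<in>elts x. z \<in> elts y} = \<Union> (elts ` elts x)" by auto
  then show ?thesis using small_Union[of "elts x"] by (simp add: vunion_def)
qed

lemma elts_vun [simp]: "elts (vun x y) = elts x \<union> elts y"
  by (simp add: vun_def flip: Un_def)

lemma elts_diff [simp]: "elts (diff x y) = elts x - elts y"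
  by (simp add: diff_def flip: set_diff_eq)

lemma elts_pow [simp]: "elts (pow x) = {z. elts z \<subseteq> elts x}"
  by (simp add: pow_def)

lemma elts_suc [simp]: "elts (suc x) = insert x (elts x)"
proof -
  have "{z. z = x \<or> z \<in> elts x} = insert x (elts x)" by auto
  then show ?thesis by (simp add: suc_def)
qed

lemma upair_eq_iff: "upair x y = upair z w \<longleftrightarrow> x = z \<and> y = w \<or> x = w \<and> y = z"
  using elts_eq_iff[of "upair x y" "upair z w"] by (auto simp: doubleton_eq_iff)

lemma pair_eq_iff [simp]: "pair x y = pair z w \<longleftrightarrow> x = z \<and> y = w"
  by (auto simp: pair_def upair_eq_iff)

lemma pfst_pair [simp]: "pfst (pair x y) = x"
  by (simp add: pfst_def)

lemma psnd_pair [simp]: "psnd (pair x y) = y"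
  by (simp add: psnd_def)

lemma opair_iff: "opair z x y \<longleftrightarrow> z = pair x y"
proof
  assume "opair z x y"
  then obtain a b where "elts a = {x}" "elts b = {x, y}" "elts z = {a, b}"
    unfolding opair_def by blast
  then show "z = pair x y"
    using elts_eq_iff[of a "upair x x"] elts_eq_iff[of b "upair x y"] elts_eq_iff[of z "pair x y"]
    by (simp add: pair_def)
next
  show "z = pair x y \<Longrightarrow> opair z x y"
    unfolding opair_def pair_def
    by (intro exI[of _ "upair x x"] exI[of _ "upair x y"]) simp
qed

lemma rel_iff: "rel r x y \<longleftrightarrow> pair x y \<in> elts r"
  by (simp add: rel_def opair_iff)

lemma dfn_rel [dfn, simp]: "trm t \<Longrightarrow> trm u \<Longrightarrow> trm r \<Longrightarrow> dfn (\<lambda>e. rel (r e) (t e) (u e))"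
  unfolding rel_iff by (intro dfn)

lemma elts_prod [simp]: "elts (prod A B) = {pair x y | x y. x \<in> elts A \<and> y \<in> elts B}"
proof -
  have "{p. \<exists>x\<in>elts A. \<exists>y\<in>elts B. p = pair x y} \<subseteq> elts (pow (pow (vun A B)))"
    by (auto simp: pair_def)
  then have "small {p. \<exists>x\<in>elts A. \<exists>y\<in>elts B. p = pair x y}"
    by (rule small_Collect[rotated]) (intro dfn)
  then show ?thesis by (auto simp: prod_def)
qed

lemma elts_lam [simp]: "trm1 F \<Longrightarrow> elts (lam A F) = (\<lambda>x. pair x (F x)) ` elts A"
  using small_image[of "\<lambda>x. pair x (F x)" A] by (simp add: lam_def image_def)

lemma app_eqI: "pair x y \<in> elts f \<Longrightarrow> (\<And>z. pair x z \<in> elts f \<Longrightarrow> z = y) \<Longrightarrow> app f x = y"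
  unfolding app_def by (intro mk_eqI) blast

lemma app_lam [simp]: "trm1 F \<Longrightarrow> x \<in> elts A \<Longrightarrow> app (lam A F) x = F x"
  by (rule app_eqI) auto

lemma lam_cong: "(\<And>x. x \<in> elts A \<Longrightarrow> F x = G x) \<Longrightarrow> lam A F = lam A G"
  unfolding lam_def by (rule arg_cong[of _ _ mk]) auto

lemma elts_funs: "elts (funs A B) = {f. f = lam A (app f) \<and> (\<forall>x\<in>elts A. app f x \<in> elts B)}"
proof -
  have "f \<in> elts (pow (prod A B))" if "f = lam A (app f)" "\<forall>x\<in>elts A. app f x \<in> elts B" for f
  proof -
    have "elts f = (\<lambda>x. pair x (app f x)) ` elts A"
      by (subst that(1)) simp
    with that(2) show ?thesis by auto
  qed
  then have "small {f. f = lam A (app f) \<and> (\<forall>x\<in>elts A. app f x \<in> elts B)}"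
    by (intro small_Collect[of _ "pow (prod A B)"]) (auto intro!: dfn)
  then show ?thesis by (simp add: funs_def)
qed

lemma app_in: "f \<in> elts (funs A B) \<Longrightarrow> x \<in> elts A \<Longrightarrow> app f x \<in> elts B"
  by (simp add: elts_funs)

lemma lam_in_funs: "trm1 F \<Longrightarrow> (\<And>x. x \<in> elts A \<Longrightarrow> F x \<in> elts B) \<Longrightarrow> lam A F \<in> elts (funs A B)"
  by (auto simp: elts_funs intro!: lam_cong)

lemma funs_eqI:
  assumes "f \<in> elts (funs A B)" "g \<in> elts (funs A C)" "\<And>x. x \<in> elts A \<Longrightarrow> app f x = app g x"
  shows "f = g"
  using assms lam_cong[of A "app f" "app g"] by (simp add: elts_funs)

lemma funs_mono: "f \<in> elts (funs A B) \<Longrightarrow> elts B \<subseteq> elts C \<Longrightarrow> f \<in> elts (funs A C)"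
  by (auto simp: elts_funs)

lemma function_between_app:
  assumes "function_between f A B" "a \<in> elts A"
  shows "rel f a b \<longleftrightarrow> app f a = b" and "app f a \<in> elts B"
proof -
  obtain c where c: "rel f a c" "\<And>d. rel f a d \<Longrightarrow> d = c"
    using assms unfolding function_between_def by blast
  then have "app f a = c"
    unfolding rel_iff by (rule app_eqI)
  with c show "rel f a b \<longleftrightarrow> app f a = b"
    by blast
  from c have "c \<in> elts B"
    using assms(1) unfolding function_between_def relation_between_def rel_iff opair_iff
    by (metis pair_eq_iff)
  then show "app f a \<in> elts B" using \<open>app f a = c\<close> by simp
qed

lemma function_between_lam:
  assumes "trm1 F" "\<And>x. x \<in> elts A \<Longrightarrow> F x \<in> elts B"
  shows "function_between (lam A F) A B"
  using assms by (auto simp: function_between_def relation_between_def opair_iff rel_iff)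

lemma not_mem_self: "x \<notin> elts x"
  using foundation[of "upair x x"] by auto

lemma not_mem_sym: "x \<in> elts y \<Longrightarrow> y \<notin> elts x"
  using foundation[of "upair x y"] by auto

text \<open>Disjointifying the fibres over \<^term>\<open>A\<close> reduces the claim to the axiom of choice.\<close>

lemma choice_fun:
  assumes R: "dfn2 R" and ex: "\<And>x. x \<in> elts A \<Longrightarrow> \<exists>y\<in>elts B. R x y"
  obtains f where "f \<in> elts (funs A B)" "\<And>x. x \<in> elts A \<Longrightarrow> R x (app f x)"
proof -
  note dfn_R [dfn, simp] = dfn2_subst[OF R]
  define fib where "fib x = sep (prod A B) (\<lambda>p. pfst p = x \<and> R x (psnd p))" for x
  have [simp]: "trm1 fib"
    unfolding fib_def by simp
  have fib: "p \<in> elts (fib x) \<longleftrightarrow> (\<exists>y\<in>elts B. p = pair x y \<and> R x y)" if "x \<in> elts A" for p x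
    using that by (auto simp: fib_def)
  have "\<exists>c. \<forall>u \<in> elts (rep A fib). \<exists>!z. z \<in> elts u \<inter> elts c"
  proof (rule choice)
    fix u assume "u \<in> elts (rep A fib)"
    then show "elts u \<noteq> {}"
      using ex fib by fastforce
  next
    fix u v assume "u \<in> elts (rep A fib)" "v \<in> elts (rep A fib)" "u \<noteq> v"
    then obtain x x' where "u = fib x" "x \<in> elts A" "v = fib x'" "x' \<in> elts A" "x \<noteq> x'"
      by auto
    then show "elts u \<inter> elts v = {}"
      using fib by auto
  qed
  then obtain c where "\<forall>u \<in> elts (rep A fib). \<exists>!z. z \<in> elts u \<inter> elts c" ..
  then have c: "\<exists>!z. z \<in> elts (fib x) \<inter> elts c" if "x \<in> elts A" for x
    using that by simp
  have *: "app c' x \<in> elts B \<and> R x (app c' x)"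
    if x: "x \<in> elts A" and c': "c' = sep c (\<lambda>p. \<exists>x\<in>elts A. p \<in> elts (fib x))" for x c'
  proof -
    obtain z where z: "z \<in> elts (fib x)" "z \<in> elts c" "\<And>w. w \<in> elts (fib x) \<Longrightarrow> w \<in> elts c \<Longrightarrow> w = z"
      using c[OF x] by blast
    then obtain y where y: "y \<in> elts B" "z = pair x y" "R x y"
      using fib[OF x] by blast
    have elts_c: "elts c' = {p \<in> elts c. \<exists>x\<in>elts A. p \<in> elts (fib x)}"
      unfolding c' by (rule elts_sep) (intro dfn trm1_subst[OF \<open>trm1 fib\<close>])
    have "app c' x = y"
    proof (rule app_eqI)
      show "pair x y \<in> elts c'"
        using z(1,2) y(2) x by (auto simp: elts_c)
      show "w = y" if "pair x w \<in> elts c'" for w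
      proof -
        from that obtain x' where "x' \<in> elts A" "pair x w \<in> elts (fib x')" "pair x w \<in> elts c"
          by (auto simp: elts_c)
        moreover from this fib have "x' = x" by auto
        ultimately show "w = y" using z(3)[of "pair x w"] y(2) by auto
      qed
    qed
    then show ?thesis using y by simp
  qed
  define c' where "c' = sep c (\<lambda>p. \<exists>x\<in>elts A. p \<in> elts (fib x))"
  show thesis
  proof (rule that[of "lam A (app c')"])
    show "lam A (app c') \<in> elts (funs A B)"
      by (rule lam_in_funs) (use * c'_def in simp_all)
    show "R x (app (lam A (app c')) x)" if "x \<in> elts A" for x
      using * c'_def that by simp
  qed
qed

end

section \<open>Wellfounded recursion\<close>

context ZFC_model
begin

text \<open>Minimal elements are demanded only for subsets that are elements of the model. Hence
  induction along \<open>R\<close> needs a definability premise.\<close>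

definition wfon :: "('v \<Rightarrow> 'v \<Rightarrow> bool) \<Rightarrow> 'v \<Rightarrow> bool" where
  "wfon R A \<longleftrightarrow> (\<forall>S. elts S \<subseteq> elts A \<and> elts S \<noteq> {} \<longrightarrow> (\<exists>m\<in>elts S. \<forall>x\<in>elts S. \<not> R x m))"

lemma wfon_mem: "wfon mem A"
  using foundation by (fastforce simp: wfon_def elts_def)

lemma wfon_induct:
  assumes "wfon R A" "dfn1 P" "a \<in> elts A"
    and "\<And>a. a \<in> elts A \<Longrightarrow> (\<And>b. b \<in> elts A \<Longrightarrow> R b a \<Longrightarrow> P b) \<Longrightarrow> P a"
  shows "P a"
proof (rule ccontr)
  assume "\<not> P a"
  have S: "elts (sep A (\<lambda>x. \<not> P x)) = {x \<in> elts A. \<not> P x}"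
    using assms(2) by (intro elts_sep dfn)
  then obtain m where "m \<in> elts A" "\<not> P m" "\<And>x. x \<in> elts A \<Longrightarrow> \<not> P x \<Longrightarrow> \<not> R x m"
    using assms(1,3) \<open>\<not> P a\<close> unfolding wfon_def by (metis (no_types, lifting) empty_iff mem_Collect_eq subsetI)
  then show False using assms(4) by blast
qed

lemma rep_cong: "(\<And>x. x \<in> elts A \<Longrightarrow> F x = G x) \<Longrightarrow> rep A F = rep A G"
  unfolding rep_def by (rule arg_cong[of _ _ mk]) auto

text \<open>\<open>F\<close> is glued from approximations \<open>app q\<close> that obey the
  recursion on an \<open>R\<close>-closed set \<open>d\<close>; any two agree where both are
  defined. \<open>H\<close> receives the set of earlier values and not their graph, which is what a
  collapse wants.\<close>

lemma wf_recursion: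
  assumes wf: "wfon R A" and R: "dfn2 R" and H: "trm1 H"
  obtains F where "trm1 F" "\<And>a. a \<in> elts A \<Longrightarrow> F a = H (rep (sep A (\<lambda>b. R b a)) F)"
proof -
  note [dfn, simp] = dfn2_subst[OF R] trm1_subst[OF H]
  define pred where "pred a = sep A (\<lambda>b. R b a)" for a
  have "trm1 pred" unfolding pred_def by simp
  note [dfn, simp] = trm1_subst[OF this]
  have pred [simp]: "elts (pred a) = {b \<in> elts A. R b a}" for a
    by (simp add: pred_def)
  define appr where "appr q d \<longleftrightarrow> elts d \<subseteq> elts A \<and> (\<forall>a\<in>elts d. elts (pred a) \<subseteq> elts d) \<and>
    (\<forall>a\<in>elts d. app q a = H (rep (pred a) (app q)))" for q d
  have "dfn2 appr"
    unfolding appr_def by (intro dfn)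
  note [dfn, simp] = dfn2_subst[OF this]
  have uniq: "app q a = app q' a"
    if "appr q d" "appr q' d'" "a \<in> elts d" "a \<in> elts d'" for q d q' d' a
  proof -
    have "a \<in> elts A" using that by (auto simp: appr_def)
    have "a \<in> elts d \<longrightarrow> a \<in> elts d' \<longrightarrow> app q a = app q' a"
    proof (rule wfon_induct[OF wf _ \<open>a \<in> elts A\<close>])
      show "dfn1 (\<lambda>a. a \<in> elts d \<longrightarrow> a \<in> elts d' \<longrightarrow> app q a = app q' a)"
        by (intro dfn)
    next
      fix a assume a: "a \<in> elts A"
        and IH: "\<And>b. b \<in> elts A \<Longrightarrow> R b a \<Longrightarrow> b \<in> elts d \<longrightarrow> b \<in> elts d' \<longrightarrow> app q b = app q' b"
      show "a \<in> elts d \<longrightarrow> a \<in> elts d' \<longrightarrow> app q a = app q' a"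
      proof (intro impI)
        assume a': "a \<in> elts d" "a \<in> elts d'"
        then have "elts (pred a) \<subseteq> elts d" "elts (pred a) \<subseteq> elts d'"
          using that(1,2) unfolding appr_def by blast+
        then have "rep (pred a) (app q) = rep (pred a) (app q')"
          using IH by (intro rep_cong) auto
        then show "app q a = app q' a"
          using a' that(1,2) unfolding appr_def by metis
      qed
    qed
    with that show ?thesis by blast
  qed
  define F where "F b = mk {z. \<exists>q d. appr q d \<and> b \<in> elts d \<and> z \<in> elts (app q b)}" for b
  have "trm1 F" unfolding F_def by (intro dfn)
  note [dfn, simp] = trm1_subst[OF this]
  have F: "F b = app q b" if "appr q d" "b \<in> elts d" for b q d
  proof -
    have "z \<in> elts (app q b)" if "appr q' d'" "b \<in> elts d'" "z \<in> elts (app q' b)" for q' d' z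
      using uniq[OF that(1) \<open>appr q d\<close> that(2) \<open>b \<in> elts d\<close>] that(3) by simp
    then have "elts (app q b) = {z. \<exists>q d. appr q d \<and> b \<in> elts d \<and> z \<in> elts (app q b)}"
      using that by blast
    then show ?thesis
      unfolding F_def by (rule mk_eqI)
  qed
  define dom where "dom b \<longleftrightarrow> (\<exists>q d. appr q d \<and> b \<in> elts d)" for b
  have "dfn1 dom" unfolding dom_def by (intro dfn)
  note [dfn, simp] = dfn1_subst[OF this]
  have F_rec: "F b = H (rep (pred b) F)" if b: "dom b" for b
  proof -
    obtain q d where q: "appr q d" "b \<in> elts d" using b dom_def by blast
    then have "elts (pred b) \<subseteq> elts d" unfolding appr_def by blast
    with q F have "rep (pred b) F = rep (pred b) (app q)"
      by (intro rep_cong) blast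
    with q F show ?thesis unfolding appr_def by metis
  qed
  have pred_dom: "dom c" if "dom b" "c \<in> elts (pred b)" for b c
    using that unfolding dom_def appr_def by blast
  have "dom a" if "a \<in> elts A" for a
  proof (rule wfon_induct[OF wf \<open>dfn1 dom\<close> that])
    fix a assume a: "a \<in> elts A" and IH: "\<And>b. b \<in> elts A \<Longrightarrow> R b a \<Longrightarrow> dom b"
    define G where "G b = H (rep (pred b) F)" for b
    have "trm1 G" unfolding G_def by simp
    \<comment> \<open>All points that are already covered are taken along with \<open>a\<close>,
      which makes \<open>d\<close> closed under predecessors.\<close>
    define d where "d = sep A (\<lambda>b. b = a \<or> dom b)"
    have d: "elts d = {b \<in> elts A. b = a \<or> dom b}"
      by (simp add: d_def)
    have "appr (lam d G) d"
      unfolding appr_def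
    proof (intro conjI ballI)
      show "elts d \<subseteq> elts A" by (auto simp: d)
      fix b assume b: "b \<in> elts d"
      have dom_pred: "dom c" if "c \<in> elts (pred b)" for c
        using b that IH pred_dom unfolding d by auto
      then show sub: "elts (pred b) \<subseteq> elts d"
        unfolding d by auto
      have "rep (pred b) F = rep (pred b) (app (lam d G))"
      proof (rule rep_cong)
        fix c assume c: "c \<in> elts (pred b)"
        then have "c \<in> elts d" using sub by blast
        then show "F c = app (lam d G) c"
          using F_rec dom_pred c \<open>trm1 G\<close> by (simp add: G_def)
      qed
      then show "app (lam d G) b = H (rep (pred b) (app (lam d G)))"
        using b \<open>trm1 G\<close> by (simp add: G_def)
    qed
    then show "dom a" unfolding dom_def using a d by blast
  qed
  then show thesis
    using that[OF \<open>trm1 F\<close>] F_rec unfolding pred_def by blast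
qed

text \<open>Mostowski's collapse for a relation that may fail to be extensional, so distinct points
  can have the same image. For the ultrapower this is wanted: functions equal almost everywhere are
  identified.\<close>

lemma collapse:
  assumes "wfon R A" "dfn2 R"
  obtains F where "trm1 F" "\<And>a. a \<in> elts A \<Longrightarrow> elts (F a) = F ` {b \<in> elts A. R b a}"
proof -
  note [dfn, simp] = dfn2_subst[OF assms(2)]
  obtain F where F: "trm1 F" "\<And>a. a \<in> elts A \<Longrightarrow> F a = rep (sep A (\<lambda>b. R b a)) F"
    using wf_recursion[OF assms, of "\<lambda>x. x"] by auto
  have "elts (F a) = F ` {b \<in> elts A. R b a}" if "a \<in> elts A" for a
    by (subst F(2)[OF that]) (simp add: F(1))
  with F(1) show thesis by (rule that)
qed

section \<open>Transitive sets\<close>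

definition trans_set :: "'v \<Rightarrow> bool" where
  "trans_set x \<longleftrightarrow> (\<forall>y\<in>elts x. elts y \<subseteq> elts x)"

lemma dfn_trans_set [dfn, simp]: "trm t \<Longrightarrow> dfn (\<lambda>e. trans_set (t e))"
  by (rule dfn1_subst[of trans_set]) (unfold trans_set_def, intro dfn)

lemma trans_setD: "trans_set x \<Longrightarrow> y \<in> elts x \<Longrightarrow> z \<in> elts y \<Longrightarrow> z \<in> elts x"
  unfolding trans_set_def by blast

text \<open>The recursion runs along membership on the inductive set \<open>I\<close>. Since each
  \<open>n\<close> in \<open>I\<close> is an element of some \<open>m\<close> in \<open>I\<close>,
  elements of elements of \<open>F n\<close> reach \<open>F m\<close>, and the union of all stages
  is transitive.\<close>

lemma ex_trans_set: "\<exists>t. elts x \<subseteq> elts t \<and> trans_set t"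
proof -
  obtain I where I: "\<exists>e\<in>elts I. elts e = {}" "\<forall>n\<in>elts I. \<exists>m\<in>elts I. elts m = insert n (elts n)"
    using infinity by blast
  obtain F where F: "trm1 F"
    "\<And>n. n \<in> elts I \<Longrightarrow> F n = vun x (vunion (vunion (rep (sep I (\<lambda>m. mem m n)) F)))"
  proof (rule wf_recursion[OF wfon_mem])
    show "dfn2 mem" "trm1 (\<lambda>y. vun x (vunion (vunion y)))" by (intro dfn)+
  qed blast
  note [dfn, simp] = F(1)
  have elts_F: "elts (F n) = elts x \<union> \<Union> (elts ` (\<Union>m\<in>{m \<in> elts I. m \<in> elts n}. elts (F m)))"
    if "n \<in> elts I" for n
    by (subst F(2)[OF that]) (simp add: elts_def[of n])
  define t where "t = vunion (rep I F)"
  have t: "elts t = (\<Union>n\<in>elts I. elts (F n))"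
    by (simp add: t_def)
  have "elts x \<subseteq> elts t"
    using I(1) elts_F unfolding t by blast
  moreover have "trans_set t"
    unfolding trans_set_def
  proof (intro ballI subsetI)
    fix y z assume "y \<in> elts t" "z \<in> elts y"
    then obtain n where n: "n \<in> elts I" "y \<in> elts (F n)"
      unfolding t by blast
    then obtain m where m: "m \<in> elts I" "n \<in> elts m"
      using I(2) by blast
    then have "z \<in> elts (F m)"
      using n \<open>z \<in> elts y\<close> by (subst elts_F) blast+
    with m show "z \<in> elts t" unfolding t by blast
  qed
  ultimately show ?thesis by blast
qed

section \<open>Ordinals and cardinals\<close>

text \<open>Two nested membership inductions inside a transitive set containing both. If x and y are
  incomparable, the induction hypotheses put each element of one into the other, and extensionality
  gives x = y.\<close>

lemma hereditarily_trans_linear: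
  assumes "trans_set a" "\<forall>x\<in>elts a. trans_set x" "trans_set b" "\<forall>x\<in>elts b. trans_set x"
  shows "a \<in> elts b \<or> a = b \<or> b \<in> elts a"
proof -
  define A where "A = vun (vun a b) (upair a b)"
  have A: "elts A = elts a \<union> elts b \<union> {a, b}" by (auto simp: A_def)
  have tr: "z \<in> elts A" if "x \<in> elts A" "z \<in> elts x" for x z
    using that assms(1,3) unfolding A trans_set_def by blast
  have tA: "trans_set x" if "x \<in> elts A" for x
    using that assms unfolding A by blast
  define cmp where "cmp x y \<longleftrightarrow> x \<in> elts y \<or> x = y \<or> y \<in> elts x" for x y
  have "\<forall>y\<in>elts A. cmp x y" if "x \<in> elts A" for x
  proof (rule wfon_induct[OF wfon_mem _ that, of "\<lambda>x. \<forall>y\<in>elts A. cmp x y"])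
    show "dfn1 (\<lambda>x. \<forall>y\<in>elts A. cmp x y)"
      unfolding cmp_def by (intro dfn)
  next
    fix x assume x: "x \<in> elts A" and IHx: "\<And>z. z \<in> elts A \<Longrightarrow> mem z x \<Longrightarrow> \<forall>y\<in>elts A. cmp z y"
    show "\<forall>y\<in>elts A. cmp x y"
    proof
      fix y assume y: "y \<in> elts A"
      show "cmp x y"
      proof (rule wfon_induct[OF wfon_mem _ y, of "\<lambda>y. cmp x y"])
        show "dfn1 (\<lambda>y. cmp x y)"
          unfolding cmp_def by (intro dfn)
      next
        fix y assume y: "y \<in> elts A" and IHy: "\<And>z. z \<in> elts A \<Longrightarrow> mem z y \<Longrightarrow> cmp x z"
        show "cmp x y"
        proof (rule ccontr)
          assume n: "\<not> cmp x y"
          have "z \<in> elts y" if "z \<in> elts x" for z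
          proof -
            have "cmp z y" using IHx tr x y that by (simp add: elts_def)
            then show ?thesis
              using n that trans_setD[OF tA[OF x], of z y] unfolding cmp_def by blast
          qed
          moreover have "z \<in> elts x" if "z \<in> elts y" for z
          proof -
            have "cmp x z" using IHy tr y that by (simp add: elts_def)
            then show ?thesis
              using n that trans_setD[OF tA[OF y], of z x] unfolding cmp_def by blast
          qed
          ultimately have "x = y" by (auto intro: extensionality)
          then show False using n by (simp add: cmp_def)
        qed
      qed
    qed
  qed
  then show ?thesis unfolding A cmp_def by blast
qed

lemma mem_elts: "x \<in> elts y \<longleftrightarrow> mem x y"
  by (simp add: elts_def)

text \<open>Foundation supplies the wellordering. The hereditary form makes definability evident and
  passes easily to the ultrapower.\<close>

lemma ordinal_iff: "ordinal \<alpha> \<longleftrightarrow> trans_set \<alpha> \<and> (\<forall>\<beta>\<in>elts \<alpha>. trans_set \<beta>)"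
proof
  assume L: "ordinal \<alpha>"
  then have t: "trans_set \<alpha>" and tr: "transp_on (elts \<alpha>) mem"
    by (simp_all add: ordinal_def trans_set_def wellorders_def)
  then have "x \<in> elts z" if "x \<in> elts y" "y \<in> elts z" "z \<in> elts \<alpha>" for x y z
  proof -
    have "y \<in> elts \<alpha>" "x \<in> elts \<alpha>"
      using that trans_setD[OF t] by blast+
    with transp_onD[OF tr] that(3) have "mem x y \<Longrightarrow> mem y z \<Longrightarrow> mem x z"
      by blast
    with that show ?thesis by (simp add: mem_elts)
  qed
  then have "trans_set \<beta>" if "\<beta> \<in> elts \<alpha>" for \<beta>
    using that unfolding trans_set_def by blast
  with t show "trans_set \<alpha> \<and> (\<forall>\<beta>\<in>elts \<alpha>. trans_set \<beta>)"
    by blast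
next
  assume R: "trans_set \<alpha> \<and> (\<forall>\<beta>\<in>elts \<alpha>. trans_set \<beta>)"
  then have "\<forall>z\<in>elts x. trans_set z" if "x \<in> elts \<alpha>" for x
    using that trans_setD[of \<alpha>] by blast
  then have "x \<in> elts y \<or> x = y \<or> y \<in> elts x" if "x \<in> elts \<alpha>" "y \<in> elts \<alpha>" for x y
    using R that by (intro hereditarily_trans_linear) simp_all
  then have "mem x y \<or> mem y x" if "x \<in> elts \<alpha>" "y \<in> elts \<alpha>" "x \<noteq> y" for x y
    using that by (simp add: mem_elts) blast
  then have "totalp_on (elts \<alpha>) mem"
    by (rule totalp_onI)
  moreover have "transp_on (elts \<alpha>) mem"
  proof (rule transp_onI)
    fix x y z assume "z \<in> elts \<alpha>" "mem x y" "mem y z"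
    with R have "x \<in> elts z"
      using trans_setD[of z y x] by (simp add: mem_elts)
    then show "mem x z" by (simp add: mem_elts)
  qed
  moreover have "irreflp_on (elts \<alpha>) mem"
    using not_mem_self by (intro irreflp_onI) (simp add: mem_elts)
  ultimately show "ordinal \<alpha>"
    using R wfon_mem[of \<alpha>] by (simp add: ordinal_def wellorders_def wfon_def trans_set_def)
qed

lemma dfn_ordinal [dfn, simp]: "trm t \<Longrightarrow> dfn (\<lambda>e. ordinal (t e))"
  by (rule dfn1_subst[of ordinal]) (unfold ordinal_iff, intro dfn)

lemma ordinal_mem: "ordinal \<alpha> \<Longrightarrow> \<beta> \<in> elts \<alpha> \<Longrightarrow> ordinal \<beta>"
  unfolding ordinal_iff by (meson trans_setD)

lemma ordinal_mem_trans: "ordinal \<alpha> \<Longrightarrow> \<beta> \<in> elts \<alpha> \<Longrightarrow> \<gamma> \<in> elts \<beta> \<Longrightarrow> \<gamma> \<in> elts \<alpha>"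
  unfolding ordinal_iff by (meson trans_setD)

lemma ordinal_mem_subset: "ordinal \<alpha> \<Longrightarrow> \<beta> \<in> elts \<alpha> \<Longrightarrow> elts \<beta> \<subseteq> elts \<alpha>"
  using ordinal_mem_trans by blast

lemma ordinal_linear: "ordinal \<alpha> \<Longrightarrow> ordinal \<beta> \<Longrightarrow> \<alpha> \<in> elts \<beta> \<or> \<alpha> = \<beta> \<or> \<beta> \<in> elts \<alpha>"
  unfolding ordinal_iff by (meson hereditarily_trans_linear)

lemma ordinal_subset_iff:
  "ordinal \<alpha> \<Longrightarrow> ordinal \<beta> \<Longrightarrow> elts \<alpha> \<subseteq> elts \<beta> \<longleftrightarrow> \<alpha> \<in> elts \<beta> \<or> \<alpha> = \<beta>"
  using ordinal_linear ordinal_mem_subset not_mem_self by blast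

lemma ordinal_not_mem_iff:
  "ordinal \<alpha> \<Longrightarrow> ordinal \<beta> \<Longrightarrow> \<beta> \<notin> elts \<alpha> \<longleftrightarrow> elts \<alpha> \<subseteq> elts \<beta>"
  using ordinal_linear ordinal_mem_subset not_mem_self by blast

lemma ord_le_iff: "ordinal \<alpha> \<Longrightarrow> ordinal \<beta> \<Longrightarrow> ord_le \<alpha> \<beta> \<longleftrightarrow> elts \<alpha> \<subseteq> elts \<beta>"
  by (simp add: ordinal_subset_iff ord_le_def mem_elts)

lemma ordinal_subset_mem_trans:
  "ordinal \<alpha> \<Longrightarrow> ordinal \<gamma> \<Longrightarrow> elts \<alpha> \<subseteq> elts \<beta> \<Longrightarrow> ordinal \<beta> \<Longrightarrow> \<beta> \<in> elts \<gamma> \<Longrightarrow> \<alpha> \<in> elts \<gamma>"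
  using ordinal_subset_iff ordinal_mem_trans by blast

lemma ordinal_suc: "ordinal \<alpha> \<Longrightarrow> ordinal (suc \<alpha>)"
  unfolding ordinal_iff trans_set_def by auto

lemma ordinal_vun:
  assumes "ordinal \<alpha>" "ordinal \<beta>"
  shows "vun \<alpha> \<beta> = \<alpha> \<or> vun \<alpha> \<beta> = \<beta>"
  using ordinal_not_mem_iff[OF assms] ordinal_mem_subset[OF assms(1), of \<beta>]
  by (metis elts_eq_iff elts_vun sup.absorb1 sup.absorb2)

lemma least_ordinal:
  assumes "ordinal \<alpha>" "P \<alpha>" "dfn1 P"
  obtains \<beta> where "ordinal \<beta>" "P \<beta>" "\<And>\<gamma>. \<gamma> \<in> elts \<beta> \<Longrightarrow> \<not> P \<gamma>" "elts \<beta> \<subseteq> elts \<alpha>"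
proof -
  have S: "elts (sep (suc \<alpha>) P) = {x \<in> insert \<alpha> (elts \<alpha>). P x}"
    using assms(3) by simp
  then obtain \<beta> where \<beta>: "\<beta> \<in> insert \<alpha> (elts \<alpha>)" "P \<beta>"
    "\<And>x. x \<in> insert \<alpha> (elts \<alpha>) \<Longrightarrow> P x \<Longrightarrow> x \<notin> elts \<beta>"
    using foundation[of "sep (suc \<alpha>) P"] assms(2) by blast
  then have "ordinal \<beta>" "elts \<beta> \<subseteq> elts \<alpha>"
    using assms(1) ordinal_mem ordinal_mem_subset by blast+
  with \<beta> show thesis by (intro that) blast+
qed

lemma ordinal_induct:
  assumes "ordinal \<alpha>" "dfn1 P"
    and "\<And>\<alpha>. ordinal \<alpha> \<Longrightarrow> (\<And>\<beta>. \<beta> \<in> elts \<alpha> \<Longrightarrow> P \<beta>) \<Longrightarrow> P \<alpha>"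
  shows "P \<alpha>"
proof (rule ccontr)
  assume "\<not> P \<alpha>"
  obtain \<beta> where "ordinal \<beta>" "\<not> P \<beta>" "\<And>\<gamma>. \<gamma> \<in> elts \<beta> \<Longrightarrow> \<not> \<not> P \<gamma>"
    by (rule least_ordinal[OF assms(1) \<open>\<not> P \<alpha>\<close> dfn_not[OF assms(2)]]) blast
  with assms(3) show False by blast
qed

text \<open>The collapse of a linear wellfounded relation. Linearity makes \<open>F\<close>
  injective: equal images of distinct points would be a set that is an element of itself.\<close>

lemma order_type:
  assumes wf: "wfon R A" and R: "dfn2 R"
    and total: "\<And>a b. a \<in> elts A \<Longrightarrow> b \<in> elts A \<Longrightarrow> R a b \<or> a = b \<or> R b a"
  obtains F where "trm1 F" "\<And>a. a \<in> elts A \<Longrightarrow> elts (F a) = F ` {b \<in> elts A. R b a}"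
    "inj_on F (elts A)" "ordinal (rep A F)" "\<And>a. a \<in> elts A \<Longrightarrow> ordinal (F a)"
proof -
  obtain F where F: "trm1 F" "\<And>a. a \<in> elts A \<Longrightarrow> elts (F a) = F ` {b \<in> elts A. R b a}"
    by (rule collapse[OF wf R]) blast
  \<comment> \<open>Transitivity comes from a minimal element of {a, b, c}: it can only be a, which
    excludes a = c and R c a.\<close>
  have trans: "R a c" if "R a b" "R b c" "a \<in> elts A" "b \<in> elts A" "c \<in> elts A" for a b c
  proof -
    have "elts (vun (upair a b) (upair c c)) \<subseteq> elts A" "elts (vun (upair a b) (upair c c)) \<noteq> {}"
      using that by auto
    then obtain m where "m \<in> {a, b, c}" "\<not> R a m" "\<not> R b m" "\<not> R c m"
      using wf[unfolded wfon_def, rule_format, of "vun (upair a b) (upair c c)"] by auto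
    with that total[of a c] show ?thesis by blast
  qed
  have F_trans: "trans_set (F a)" if "a \<in> elts A" for a
    using that F(2) trans unfolding trans_set_def by (auto; blast)
  have F_ord: "ordinal (F a)" if "a \<in> elts A" for a
    using that F_trans F(2) unfolding ordinal_iff by auto
  have "inj_on F (elts A)"
  proof (rule inj_onI, rule ccontr)
    fix a b assume "a \<in> elts A" "b \<in> elts A" "F a = F b" "a \<noteq> b"
    then have "F a \<in> elts (F b) \<or> F b \<in> elts (F a)"
      using total[of a b] F(2) by blast
    with \<open>F a = F b\<close> show False using not_mem_self by metis
  qed
  moreover have "ordinal (rep A F)"
    using F_trans F(2) unfolding ordinal_iff trans_set_def by (auto simp: F(1))
  ultimately show thesis using F F_ord by (intro that)
qed

section \<open>Comparison of cardinalities\<close>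

text \<open>Any set may serve as \<open>f\<close>, as \<open>app\<close> is total and only the
  values on \<open>A\<close> count. Cardinal estimates are phrased with this preorder;
  \<open>cardinal_iff\<close> links it to bijections.\<close>

definition lep :: "'v \<Rightarrow> 'v \<Rightarrow> bool" where
  "lep A B \<longleftrightarrow> (\<exists>f. \<forall>x\<in>elts A. app f x \<in> elts B \<and> (\<forall>y\<in>elts A. app f x = app f y \<longrightarrow> x = y))"

lemma dfn_lep [dfn, simp]: "trm t \<Longrightarrow> trm u \<Longrightarrow> dfn (\<lambda>e. lep (t e) (u e))"
  by (rule dfn2_subst[of lep]) (unfold lep_def, intro dfn)

lemma lepI:
  assumes F: "trm1 F" and "\<And>x. x \<in> elts A \<Longrightarrow> F x \<in> elts B"
    "\<And>x y. x \<in> elts A \<Longrightarrow> y \<in> elts A \<Longrightarrow> F x = F y \<Longrightarrow> x = y"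
  shows "lep A B"
  unfolding lep_def using assms by (intro exI[of _ "lam A F"]) simp

lemma lepE:
  assumes "lep A B"
  obtains f where "\<And>x. x \<in> elts A \<Longrightarrow> app f x \<in> elts B"
    "\<And>x y. x \<in> elts A \<Longrightarrow> y \<in> elts A \<Longrightarrow> app f x = app f y \<Longrightarrow> x = y"
  using assms unfolding lep_def by blast

lemma lep_subset: "elts A \<subseteq> elts B \<Longrightarrow> lep A B"
  by (rule lepI[of "\<lambda>x. x"]) (auto intro: dfn)

lemma lep_trans [trans]:
  assumes "lep A B" "lep B C"
  shows "lep A C"
proof -
  obtain f where f: "\<And>x. x \<in> elts A \<Longrightarrow> app f x \<in> elts B"
    "\<And>x y. x \<in> elts A \<Longrightarrow> y \<in> elts A \<Longrightarrow> app f x = app f y \<Longrightarrow> x = y"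
    by (rule lepE[OF assms(1)]) blast
  obtain g where g: "\<And>x. x \<in> elts B \<Longrightarrow> app g x \<in> elts C"
    "\<And>x y. x \<in> elts B \<Longrightarrow> y \<in> elts B \<Longrightarrow> app g x = app g y \<Longrightarrow> x = y"
    by (rule lepE[OF assms(2)]) blast
  show ?thesis
    by (rule lepI[of "\<lambda>x. app g (app f x)"]) (use f g in \<open>auto intro: dfn\<close>)
qed

lemma lep_surj:
  assumes F: "trm1 F" and sub: "elts A \<subseteq> F ` elts B"
  shows "lep A B"
proof -
  note [dfn, simp] = trm1_subst[OF F]
  have "dfn2 (\<lambda>y x. y = F x)" by (intro dfn)
  moreover have "\<exists>x\<in>elts B. y = F x" if "y \<in> elts A" for y
    using sub that by blast
  ultimately obtain f where f: "f \<in> elts (funs A B)" "\<And>y. y \<in> elts A \<Longrightarrow> y = F (app f y)"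
    by (rule choice_fun) blast+
  show ?thesis
  proof (rule lepI[of "app f"])
    show "x = y" if "x \<in> elts A" "y \<in> elts A" "app f x = app f y" for x y
      using f(2) that by metis
  qed (use app_in[OF f(1)] in \<open>auto intro: dfn\<close>)
qed

lemma bijectionI:
  assumes F: "trm1 F" and inj: "inj_on F (elts A)"
  shows "bijection_between (rep A (\<lambda>a. pair a (F a))) A (rep A F)"
    and "bijection_between (rep A (\<lambda>a. pair (F a) a)) (rep A F) A"
proof -
  note [dfn, simp] = trm1_subst[OF F]
  have 1: "rel (rep A (\<lambda>a. pair a (F a))) x y \<longleftrightarrow> x \<in> elts A \<and> y = F x" for x y
    by (auto simp: rel_iff)
  show "bijection_between (rep A (\<lambda>a. pair a (F a))) A (rep A F)"
    using inj by (auto simp: bijection_between_def function_between_def relation_between_def 1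
        opair_iff inj_on_eq_iff)
  have 2: "rel (rep A (\<lambda>a. pair (F a) a)) x y \<longleftrightarrow> y \<in> elts A \<and> x = F y" for x y
    by (auto simp: rel_iff)
  show "bijection_between (rep A (\<lambda>a. pair (F a) a)) (rep A F) A"
    using inj by (auto simp: bijection_between_def function_between_def relation_between_def 2
        opair_iff inj_on_eq_iff)
qed

lemma equinumerous_lep:
  assumes "equinumerous A B"
  shows "lep A B" and "lep B A"
proof -
  obtain f where f: "function_between f A B" "\<And>b. b \<in> elts B \<Longrightarrow> \<exists>!a. rel f a b"
    using assms unfolding equinumerous_def bijection_between_def by blast
  show "lep A B"
  proof (rule lepI[of "app f"])
    fix x y assume "x \<in> elts A" "y \<in> elts A" "app f x = app f y"
    then show "x = y"
      using function_between_app[OF f(1)] f(2) by metis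
  qed (use function_between_app[OF f(1)] in \<open>auto intro: dfn\<close>)
  define g where "g b = mk {z. \<exists>a. rel f a b \<and> z \<in> elts a}" for b
  have g: "g b \<in> elts A \<and> b = app f (g b)" if b: "b \<in> elts B" for b
  proof -
    obtain a where a: "rel f a b" "\<And>c. rel f c b \<Longrightarrow> c = a" using f(2)[OF b] by blast
    then have "g b = a" unfolding g_def by (intro mk_eqI) blast
    moreover have "a \<in> elts A"
      using a(1) f(1) unfolding function_between_def relation_between_def rel_iff opair_iff by fastforce
    ultimately show ?thesis
      using function_between_app[OF f(1)] a(1) by metis
  qed
  show "lep B A"
  proof (rule lepI[of g])
    show "trm1 g" unfolding g_def by (intro dfn)
    show "x = y" if "x \<in> elts B" "y \<in> elts B" "g x = g y" for x y
      using g that by metis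
  qed (use g in blast)
qed

text \<open>\<open>A\<close> is ordered by its image in \<beta>. The order type is at most \<beta>
  because, by induction, the rank of each a is at most \<open>app f a\<close>.\<close>

lemma lep_ordinal_equinumerous:
  assumes "lep A \<beta>" and \<beta>: "ordinal \<beta>"
  obtains \<gamma> where "ordinal \<gamma>" "elts \<gamma> \<subseteq> elts \<beta>" "equinumerous \<gamma> A"
proof -
  obtain f where f: "\<And>x. x \<in> elts A \<Longrightarrow> app f x \<in> elts \<beta>"
    "\<And>x y. x \<in> elts A \<Longrightarrow> y \<in> elts A \<Longrightarrow> app f x = app f y \<Longrightarrow> x = y"
    by (rule lepE[OF assms(1)]) blast
  define R where "R a b \<longleftrightarrow> app f a \<in> elts (app f b)" for a b
  have R: "dfn2 R" unfolding R_def by (intro dfn)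
  have wf: "wfon R A"
    unfolding wfon_def
  proof (intro allI impI)
    fix S assume S: "elts S \<subseteq> elts A \<and> elts S \<noteq> {}"
    then obtain y where "y \<in> elts (rep S (app f))" "elts y \<inter> elts (rep S (app f)) = {}"
      using foundation[of "rep S (app f)"] by auto
    then show "\<exists>m\<in>elts S. \<forall>x\<in>elts S. \<not> R x m"
      unfolding R_def by auto
  qed
  have total: "R a b \<or> a = b \<or> R b a" if "a \<in> elts A" "b \<in> elts A" for a b
    unfolding R_def using that f ordinal_linear ordinal_mem[OF \<beta>] by metis
  obtain F where F: "trm1 F" "\<And>a. a \<in> elts A \<Longrightarrow> elts (F a) = F ` {b \<in> elts A. R b a}"
    "inj_on F (elts A)" "ordinal (rep A F)" "\<And>a. a \<in> elts A \<Longrightarrow> ordinal (F a)"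
  proof (rule order_type[OF wf R])
    show "R a b \<or> a = b \<or> R b a" if "a \<in> elts A" "b \<in> elts A" for a b
      using that by (rule total)
  qed (rule that, assumption, simp_all)
  note [dfn, simp] = trm1_subst[OF F(1)]
  have le: "elts (F a) \<subseteq> elts (app f a)" if "a \<in> elts A" for a
  proof (rule wfon_induct[OF wf _ that, of "\<lambda>a. elts (F a) \<subseteq> elts (app f a)"])
    show "dfn1 (\<lambda>a. elts (F a) \<subseteq> elts (app f a))" by (intro dfn)
    fix a assume a: "a \<in> elts A" and IH: "\<And>b. b \<in> elts A \<Longrightarrow> R b a \<Longrightarrow> elts (F b) \<subseteq> elts (app f b)"
    show "elts (F a) \<subseteq> elts (app f a)"
    proof
      fix x assume "x \<in> elts (F a)"
      then obtain b where b: "b \<in> elts A" "R b a" "x = F b" using F(2) a by auto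
      have "F b \<in> elts (app f a)"
        using ordinal_subset_mem_trans[OF F(5)[OF b(1)] _ IH[OF b(1,2)]]
          b a f(1) ordinal_mem[OF \<beta>] by (simp add: R_def)
      with b(3) show "x \<in> elts (app f a)" by simp
    qed
  qed
  have "elts (rep A F) \<subseteq> elts \<beta>"
  proof
    fix x assume "x \<in> elts (rep A F)"
    then obtain a where a: "a \<in> elts A" "x = F a" using F(1) by auto
    have "F a \<in> elts \<beta>"
      using ordinal_subset_mem_trans[OF F(5)[OF a(1)] \<beta> le[OF a(1)]] a f(1) ordinal_mem[OF \<beta>]
      by simp
    with a(2) show "x \<in> elts \<beta>" by simp
  qed
  moreover have "equinumerous (rep A F) A"
    unfolding equinumerous_def using bijectionI(2)[OF F(1,3)] by blast
  ultimately show thesis using F(4) that by blast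
qed

text \<open>An injection into a smaller \<alpha> yields a bijection with an ordinal that is at most
  \<alpha>, hence still below \<kappa>.\<close>

lemma cardinal_iff: "cardinal \<kappa> \<longleftrightarrow> ordinal \<kappa> \<and> (\<forall>\<alpha>\<in>elts \<kappa>. \<not> lep \<kappa> \<alpha>)"
proof (cases "ordinal \<kappa>")
  case True
  have "\<exists>\<gamma>\<in>elts \<kappa>. equinumerous \<gamma> \<kappa>" if \<alpha>: "\<alpha> \<in> elts \<kappa>" and "lep \<kappa> \<alpha>" for \<alpha>
  proof -
    obtain \<gamma> where "ordinal \<gamma>" "elts \<gamma> \<subseteq> elts \<alpha>" "equinumerous \<gamma> \<kappa>"
      using lep_ordinal_equinumerous[OF \<open>lep \<kappa> \<alpha>\<close>] ordinal_mem[OF True \<alpha>] by blast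
    then show ?thesis
      using ordinal_subset_mem_trans[OF _ True] \<alpha> ordinal_mem[OF True \<alpha>] by blast
  qed
  then show ?thesis
    unfolding cardinal_def using equinumerous_lep(2) by blast
qed (simp add: cardinal_def)

lemma dfn_cardinal [dfn, simp]: "trm t \<Longrightarrow> dfn (\<lambda>e. cardinal (t e))"
  by (rule dfn1_subst[of cardinal]) (unfold cardinal_iff, intro dfn)

lemma cardinal_not_lep: "cardinal \<kappa> \<Longrightarrow> \<alpha> \<in> elts \<kappa> \<Longrightarrow> \<not> lep \<kappa> \<alpha>"
  by (simp add: cardinal_iff)

lemma cardinal_ordinal: "cardinal \<kappa> \<Longrightarrow> ordinal \<kappa>"
  by (simp add: cardinal_def)

lemma ex_cardinality:
  assumes "ordinal \<alpha>"
  obtains \<theta> where "cardinal \<theta>" "elts \<theta> \<subseteq> elts \<alpha>" "lep \<alpha> \<theta>"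
proof -
  have "dfn1 (lep \<alpha>)" by (intro dfn)
  obtain \<theta> where \<theta>: "ordinal \<theta>" "lep \<alpha> \<theta>" "\<And>\<gamma>. \<gamma> \<in> elts \<theta> \<Longrightarrow> \<not> lep \<alpha> \<gamma>" "elts \<theta> \<subseteq> elts \<alpha>"
    by (rule least_ordinal[OF assms, of "lep \<alpha>"]) (use \<open>dfn1 (lep \<alpha>)\<close> lep_subset in blast)+
  then have "cardinal \<theta>"
    unfolding cardinal_iff using lep_trans by blast
  with \<theta> show thesis by (intro that)
qed

lemma cardinal_lep_iff:
  assumes "cardinal \<theta>" "ordinal \<alpha>" "lep \<theta> \<alpha>"
  shows "elts \<theta> \<subseteq> elts \<alpha>"
  using assms ordinal_not_mem_iff[of \<theta> \<alpha>] cardinal_not_lep cardinal_ordinal by blast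

lemma successor_cardinal_lep:
  assumes "successor_cardinal \<mu> \<theta>" "cardinal \<theta>" "\<alpha> \<in> elts \<mu>"
  shows "lep \<alpha> \<theta>"
proof -
  have \<mu>: "cardinal \<mu>" "\<theta> \<in> elts \<mu>" "\<And>\<sigma>. cardinal \<sigma> \<Longrightarrow> \<theta> \<in> elts \<sigma> \<Longrightarrow> ord_le \<mu> \<sigma>"
    using assms(1) by (simp_all add: successor_cardinal_def mem_elts)
  note o = cardinal_ordinal[OF \<mu>(1)] cardinal_ordinal[OF assms(2)]
  obtain \<sigma> where \<sigma>: "cardinal \<sigma>" "elts \<sigma> \<subseteq> elts \<alpha>" "lep \<alpha> \<sigma>"
    using ex_cardinality[OF ordinal_mem[OF o(1) assms(3)]] .
  have "\<theta> \<notin> elts \<sigma>"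
  proof
    assume "\<theta> \<in> elts \<sigma>"
    then have "elts \<mu> \<subseteq> elts \<sigma>"
      using \<mu>(3)[OF \<sigma>(1)] ord_le_iff[OF o(1) cardinal_ordinal[OF \<sigma>(1)]] by blast
    then show False using \<sigma>(2) assms(3) not_mem_self by blast
  qed
  then have "elts \<sigma> \<subseteq> elts \<theta>"
    using ordinal_not_mem_iff o(2) cardinal_ordinal[OF \<sigma>(1)] by blast
  with \<sigma>(3) show ?thesis using lep_subset lep_trans by blast
qed

lemma successor_cardinal_le:
  assumes "successor_cardinal \<mu> \<theta>" "cardinal \<kappa>" "\<theta> \<in> elts \<kappa>"
  shows "elts \<mu> \<subseteq> elts \<kappa>"
proof -
  have "cardinal \<mu>" "ord_le \<mu> \<kappa>"
    using assms by (simp_all add: successor_cardinal_def mem_elts)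
  with assms(2) show ?thesis
    using ord_le_iff cardinal_ordinal by blast
qed

lemma omega_suc:
  assumes "is_omega w" and x: "x \<in> elts w"
  shows "suc x \<in> elts w"
proof -
  have w_lim: "ordinal w" "\<And>\<beta>. \<beta> \<in> elts w \<Longrightarrow> \<exists>\<gamma>\<in>elts w. \<beta> \<in> elts \<gamma>"
    using assms(1) by (simp_all add: is_omega_def limit_ordinal_def mem_elts)
  obtain y where y: "y \<in> elts w" "x \<in> elts y" using w_lim(2)[OF x] by blast
  have ox: "ordinal x" and oy: "ordinal y" using ordinal_mem[OF w_lim(1)] x y(1) by blast+
  have "elts (suc x) \<subseteq> elts y" using y(2) ordinal_mem_subset[OF oy y(2)] by simp
  then show ?thesis
    using ordinal_subset_mem_trans[OF ordinal_suc[OF ox] w_lim(1) _ oy y(1)] by blast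
qed

text \<open>Hilbert's hotel: if suc \<alpha> were not below \<kappa>, shifting omega by one frees
  \<open>zero\<close> for \<alpha> and injects suc \<alpha>, hence \<kappa>, into \<alpha>.\<close>

lemma infinite_cardinal_suc:
  assumes \<kappa>: "cardinal \<kappa>" and w: "is_omega w" "w \<in> elts \<kappa>" and \<alpha>: "\<alpha> \<in> elts \<kappa>"
  shows "suc \<alpha> \<in> elts \<kappa>"
proof (rule ccontr)
  assume n: "suc \<alpha> \<notin> elts \<kappa>"
  note o\<kappa> = cardinal_ordinal[OF \<kappa>]
  note o\<alpha> = ordinal_mem[OF o\<kappa> \<alpha>]
  have w_lim: "ordinal w" "elts w \<noteq> {}"
    using w(1) by (simp_all add: is_omega_def limit_ordinal_def)
  have sub: "elts \<kappa> \<subseteq> elts (suc \<alpha>)"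
    using n ordinal_not_mem_iff[OF o\<kappa> ordinal_suc[OF o\<alpha>]] by blast
  then have w\<alpha>: "elts w \<subseteq> elts \<alpha>"
    using w(2) ordinal_mem_subset[OF o\<alpha>] by auto
  note suc_w = omega_suc[OF w(1)]
  have zero_w: "zero \<in> elts w"
  proof -
    obtain x where "x \<in> elts w" "elts x \<inter> elts w = {}"
      using foundation[OF w_lim(2)] by blast
    then have "elts x = {}" using ordinal_mem_subset[OF w_lim(1)] by blast
    then have "x = zero" by (intro extensionality) simp
    with \<open>x \<in> elts w\<close> show ?thesis by simp
  qed
  have suc_inj: "x = y" if "suc x = suc y" for x y
  proof -
    have "x \<in> elts (suc y)" "y \<in> elts (suc x)"
      using elts_suc[of x] elts_suc[of y] unfolding that by blast+
    then show ?thesis using not_mem_sym[of x y] by auto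
  qed
  have suc_0: "suc x \<noteq> zero" for x
  proof
    assume "suc x = zero"
    then have "elts (suc x) = elts zero" by (rule arg_cong)
    then show False by simp
  qed
  have "\<alpha> \<notin> elts w" using w\<alpha> not_mem_self by blast
  have "lep (suc \<alpha>) \<alpha>"
  proof (rule lepI[of "\<lambda>x. if x \<in> elts w then suc x else if x = \<alpha> then zero else x"])
    show "trm1 (\<lambda>x. if x \<in> elts w then suc x else if x = \<alpha> then zero else x)"
      by (intro dfn)
    show "(if x \<in> elts w then suc x else if x = \<alpha> then zero else x) \<in> elts \<alpha>"
      if "x \<in> elts (suc \<alpha>)" for x
      using that suc_w zero_w w\<alpha> by auto
    show "x = y" if "(if x \<in> elts w then suc x else if x = \<alpha> then zero else x) =
      (if y \<in> elts w then suc y else if y = \<alpha> then zero else y)" for x y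
      using that suc_w[of x] suc_w[of y] zero_w suc_inj[of x y] suc_0[of x] suc_0[of y]
      by (auto split: if_splits)
  qed
  with lep_subset[OF sub] have "lep \<kappa> \<alpha>" by (rule lep_trans)
  with cardinal_not_lep[OF \<kappa> \<alpha>] show False by blast
qed

lemma lep_prod:
  assumes "lep A B" "lep C D"
  shows "lep (prod A C) (prod B D)"
proof -
  obtain f where f: "\<And>x. x \<in> elts A \<Longrightarrow> app f x \<in> elts B"
    "\<And>x y. x \<in> elts A \<Longrightarrow> y \<in> elts A \<Longrightarrow> app f x = app f y \<Longrightarrow> x = y"
    by (rule lepE[OF assms(1)]) blast
  obtain g where g: "\<And>x. x \<in> elts C \<Longrightarrow> app g x \<in> elts D"
    "\<And>x y. x \<in> elts C \<Longrightarrow> y \<in> elts C \<Longrightarrow> app g x = app g y \<Longrightarrow> x = y"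
    by (rule lepE[OF assms(2)]) blast
  show ?thesis
  proof (rule lepI[of "\<lambda>p. pair (app f (pfst p)) (app g (psnd p))"])
    show "trm1 (\<lambda>p. pair (app f (pfst p)) (app g (psnd p)))" by (intro dfn)
    show "pair (app f (pfst p)) (app g (psnd p)) \<in> elts (prod B D)" if "p \<in> elts (prod A C)" for p
      using that f(1) g(1) by auto
    show "p = q" if pq: "p \<in> elts (prod A C)" "q \<in> elts (prod A C)"
      and eq: "pair (app f (pfst p)) (app g (psnd p)) = pair (app f (pfst q)) (app g (psnd q))" for p q
    proof -
      obtain a c a' c' where *: "p = pair a c" "q = pair a' c'" "a \<in> elts A" "a' \<in> elts A"
        "c \<in> elts C" "c' \<in> elts C"
        using pq by auto
      have "a = a'" "c = c'"
        using eq f(2)[of a a'] g(2)[of c c'] * by simp_all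
      then show ?thesis using * by simp
    qed
  qed
qed

lemma lep_funs:
  assumes "lep A B"
  shows "lep (funs D A) (funs D B)"
proof -
  obtain h where h: "\<And>x. x \<in> elts A \<Longrightarrow> app h x \<in> elts B"
    "\<And>x y. x \<in> elts A \<Longrightarrow> y \<in> elts A \<Longrightarrow> app h x = app h y \<Longrightarrow> x = y"
    by (rule lepE[OF assms]) blast
  show ?thesis
  proof (rule lepI[of "\<lambda>f. lam D (\<lambda>x. app h (app f x))"])
    show "trm1 (\<lambda>f. lam D (\<lambda>x. app h (app f x)))" by (intro dfn)
    show "lam D (\<lambda>x. app h (app f x)) \<in> elts (funs D B)" if f: "f \<in> elts (funs D A)" for f
      by (rule lam_in_funs) (use app_in[OF f] h(1) in simp_all)
    show "f = g" if fg: "f \<in> elts (funs D A)" "g \<in> elts (funs D A)"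
      and eq: "lam D (\<lambda>x. app h (app f x)) = lam D (\<lambda>x. app h (app g x))" for f g
    proof (rule funs_eqI[OF fg])
      fix x assume x: "x \<in> elts D"
      have "app (lam D (\<lambda>x. app h (app f x))) x = app (lam D (\<lambda>x. app h (app g x))) x"
        using eq by simp
      then have "app h (app f x) = app h (app g x)" using x by simp
      then show "app f x = app g x"
        using h(2) app_in fg x by blast
    qed
  qed
qed

section \<open>Goedel's wellordering of pairs of ordinals\<close>

lemma minimal_image:
  assumes "trm1 F" "elts S \<noteq> {}"
  shows "\<exists>p\<in>elts S. \<forall>q\<in>elts S. F q \<notin> elts (F p)"
proof -
  have S: "elts (rep S F) = F ` elts S" using assms(1) by simp
  then obtain y where "y \<in> F ` elts S" "elts y \<inter> F ` elts S = {}"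
    using foundation[of "rep S F"] assms(2) by auto
  then show ?thesis by blast
qed

text \<open>The union of two ordinals is their maximum.\<close>

definition mx :: "'v \<Rightarrow> 'v" where
  "mx p = vun (pfst p) (psnd p)"

text \<open>Comparing maxima before coordinates makes the predecessors of a pair p of ordinals lie
  in the square of suc (mx p).\<close>

definition godel_less :: "'v \<Rightarrow> 'v \<Rightarrow> bool" where
  "godel_less p q \<longleftrightarrow> mx p \<in> elts (mx q) \<or> mx p = mx q \<and>
    (pfst p \<in> elts (pfst q) \<or> pfst p = pfst q \<and> psnd p \<in> elts (psnd q))"

lemma trm_mx [dfn, simp]: "trm t \<Longrightarrow> trm (\<lambda>e. mx (t e))"
  unfolding mx_def by (intro dfn)

lemma dfn_godel_less [dfn, simp]: "trm t \<Longrightarrow> trm u \<Longrightarrow> dfn (\<lambda>e. godel_less (t e) (u e))"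
  unfolding godel_less_def by (intro dfn)

text \<open>The maximum, the first and the second coordinate are minimised in turn, each among the
  pairs left by the previous choice.\<close>

lemma wfon_godel_less: "wfon godel_less A"
  unfolding wfon_def
proof (intro allI impI)
  fix S assume "elts S \<subseteq> elts A \<and> elts S \<noteq> {}"
  then have "elts S \<noteq> {}" ..
  then obtain p1 where p1: "p1 \<in> elts S" "\<And>q. q \<in> elts S \<Longrightarrow> mx q \<notin> elts (mx p1)"
    using minimal_image[of mx S] by (auto intro: dfn)
  define S1 where "S1 = sep S (\<lambda>p. mx p = mx p1)"
  have S1: "elts S1 = {p \<in> elts S. mx p = mx p1}" by (simp add: S1_def)
  then obtain p2 where p2: "p2 \<in> elts S1" "\<And>q. q \<in> elts S1 \<Longrightarrow> pfst q \<notin> elts (pfst p2)"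
    using minimal_image[of pfst S1] p1 by (auto intro: dfn)
  define S2 where "S2 = sep S1 (\<lambda>p. pfst p = pfst p2)"
  have S2: "elts S2 = {p \<in> elts S1. pfst p = pfst p2}" by (simp add: S2_def)
  then obtain p3 where p3: "p3 \<in> elts S2" "\<And>q. q \<in> elts S2 \<Longrightarrow> psnd q \<notin> elts (psnd p3)"
    using minimal_image[of psnd S2] p2 by (auto intro: dfn)
  have p3': "p3 \<in> elts S" "mx p3 = mx p1" "pfst p3 = pfst p2"
    using p3(1) by (simp_all add: S1 S2)
  have "\<not> godel_less q p3" if q: "q \<in> elts S" for q
    using p1(2)[OF q] p2(2)[of q] p3(2)[of q] q p3' by (auto simp: godel_less_def S1 S2)
  with p3'(1) show "\<exists>m\<in>elts S. \<forall>x\<in>elts S. \<not> godel_less x m" by blast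
qed

lemma godel_less_total:
  assumes \<theta>: "ordinal \<theta>" and pq: "p \<in> elts (prod \<theta> \<theta>)" "q \<in> elts (prod \<theta> \<theta>)"
  shows "godel_less p q \<or> p = q \<or> godel_less q p"
proof -
  obtain a b c d where *: "p = pair a b" "q = pair c d" "a \<in> elts \<theta>" "b \<in> elts \<theta>" "c \<in> elts \<theta>" "d \<in> elts \<theta>"
    using pq by auto
  then have o: "ordinal a" "ordinal b" "ordinal c" "ordinal d"
    using ordinal_mem[OF \<theta>] by blast+
  then have "ordinal (vun a b)" "ordinal (vun c d)"
    using ordinal_vun by metis+
  from ordinal_linear[OF this] ordinal_linear[OF o(1,3)] ordinal_linear[OF o(2,4)]
  show ?thesis by (auto simp: godel_less_def mx_def *)
qed

lemma GCH_atE: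
  assumes "GCH_at \<theta>"
  obtains \<mu> where "successor_cardinal \<mu> \<theta>" "lep (pow \<theta>) \<mu>" "lep \<mu> (pow \<theta>)"
proof -
  obtain P \<mu> where P: "powerset P \<theta>" "successor_cardinal \<mu> \<theta>" "equinumerous P \<mu>"
    using assms unfolding GCH_at_def by blast
  have "P = pow \<theta>"
    using P(1) by (intro extensionality) (simp add: powerset_def)
  with P equinumerous_lep show thesis by (intro that) blast+
qed

end

section \<open>Measures\<close>

locale measure_model = ZFC_model mem for mem :: "'v \<Rightarrow> 'v \<Rightarrow> bool" +
  fixes \<delta> U :: 'v
  assumes uncountable: "uncountable_cardinal \<delta>"
    and ultrafilter: "ultrafilter_on U \<delta>"
    and nonprincipal: "nonprincipal_on U \<delta>"
    and complete: "complete_on \<delta> U \<delta>"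
begin

lemma cardinal_\<delta>: "cardinal \<delta>"
  using uncountable by (simp add: uncountable_cardinal_def)

lemma ordinal_\<delta>: "ordinal \<delta>"
  using cardinal_\<delta> by (rule cardinal_ordinal)

lemma
  shows U_subset: "X \<in> elts U \<Longrightarrow> elts X \<subseteq> elts \<delta>"
    and U_nonempty: "X \<in> elts U \<Longrightarrow> elts X \<noteq> {}"
    and U_top: "\<delta> \<in> elts U"
    and U_Int: "X \<in> elts U \<Longrightarrow> Y \<in> elts U \<Longrightarrow> elts Z = elts X \<inter> elts Y \<Longrightarrow> Z \<in> elts U"
    and U_mono: "X \<in> elts U \<Longrightarrow> elts X \<subseteq> elts Y \<Longrightarrow> elts Y \<subseteq> elts \<delta> \<Longrightarrow> Y \<in> elts U"
    and U_cases: "elts X \<subseteq> elts \<delta> \<Longrightarrow> elts Y = elts \<delta> - elts X \<Longrightarrow> X \<in> elts U \<or> Y \<in> elts U"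
proof -
  note u = ultrafilter[unfolded ultrafilter_on_def]
  show "X \<in> elts U \<Longrightarrow> elts X \<subseteq> elts \<delta>" "X \<in> elts U \<Longrightarrow> elts X \<noteq> {}"
    by (rule bspec[OF conjunct1[OF u], THEN conjunct1], assumption,
        rule bspec[OF conjunct1[OF u], THEN conjunct2], assumption)
  note u = conjunct2[OF u]
  show "\<delta> \<in> elts U" by (rule conjunct1[OF u])
  note u = conjunct2[OF u]
  show "X \<in> elts U \<Longrightarrow> Y \<in> elts U \<Longrightarrow> elts Z = elts X \<inter> elts Y \<Longrightarrow> Z \<in> elts U"
    by (rule conjunct1[OF u, rule_format])
  note u = conjunct2[OF u]
  show "X \<in> elts U \<Longrightarrow> elts X \<subseteq> elts Y \<Longrightarrow> elts Y \<subseteq> elts \<delta> \<Longrightarrow> Y \<in> elts U"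
    by (rule conjunct1[OF u, rule_format, OF _ conjI])
  note u = conjunct2[OF u]
  show "elts X \<subseteq> elts \<delta> \<Longrightarrow> elts Y = elts \<delta> - elts X \<Longrightarrow> X \<in> elts U \<or> Y \<in> elts U"
    by (rule u[rule_format, OF conjI])
qed

lemma cardinal_suc:
  assumes "cardinal \<theta>" "elts \<delta> \<subseteq> elts \<theta>" "\<alpha> \<in> elts \<theta>"
  shows "suc \<alpha> \<in> elts \<theta>"
proof -
  obtain w where "is_omega w" "w \<in> elts \<delta>"
    using uncountable by (auto simp: uncountable_cardinal_def mem_elts)
  with infinite_cardinal_suc assms show ?thesis by blast
qed

text \<open>The measure read as a quantifier over \<delta>. For an undefinable predicate
  \<open>sep\<close> need not have the intended elements, hence the \<open>dfn1\<close> premises of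
  most rules.\<close>

definition AE :: "('v \<Rightarrow> bool) \<Rightarrow> bool" where
  "AE P \<longleftrightarrow> sep \<delta> P \<in> elts U"

lemma dfn_AE [dfn, simp]:
  "dfn (\<lambda>e. P (\<lambda>i. e (Suc i)) (e 0)) \<Longrightarrow> dfn (\<lambda>e. AE (P e))"
  unfolding AE_def by (intro dfn)

lemma AE_cong: "(\<And>x. x \<in> elts \<delta> \<Longrightarrow> P x \<longleftrightarrow> Q x) \<Longrightarrow> AE P \<longleftrightarrow> AE Q"
proof -
  assume "\<And>x. x \<in> elts \<delta> \<Longrightarrow> P x \<longleftrightarrow> Q x"
  then have "{x. x \<in> elts \<delta> \<and> P x} = {x. x \<in> elts \<delta> \<and> Q x}" by blast
  then show ?thesis by (simp only: AE_def sep_def)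
qed

lemma AE_True: "(\<And>x. x \<in> elts \<delta> \<Longrightarrow> P x) \<Longrightarrow> AE P"
proof -
  assume "\<And>x. x \<in> elts \<delta> \<Longrightarrow> P x"
  then have "{x. x \<in> elts \<delta> \<and> P x} = elts \<delta>" by blast
  then show ?thesis
    using U_top by (simp add: AE_def sep_def)
qed

lemma AE_mono:
  assumes "AE P" "dfn1 P" "dfn1 Q" "\<And>x. x \<in> elts \<delta> \<Longrightarrow> P x \<Longrightarrow> Q x"
  shows "AE Q"
proof -
  have "elts (sep \<delta> P) \<subseteq> elts (sep \<delta> Q)" "elts (sep \<delta> Q) \<subseteq> elts \<delta>"
    using assms(2-4) by auto
  with assms(1) show ?thesis
    unfolding AE_def by (rule U_mono)
qed

lemma AE_conj:
  assumes "AE P" "AE Q" "dfn1 P" "dfn1 Q"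
  shows "AE (\<lambda>x. P x \<and> Q x)"
proof -
  have "elts (sep \<delta> (\<lambda>x. P x \<and> Q x)) = elts (sep \<delta> P) \<inter> elts (sep \<delta> Q)"
    using assms(3,4) by auto
  with assms(1,2) show ?thesis
    unfolding AE_def by (rule U_Int)
qed

lemma AE_mono2:
  assumes "AE P" "AE Q" "dfn1 P" "dfn1 Q" "dfn1 R"
    and "\<And>x. x \<in> elts \<delta> \<Longrightarrow> P x \<Longrightarrow> Q x \<Longrightarrow> R x"
  shows "AE R"
  by (rule AE_mono[OF AE_conj[OF assms(1-4)] dfn_conj[OF assms(3,4)] assms(5)])
    (use assms(6) in blast)

lemma AE_ex: "AE P \<Longrightarrow> dfn1 P \<Longrightarrow> \<exists>x\<in>elts \<delta>. P x"
proof -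
  assume "AE P" "dfn1 P"
  then have "elts (sep \<delta> P) \<noteq> {}"
    unfolding AE_def by (intro U_nonempty)
  with \<open>dfn1 P\<close> show ?thesis by auto
qed

lemma AE_not: "dfn1 P \<Longrightarrow> AE (\<lambda>x. \<not> P x) \<longleftrightarrow> \<not> AE P"
proof -
  assume P: "dfn1 P"
  have "elts (sep \<delta> P) \<subseteq> elts \<delta> \<and> elts (sep \<delta> (\<lambda>x. \<not> P x)) = elts \<delta> - elts (sep \<delta> P)"
    using P by auto
  then have "AE P \<or> AE (\<lambda>x. \<not> P x)"
    unfolding AE_def using U_cases by blast
  moreover have False if "AE P" "AE (\<lambda>x. \<not> P x)"
    using AE_ex[OF AE_conj[OF that P dfn_not[OF P]] dfn_conj[OF P dfn_not[OF P]]] by blast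
  ultimately show ?thesis by blast
qed

text \<open>Completeness in dual form: if no piece had measure one, the complements, fewer than
  \<delta> many, would intersect in a set of measure one that misses every piece.\<close>

lemma AE_partition:
  assumes \<beta>: "\<beta> \<in> elts \<delta>" and P: "dfn2 P" and AE: "AE (\<lambda>x. \<exists>i\<in>elts \<beta>. P i x)"
  shows "\<exists>i\<in>elts \<beta>. AE (P i)"
proof (rule ccontr)
  assume n: "\<not> (\<exists>i\<in>elts \<beta>. AE (P i))"
  note [dfn, simp] = dfn2_subst[OF P]
  have o\<beta>: "ordinal \<beta>" using ordinal_mem[OF ordinal_\<delta> \<beta>] .
  define B where "B i = sep \<delta> (\<lambda>x. \<not> P i x)" for i
  have B: "trm1 B" unfolding B_def by (intro dfn)
  have "B i \<in> elts U" if "i \<in> elts \<beta>" for i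
    using n that AE_not[of "P i"] by (simp add: AE_def B_def)
  then have sub: "elts (rep \<beta> B) \<subseteq> elts U" using B by auto
  have "lep (rep \<beta> B) \<beta>"
    by (rule lep_surj[OF B]) (use B in simp)
  then obtain \<gamma> where \<gamma>: "ordinal \<gamma>" "elts \<gamma> \<subseteq> elts \<beta>" "equinumerous \<gamma> (rep \<beta> B)"
    by (rule lep_ordinal_equinumerous[OF _ o\<beta>])
  then have "\<gamma> \<in> elts \<delta>"
    using ordinal_subset_mem_trans[OF \<gamma>(1) ordinal_\<delta> \<gamma>(2) o\<beta> \<beta>] by blast
  then obtain Y where Y: "Y \<in> elts U" "elts Y = {z \<in> elts \<delta>. \<forall>X\<in>elts (rep \<beta> B). z \<in> elts X}"
    using complete sub \<gamma>(3) unfolding complete_on_def by blast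
  have "elts Y = elts (sep \<delta> (\<lambda>x. \<not> (\<exists>i\<in>elts \<beta>. P i x)))"
    using Y(2) B by (auto simp: B_def)
  then have "Y = sep \<delta> (\<lambda>x. \<not> (\<exists>i\<in>elts \<beta>. P i x))" by (rule extensionality)
  then have "AE (\<lambda>x. \<not> (\<exists>i\<in>elts \<beta>. P i x))"
    using Y(1) by (simp add: AE_def)
  then show False
    using AE AE_not[of "\<lambda>x. \<exists>i\<in>elts \<beta>. P i x"] by simp
qed

lemma not_AE_singleton:
  assumes a: "a \<in> elts \<delta>"
  shows "\<not> AE (\<lambda>x. x = a)"
proof
  assume AE: "AE (\<lambda>x. x = a)"
  define S where "S = sep \<delta> (\<lambda>x. x = a)"
  have S: "S \<in> elts U" "elts S = {a}"
    using AE a by (auto simp: AE_def S_def)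
  have "X \<in> elts U \<longleftrightarrow> elts X \<subseteq> elts \<delta> \<and> a \<in> elts X" for X
  proof
    assume X: "X \<in> elts U"
    obtain Z where Z: "elts Z = elts X \<inter> elts S"
      using elts_mk[OF small_Int] by blast
    have "elts Z \<noteq> {}" by (rule U_nonempty[OF U_Int[OF X S(1) Z]])
    then have "a \<in> elts X" unfolding Z S(2) by blast
    moreover have "elts X \<subseteq> elts \<delta>" using X by (rule U_subset)
    ultimately show "elts X \<subseteq> elts \<delta> \<and> a \<in> elts X" by blast
  next
    assume "elts X \<subseteq> elts \<delta> \<and> a \<in> elts X"
    then have "elts S \<subseteq> elts X" "elts X \<subseteq> elts \<delta>" using S(2) by auto
    with S(1) show "X \<in> elts U" by (rule U_mono)
  qed
  then have "elts U = {X. elts X \<subseteq> elts \<delta> \<and> a \<in> elts X}" by blast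
  then show False using nonprincipal a unfolding nonprincipal_on_def by blast
qed

text \<open>Otherwise almost every x is at most i, and completeness concentrates the measure at a
  single j, against nonprincipality.\<close>

lemma AE_above:
  assumes i: "i \<in> elts \<delta>"
  shows "AE (\<lambda>x. i \<in> elts x)"
proof (rule ccontr)
  assume "\<not> AE (\<lambda>x. i \<in> elts x)"
  then have n: "AE (\<lambda>x. i \<notin> elts x)" by (simp add: AE_not)
  have "AE (\<lambda>x. \<exists>j\<in>elts (suc i). x = j)"
  proof (rule AE_mono[OF n])
    fix x assume "x \<in> elts \<delta>" "i \<notin> elts x"
    then show "\<exists>j\<in>elts (suc i). x = j"
      using ordinal_linear[of i x] ordinal_mem[OF ordinal_\<delta>] i by auto
  qed (intro dfn)+
  then obtain j where j: "j \<in> elts (suc i)" "AE (\<lambda>x. x = j)"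
    using AE_partition[OF cardinal_suc[OF cardinal_\<delta> subset_refl i], of "\<lambda>j x. x = j"]
    by (auto intro: dfn)
  have "j \<in> elts \<delta>"
    using j(1) i ordinal_mem_trans[OF ordinal_\<delta> i] by auto
  with not_AE_singleton j(2) show False by blast
qed

lemma inj_not_AE_const:
  assumes f: "\<And>x y. x \<in> elts \<delta> \<Longrightarrow> y \<in> elts \<delta> \<Longrightarrow> app f x = app f y \<Longrightarrow> x = y"
  shows "\<not> AE (\<lambda>x. app f x = c)"
proof
  assume AE: "AE (\<lambda>x. app f x = c)"
  then obtain a where a: "a \<in> elts \<delta>" "app f a = c" using AE_ex[OF AE] by (auto intro: dfn)
  have "AE (\<lambda>x. x = a)"
    by (rule AE_mono[OF AE]) (use a f in \<open>auto intro: dfn\<close>)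
  with not_AE_singleton[OF a(1)] show False by blast
qed

text \<open>Both coordinates of a map from \<delta> are constant almost everywhere, so it is not
  injective. This serves as the base of \<open>hessenberg\<close>, covering all smaller cardinals at
  once, the finite ones included.\<close>

lemma not_lep_prod_below:
  assumes m: "m \<in> elts \<delta>"
  shows "\<not> lep \<delta> (prod m m)"
proof
  assume "lep \<delta> (prod m m)"
  then obtain f where f: "\<And>x. x \<in> elts \<delta> \<Longrightarrow> app f x \<in> elts (prod m m)"
    "\<And>x y. x \<in> elts \<delta> \<Longrightarrow> y \<in> elts \<delta> \<Longrightarrow> app f x = app f y \<Longrightarrow> x = y"
    by (rule lepE) blast
  have "AE (\<lambda>x. \<exists>i\<in>elts m. pfst (app f x) = i)" "AE (\<lambda>x. \<exists>i\<in>elts m. psnd (app f x) = i)"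
    by (rule AE_True, use f(1) in fastforce)+
  then obtain i j where ij: "AE (\<lambda>x. pfst (app f x) = i)" "AE (\<lambda>x. psnd (app f x) = j)"
    using AE_partition[OF m, of "\<lambda>i x. pfst (app f x) = i"]
      AE_partition[OF m, of "\<lambda>i x. psnd (app f x) = i"] by (auto intro: dfn)
  have "AE (\<lambda>x. app f x = pair i j)"
    by (rule AE_mono2[OF ij]) (use f(1) in \<open>fastforce intro: dfn\<close>)+
  with inj_not_AE_const f(2) show False by blast
qed

text \<open>The measure decides for each i below \<nu> whether i belongs to the values of f; fewer
  than \<delta> decisions hold simultaneously, so f is constant almost everywhere. In the end this
  keeps a measurable cardinal from being a successor.\<close>

lemma not_lep_pow_below:
  assumes \<nu>: "\<nu> \<in> elts \<delta>"
  shows "\<not> lep \<delta> (pow \<nu>)"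
proof
  assume "lep \<delta> (pow \<nu>)"
  then obtain f where f: "\<And>x. x \<in> elts \<delta> \<Longrightarrow> app f x \<in> elts (pow \<nu>)"
    "\<And>x y. x \<in> elts \<delta> \<Longrightarrow> y \<in> elts \<delta> \<Longrightarrow> app f x = app f y \<Longrightarrow> x = y"
    by (rule lepE) blast
  define c where "c i \<longleftrightarrow> AE (\<lambda>x. i \<in> elts (app f x))" for i
  have "dfn1 c" unfolding c_def by (intro dfn)
  note [dfn, simp] = dfn1_subst[OF this]
  have "\<not> AE (\<lambda>x. \<not> (i \<in> elts (app f x) \<longleftrightarrow> c i))" for i
  proof (cases "c i")
    case True
    then show ?thesis using AE_not[of "\<lambda>x. i \<in> elts (app f x)"] by (simp add: c_def)
  next
    case False
    then show ?thesis by (simp add: c_def)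
  qed
  then have "\<not> AE (\<lambda>x. \<exists>i\<in>elts \<nu>. \<not> (i \<in> elts (app f x) \<longleftrightarrow> c i))"
    using AE_partition[OF \<nu>, of "\<lambda>i x. \<not> (i \<in> elts (app f x) \<longleftrightarrow> c i)"] by (auto intro: dfn)
  then have n: "AE (\<lambda>x. \<not> (\<exists>i\<in>elts \<nu>. \<not> (i \<in> elts (app f x) \<longleftrightarrow> c i)))"
    using AE_not[of "\<lambda>x. \<exists>i\<in>elts \<nu>. \<not> (i \<in> elts (app f x) \<longleftrightarrow> c i)"] by (simp del: bex_simps ball_simps)
  have "AE (\<lambda>x. app f x = sep \<nu> c)"
  proof (rule AE_mono[OF n])
    fix x assume "x \<in> elts \<delta>" "\<not> (\<exists>i\<in>elts \<nu>. \<not> (i \<in> elts (app f x) \<longleftrightarrow> c i))"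
    then show "app f x = sep \<nu> c"
      using f(1)[of x] \<open>dfn1 c\<close> by (intro extensionality) auto
  qed (intro dfn)+
  with inj_not_AE_const f(2) show False by blast
qed

text \<open>For a cofinal map on \<beta> < \<delta>, completeness would make one of its values an
  upper bound almost everywhere, contradicting \<open>AE_above\<close>.\<close>

lemma cofinality_\<delta>: "cofinality \<delta> \<delta>"
  unfolding cofinality_def
proof (intro conjI ordinal_\<delta> ballI notI)
  have "function_between (lam \<delta> (\<lambda>x. x)) \<delta> \<delta>"
    by (rule function_between_lam) (auto intro: dfn)
  then show "\<exists>f. cofinal_map f \<delta> \<delta>"
    unfolding cofinal_map_def ord_le_def rel_iff by (intro exI[of _ "lam \<delta> (\<lambda>x. x)"]) auto
next
  fix \<beta> assume \<beta>: "\<beta> \<in> elts \<delta>" and "\<exists>f. cofinal_map f \<beta> \<delta>"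
  then obtain f where f: "function_between f \<beta> \<delta>"
    "\<And>\<alpha>. \<alpha> \<in> elts \<delta> \<Longrightarrow> \<exists>\<xi>\<in>elts \<beta>. \<exists>b. rel f \<xi> b \<and> ord_le \<alpha> b"
    unfolding cofinal_map_def by blast
  have "AE (\<lambda>x. \<exists>i\<in>elts \<beta>. x \<in> elts (suc (app f i)))"
  proof (rule AE_True)
    fix x assume "x \<in> elts \<delta>"
    with f(2) obtain i b where "i \<in> elts \<beta>" "rel f i b" "ord_le x b" by blast
    then have "x \<in> elts (suc (app f i))"
      using function_between_app[OF f(1)] by (auto simp: ord_le_def mem_elts)
    with \<open>i \<in> elts \<beta>\<close> show "\<exists>i\<in>elts \<beta>. x \<in> elts (suc (app f i))" by blast
  qed
  then obtain i where i: "i \<in> elts \<beta>" "AE (\<lambda>x. x \<in> elts (suc (app f i)))"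
    using AE_partition[OF \<beta>, of "\<lambda>i x. x \<in> elts (suc (app f i))"] by (auto intro: dfn)
  have "suc (app f i) \<in> elts \<delta>"
    using function_between_app(2)[OF f(1) i(1)] cardinal_suc[OF cardinal_\<delta>] by blast
  from AE_ex[OF AE_conj[OF i(2) AE_above[OF this]]] show False
    using not_mem_sym by (auto intro: dfn)
qed

section \<open>Cardinal arithmetic from the measurable cardinal upwards\<close>

text \<open>If the Goedel order of \<theta> \<times> \<theta> were longer than \<theta>, some pair
  would have a set of predecessors of size \<theta>, inside the square of some m < \<theta>. The
  induction hypothesis for the cardinality of m refutes this.\<close>

theorem hessenberg:
  assumes "cardinal \<theta>" "elts \<delta> \<subseteq> elts \<theta>"
  shows "lep (prod \<theta> \<theta>) \<theta>"
proof -
  have "cardinal \<theta> \<and> elts \<delta> \<subseteq> elts \<theta> \<longrightarrow> lep (prod \<theta> \<theta>) \<theta>"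
  proof (rule ordinal_induct[OF cardinal_ordinal[OF assms(1)]])
    show "dfn1 (\<lambda>\<theta>. cardinal \<theta> \<and> elts \<delta> \<subseteq> elts \<theta> \<longrightarrow> lep (prod \<theta> \<theta>) \<theta>)" by (intro dfn)
  next
    fix \<theta> assume o\<theta>: "ordinal \<theta>"
      and IH: "\<And>\<sigma>. \<sigma> \<in> elts \<theta> \<Longrightarrow> cardinal \<sigma> \<and> elts \<delta> \<subseteq> elts \<sigma> \<longrightarrow> lep (prod \<sigma> \<sigma>) \<sigma>"
    show "cardinal \<theta> \<and> elts \<delta> \<subseteq> elts \<theta> \<longrightarrow> lep (prod \<theta> \<theta>) \<theta>"
    proof (intro impI, elim conjE)
      assume c\<theta>: "cardinal \<theta>" and \<delta>\<theta>: "elts \<delta> \<subseteq> elts \<theta>"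
      define A where "A = prod \<theta> \<theta>"
      obtain F where F: "trm1 F" "\<And>a. a \<in> elts A \<Longrightarrow> elts (F a) = F ` {b \<in> elts A. godel_less b a}"
        "inj_on F (elts A)" "ordinal (rep A F)"
      proof (rule order_type[OF wfon_godel_less])
        show "dfn2 godel_less" by (intro dfn)
        show "godel_less a b \<or> a = b \<or> godel_less b a" if "a \<in> elts A" "b \<in> elts A" for a b
          using godel_less_total[OF o\<theta>] that unfolding A_def by blast
      qed (rule that, assumption, simp_all)
      have "\<theta> \<notin> elts (rep A F)"
      proof
        assume "\<theta> \<in> elts (rep A F)"
        then obtain p where p: "p \<in> elts A" "\<theta> = F p" using F(1) by auto
        \<comment> \<open>The successor is taken since predecessors of p may have the same maximum
          as p.\<close>
        define m where "m = suc (mx p)"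
        obtain a b where ab: "p = pair a b" "a \<in> elts \<theta>" "b \<in> elts \<theta>"
          using p(1) by (auto simp: A_def)
        have oab: "ordinal a" "ordinal b" using ab ordinal_mem[OF o\<theta>] by blast+
        have "mx p = a \<or> mx p = b"
          using ordinal_vun[OF oab] by (simp add: mx_def ab)
        then have mxp: "mx p \<in> elts \<theta>" using ab by auto
        have m: "m \<in> elts \<theta>"
          using mxp cardinal_suc[OF c\<theta> \<delta>\<theta>] by (simp add: m_def)
        have below: "q \<in> elts (prod m m)" if q: "q \<in> elts A" "godel_less q p" for q
        proof -
          obtain c d where cd: "q = pair c d" "c \<in> elts \<theta>" "d \<in> elts \<theta>"
            using q(1) by (auto simp: A_def)
          have ocd: "ordinal c" "ordinal d" using cd ordinal_mem[OF o\<theta>] by blast+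
          have "elts (mx q) \<subseteq> elts (mx p)"
            using q(2) ordinal_mem_subset[OF ordinal_mem[OF o\<theta> mxp], of "mx q"]
            by (auto simp: godel_less_def)
          then have "elts c \<subseteq> elts (mx p)" "elts d \<subseteq> elts (mx p)"
            by (auto simp: mx_def cd)
          then have "c \<in> elts m" "d \<in> elts m"
            using ordinal_subset_iff[OF _ ordinal_mem[OF o\<theta> mxp]] ocd by (auto simp: m_def)
          then show ?thesis using cd by simp
        qed
        have "lep \<theta> (prod m m)"
        proof (rule lep_surj[OF F(1)])
          have "elts \<theta> = F ` {b \<in> elts A. godel_less b p}" using F(2)[OF p(1)] p(2) by simp
          then show "elts \<theta> \<subseteq> F ` elts (prod m m)" using below by auto
        qed
        moreover obtain \<sigma> where \<sigma>: "cardinal \<sigma>" "elts \<sigma> \<subseteq> elts m" "lep m \<sigma>"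
          using ex_cardinality[OF ordinal_mem[OF o\<theta> m]] by blast
        moreover have "lep (prod m m) (prod \<sigma> \<sigma>)"
          using lep_prod[OF \<sigma>(3) \<sigma>(3)] .
        ultimately have le: "lep \<theta> (prod \<sigma> \<sigma>)" using lep_trans by blast
        have \<sigma>\<theta>: "\<sigma> \<in> elts \<theta>"
          using ordinal_subset_mem_trans[OF cardinal_ordinal[OF \<sigma>(1)] o\<theta> \<sigma>(2) ordinal_mem[OF o\<theta> m] m] .
        show False
        \<comment> \<open>The induction hypothesis speaks only of cardinals from \<delta> on; below
          \<delta> the measure takes over.\<close>
        proof (cases "elts \<delta> \<subseteq> elts \<sigma>")
          case True
          then have "lep \<theta> \<sigma>" using IH[OF \<sigma>\<theta>] \<sigma>(1) le lep_trans by blast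
          then show False using cardinal_not_lep[OF c\<theta> \<sigma>\<theta>] by blast
        next
          case False
          then have "\<sigma> \<in> elts \<delta>"
            using ordinal_not_mem_iff[OF ordinal_\<delta> cardinal_ordinal[OF \<sigma>(1)]] by blast
          moreover have "lep \<delta> (prod \<sigma> \<sigma>)"
            using lep_trans[OF lep_subset[OF \<delta>\<theta>] le] .
          ultimately show False using not_lep_prod_below by blast
        qed
      qed
      then have sub: "elts (rep A F) \<subseteq> elts \<theta>"
        using ordinal_not_mem_iff[OF F(4) o\<theta>] by blast
      show "lep (prod \<theta> \<theta>) \<theta>"
        by (rule lepI[OF F(1)]) (use sub F(1,3) in \<open>auto simp: A_def[symmetric] inj_on_eq_iff\<close>)
    qed
  qed
  with assms show ?thesis by blast
qed

text \<open>(2^\<theta>)^\<delta> \<le> 2^\<theta>: a family of subsets of \<theta> indexed by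
  \<delta> is a subset of \<delta> \<times> \<theta>, which the pairing injection \<open>h\<close>
  codes as a subset of \<theta>.\<close>

lemma lep_funs_pow:
  assumes "cardinal \<theta>" "elts \<delta> \<subseteq> elts \<theta>"
  shows "lep (funs \<delta> (pow \<theta>)) (pow \<theta>)"
proof -
  obtain h where h: "\<And>x. x \<in> elts (prod \<theta> \<theta>) \<Longrightarrow> app h x \<in> elts \<theta>"
    "\<And>x y. x \<in> elts (prod \<theta> \<theta>) \<Longrightarrow> y \<in> elts (prod \<theta> \<theta>) \<Longrightarrow> app h x = app h y \<Longrightarrow> x = y"
    by (rule lepE[OF hessenberg[OF assms]]) blast
  define F where "F f = sep \<theta> (\<lambda>x. \<exists>\<xi>\<in>elts \<delta>. \<exists>\<eta>\<in>elts (app f \<xi>). app h (pair \<xi> \<eta>) = x)" for f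
  have F: "elts (F f) = {x \<in> elts \<theta>. \<exists>\<xi>\<in>elts \<delta>. \<exists>\<eta>\<in>elts (app f \<xi>). app h (pair \<xi> \<eta>) = x}" for f
    unfolding F_def by (rule elts_sep) (intro dfn)
  have key: "\<eta> \<in> elts (app g \<xi>)"
    if f: "f \<in> elts (funs \<delta> (pow \<theta>))" and g: "g \<in> elts (funs \<delta> (pow \<theta>))" and eq: "F f = F g"
      and \<xi>: "\<xi> \<in> elts \<delta>" and \<eta>: "\<eta> \<in> elts (app f \<xi>)" for f g \<xi> \<eta>
  proof -
    have "\<eta> \<in> elts \<theta>" using app_in[OF f \<xi>] \<eta> by auto
    then have p: "pair \<xi> \<eta> \<in> elts (prod \<theta> \<theta>)" using \<xi> assms(2) by auto
    then have "app h (pair \<xi> \<eta>) \<in> elts (F f)" unfolding F using h(1) \<xi> \<eta> by blast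
    then have "app h (pair \<xi> \<eta>) \<in> elts (F g)" using eq by simp
    then obtain \<xi>' \<eta>' where *: "\<xi>' \<in> elts \<delta>" "\<eta>' \<in> elts (app g \<xi>')" "app h (pair \<xi>' \<eta>') = app h (pair \<xi> \<eta>)"
      unfolding F by blast
    have "\<eta>' \<in> elts \<theta>" using app_in[OF g *(1)] *(2) by auto
    then have "pair \<xi>' \<eta>' \<in> elts (prod \<theta> \<theta>)" using *(1) assms(2) by auto
    with h(2)[OF _ p *(3)] have "pair \<xi>' \<eta>' = pair \<xi> \<eta>" by blast
    with * show ?thesis by simp
  qed
  show ?thesis
  proof (rule lepI[of F])
    show "trm1 F" unfolding F_def by (intro dfn)
    show "F f \<in> elts (pow \<theta>)" for f using F by auto
    show "f = g" if f: "f \<in> elts (funs \<delta> (pow \<theta>))" and g: "g \<in> elts (funs \<delta> (pow \<theta>))" and eq: "F f = F g" for f g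
    proof (rule funs_eqI[OF f g])
      show "app f \<xi> = app g \<xi>" if "\<xi> \<in> elts \<delta>" for \<xi>
        using key[OF f g eq that] key[OF g f eq[symmetric] that] by (intro extensionality) blast
    qed
  qed
qed

text \<open>A point x is coded by an index i with x in \<open>B i\<close>, together with its place
  under a chosen injection of \<open>B i\<close> into \<theta>.\<close>

lemma lep_UN:
  assumes \<theta>: "cardinal \<theta>" "elts \<delta> \<subseteq> elts \<theta>" and B: "trm1 B" and A: "lep A \<theta>"
    and le: "\<And>i. i \<in> elts A \<Longrightarrow> lep (B i) \<theta>"
    and X: "\<And>x. x \<in> elts X \<Longrightarrow> \<exists>i\<in>elts A. x \<in> elts (B i)"
  shows "lep X \<theta>"
proof -
  note [dfn, simp] = trm1_subst[OF B]
  define Q where "Q i f \<longleftrightarrow> (\<forall>x\<in>elts (B i). app f x \<in> elts \<theta> \<and> (\<forall>y\<in>elts (B i). app f x = app f y \<longrightarrow> x = y))" for i f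
  have "dfn2 Q" unfolding Q_def by (intro dfn)
  \<comment> \<open>\<open>choice_fun\<close> needs a set of candidates, so the injection is cut
    down to its graph on \<open>B i\<close>.\<close>
  moreover have "\<exists>f\<in>elts (pow (prod (vunion (rep A B)) \<theta>)). Q i f" if i: "i \<in> elts A" for i
  proof -
    obtain f where f: "\<And>x. x \<in> elts (B i) \<Longrightarrow> app f x \<in> elts \<theta>"
      "\<And>x y. x \<in> elts (B i) \<Longrightarrow> y \<in> elts (B i) \<Longrightarrow> app f x = app f y \<Longrightarrow> x = y"
      by (rule lepE[OF le[OF i]]) blast
    have "Q i (lam (B i) (app f))" unfolding Q_def using f by simp
    moreover have "elts (lam (B i) (app f)) \<subseteq> elts (prod (vunion (rep A B)) \<theta>)"
      using f(1) i by auto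
    ultimately show ?thesis by (intro bexI[of _ "lam (B i) (app f)"]) (simp_all only: elts_pow mem_Collect_eq)
  qed
  ultimately obtain c where c: "\<And>i. i \<in> elts A \<Longrightarrow> Q i (app c i)"
    by (rule choice_fun) blast+
  have "dfn2 (\<lambda>x i. x \<in> elts (B i))" by (intro dfn)
  from this X obtain g where g: "g \<in> elts (funs X A)" "\<And>x. x \<in> elts X \<Longrightarrow> x \<in> elts (B (app g x))"
    by (rule choice_fun) blast+
  obtain h where h: "\<And>x. x \<in> elts A \<Longrightarrow> app h x \<in> elts \<theta>"
    "\<And>x y. x \<in> elts A \<Longrightarrow> y \<in> elts A \<Longrightarrow> app h x = app h y \<Longrightarrow> x = y"
    by (rule lepE[OF A]) blast
  have "lep X (prod \<theta> \<theta>)"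
  proof (rule lepI[of "\<lambda>x. pair (app h (app g x)) (app (app c (app g x)) x)"])
    show "trm1 (\<lambda>x. pair (app h (app g x)) (app (app c (app g x)) x))" by (intro dfn)
  next
    fix x assume x: "x \<in> elts X"
    have gx: "app g x \<in> elts A" using app_in[OF g(1) x] .
    show "pair (app h (app g x)) (app (app c (app g x)) x) \<in> elts (prod \<theta> \<theta>)"
      using h(1)[OF gx] c[OF gx] g(2)[OF x] by (simp add: Q_def)
  next
    fix x y assume x: "x \<in> elts X" and y: "y \<in> elts X"
      and "pair (app h (app g x)) (app (app c (app g x)) x) = pair (app h (app g y)) (app (app c (app g y)) y)"
    then have eq: "app h (app g x) = app h (app g y)" "app (app c (app g x)) x = app (app c (app g y)) y"
      by simp_all
    have gx: "app g x \<in> elts A" using app_in[OF g(1) x] .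
    have gy: "app g y \<in> elts A" using app_in[OF g(1) y] .
    have "app g x = app g y" using h(2)[OF gx gy eq(1)] .
    with c[OF gx] g(2)[OF x] g(2)[OF y] eq(2) show "x = y" by (simp add: Q_def)
  qed
  with hessenberg[OF \<theta>] show ?thesis using lep_trans by blast
qed

text \<open>A short cofinal map would present \<kappa> as a union of at most \<nu> sets of size at
  most \<nu>.\<close>

lemma successor_regular:
  assumes succ: "successor_cardinal \<kappa> \<nu>" and \<nu>: "cardinal \<nu>" "elts \<delta> \<subseteq> elts \<nu>" and \<beta>: "\<beta> \<in> elts \<kappa>"
  shows "\<not> cofinal_map f \<beta> \<kappa>"
proof
  assume cof: "cofinal_map f \<beta> \<kappa>"
  then have f: "function_between f \<beta> \<kappa>"
    "\<And>\<alpha>. \<alpha> \<in> elts \<kappa> \<Longrightarrow> \<exists>\<xi>\<in>elts \<beta>. \<exists>b. rel f \<xi> b \<and> ord_le \<alpha> b"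
    unfolding cofinal_map_def by blast+
  have \<kappa>: "cardinal \<kappa>" "\<nu> \<in> elts \<kappa>"
    using succ by (simp_all add: successor_cardinal_def mem_elts)
  have \<delta>\<kappa>: "elts \<delta> \<subseteq> elts \<kappa>"
    using \<nu>(2) \<kappa> ordinal_mem_subset cardinal_ordinal by blast
  have "lep \<kappa> \<nu>"
  proof (rule lep_UN[OF \<nu>, of "\<lambda>i. suc (app f i)" \<beta>])
    show "trm1 (\<lambda>i. suc (app f i))" by (intro dfn)
    show "lep \<beta> \<nu>" using successor_cardinal_lep[OF succ \<nu>(1) \<beta>] .
    show "lep (suc (app f i)) \<nu>" if "i \<in> elts \<beta>" for i
      using successor_cardinal_lep[OF succ \<nu>(1)] cardinal_suc[OF \<kappa>(1) \<delta>\<kappa>]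
        function_between_app(2)[OF f(1) that] by blast
    show "\<exists>i\<in>elts \<beta>. x \<in> elts (suc (app f i))" if x: "x \<in> elts \<kappa>" for x
    proof -
      obtain i b where "i \<in> elts \<beta>" "rel f i b" "ord_le x b" using f(2)[OF x] by blast
      then have "x \<in> elts (suc (app f i))"
        using function_between_app[OF f(1)] by (auto simp: ord_le_def mem_elts)
      with \<open>i \<in> elts \<beta>\<close> show ?thesis by blast
    qed
  qed
  with cardinal_not_lep[OF \<kappa>] show False by blast
qed

end

section \<open>Dependent choice\<close>

context ZFC_model
begin

lemma dependent_choice:
  assumes w: "is_omega w" and c: "\<And>x. x \<in> elts S \<Longrightarrow> app c x \<in> elts S" and s0: "s0 \<in> elts S"
  obtains s where "trm1 s" "\<And>n. n \<in> elts w \<Longrightarrow> s n \<in> elts S"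
    "\<And>n. n \<in> elts w \<Longrightarrow> s (suc n) = app c (s n)"
proof -
  \<comment> \<open>Recursion passes on only the set of earlier values, so \<open>F n\<close> is the
    pair of \<open>n\<close> and the value there; this set is then the graph of the sequence below
    \<open>n\<close>. Its domain is \<open>n\<close>, and the union of \<open>n\<close> is the
    predecessor if \<open>n\<close> is a successor. The test for membership in \<open>S\<close>
    gives a point of \<open>S\<close> also at zero, where the looked-up value is a default.\<close>
  define H where "H Y = pair (rep Y pfst)
    (if app Y (vunion (rep Y pfst)) \<in> elts S then app c (app Y (vunion (rep Y pfst))) else s0)" for Y
  have H: "trm1 H" unfolding H_def by (intro dfn)
  have ow: "ordinal w" using w by (simp add: is_omega_def limit_ordinal_def)
  have "dfn2 mem" by (intro dfn)
  obtain F where F: "trm1 F" "\<And>n. n \<in> elts w \<Longrightarrow> F n = H (rep (sep w (\<lambda>m. mem m n)) F)"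
    by (rule wf_recursion[OF wfon_mem \<open>dfn2 mem\<close> H]) blast
  note [dfn, simp] = trm1_subst[OF F(1)]
  have F_eq: "F n = H (rep n F)" if n: "n \<in> elts w" for n
  proof -
    have "sep w (\<lambda>m. mem m n) = n"
      using ordinal_mem_trans[OF ow n] by (intro extensionality) (auto simp: mem_elts)
    with F(2)[OF n] show ?thesis by simp
  qed
  have fst: "pfst (F n) = n" if "n \<in> elts w" for n
  proof (rule wfon_induct[OF wfon_mem _ that])
    show "dfn1 (\<lambda>n. pfst (F n) = n)" by (intro dfn)
    fix n assume n: "n \<in> elts w" and IH: "\<And>m. m \<in> elts w \<Longrightarrow> mem m n \<Longrightarrow> pfst (F m) = m"
    have "(pfst \<circ> F) ` elts n = id ` elts n"
      using IH ordinal_mem_trans[OF ow n] by (intro image_cong) (auto simp: mem_elts)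
    then have "rep (rep n F) pfst = n"
      by (intro extensionality) (simp add: image_comp)
    then show "pfst (F n) = n" by (simp add: F_eq[OF n] H_def)
  qed
  have rep_fst: "rep (rep n F) pfst = n" if n: "n \<in> elts w" for n
    using fst[OF n] by (simp add: F_eq[OF n] H_def)
  have F_pair: "F n = pair n (psnd (F n))" if n: "n \<in> elts w" for n
  proof -
    obtain y where "F n = pair n y"
      using rep_fst[OF n] by (simp add: F_eq[OF n] H_def)
    then show ?thesis by simp
  qed
  define s where "s n = psnd (F n)" for n
  have s_eq: "s n = (if app (rep n F) (vunion n) \<in> elts S then app c (app (rep n F) (vunion n)) else s0)"
    if "n \<in> elts w" for n
    using rep_fst[OF that] by (simp add: s_def F_eq[OF that] H_def)
  have sS: "s n \<in> elts S" if "n \<in> elts w" for n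
    using s_eq[OF that] c s0 by simp
  have "s (suc n) = app c (s n)" if n: "n \<in> elts w" for n
  proof -
    have sn: "suc n \<in> elts w" using omega_suc[OF w n] .
    have "elts n \<subseteq> elts w" using ordinal_mem_trans[OF ow n] by blast
    have "vunion (suc n) = n"
      using ordinal_mem_trans[OF ordinal_mem[OF ow n]] by (intro extensionality) auto
    moreover have "app (rep (suc n) F) n = s n"
    proof (rule app_eqI)
      have "F n = pair n (s n)" using F_pair[OF n] by (simp add: s_def)
      then show "pair n (s n) \<in> elts (rep (suc n) F)" by auto
      show "z = s n" if "pair n z \<in> elts (rep (suc n) F)" for z
      proof -
        from that obtain m where m: "m \<in> elts (suc n)" "pair n z = F m" by auto
        then have "m \<in> elts w" using n \<open>elts n \<subseteq> elts w\<close> by auto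
        with m(2) fst have "m = n" by (metis pfst_pair)
        with m(2) show ?thesis by (metis psnd_pair s_def)
      qed
    qed
    ultimately show ?thesis using s_eq[OF sn] sS[OF n] by simp
  qed
  moreover have "trm1 s" unfolding s_def by (intro dfn)
  ultimately show thesis using that sS by blast
qed

end

context measure_model
begin

section \<open>The ultrapower\<close>

lemma AE_const [simp]: "AE (\<lambda>x. p) \<longleftrightarrow> p"
  using AE_True[of "\<lambda>x. True"] AE_not[of "\<lambda>x. True"] by (cases p) (auto intro: dfn)

lemma AE_disj:
  assumes "AE (\<lambda>x. P x \<or> Q x)" and P: "dfn1 P" and Q: "dfn1 Q"
  shows "AE P \<or> AE Q"
proof (rule ccontr)
  assume "\<not> (AE P \<or> AE Q)"
  then have "AE (\<lambda>x. \<not> P x)" "AE (\<lambda>x. \<not> Q x)"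
    using AE_not[OF P] AE_not[OF Q] by blast+
  from AE_conj[OF this dfn_not[OF P] dfn_not[OF Q]]
  have "AE (\<lambda>x. \<not> (P x \<or> Q x))" by simp
  with assms(1) AE_not[OF dfn_disj[OF P Q]] show False by blast
qed

text \<open>Off the set of measure one any element of \<open>B\<close> may be chosen; this is the
  role of the implication in \<open>R\<close>.\<close>

lemma AE_choice:
  assumes Q: "dfn2 Q" and AE: "AE (\<lambda>x. \<exists>y\<in>elts B. Q y x)"
  obtains g where "g \<in> elts (funs \<delta> B)" "AE (\<lambda>x. Q (app g x) x)"
proof -
  note [dfn, simp] = dfn2_subst[OF Q]
  have "dfn1 (\<lambda>x. \<exists>y\<in>elts B. Q y x)" by (intro dfn)
  from AE_ex[OF AE this] have "elts B \<noteq> {}" by blast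
  define R where "R x y \<longleftrightarrow> ((\<exists>y\<in>elts B. Q y x) \<longrightarrow> Q y x)" for x y
  have "dfn2 R" unfolding R_def by (intro dfn)
  have R: "\<exists>y\<in>elts B. R x y" for x using \<open>elts B \<noteq> {}\<close> unfolding R_def by blast
  obtain g where g: "g \<in> elts (funs \<delta> B)" "\<And>x. x \<in> elts \<delta> \<Longrightarrow> R x (app g x)"
    by (rule choice_fun[OF \<open>dfn2 R\<close>, of \<delta> B]) (use R in blast)+
  have "AE (\<lambda>x. Q (app g x) x)"
    by (rule AE_mono[OF AE \<open>dfn1 (\<lambda>x. \<exists>y\<in>elts B. Q y x)\<close>]) (intro dfn, use g(2) in \<open>auto simp: R_def\<close>)
  with g(1) show thesis by (rule that)
qed

section \<open>Equality and membership modulo the measure, and the collapse\<close>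

definition feq :: "'v \<Rightarrow> 'v \<Rightarrow> bool" where
  "feq f g \<longleftrightarrow> AE (\<lambda>x. app f x = app g x)"

definition fmem :: "'v \<Rightarrow> 'v \<Rightarrow> bool" where
  "fmem f g \<longleftrightarrow> AE (\<lambda>x. app f x \<in> elts (app g x))"

lemma dfn_feq [dfn, simp]: "trm t \<Longrightarrow> trm u \<Longrightarrow> dfn (\<lambda>e. feq (t e) (u e))"
  by (rule dfn2_subst[of feq]) (unfold feq_def, intro dfn)

lemma dfn_fmem [dfn, simp]: "trm t \<Longrightarrow> trm u \<Longrightarrow> dfn (\<lambda>e. fmem (t e) (u e))"
  by (rule dfn2_subst[of fmem]) (unfold fmem_def, intro dfn)

lemma feq_sym: "feq f g \<Longrightarrow> feq g f"
  by (simp add: feq_def eq_commute)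

lemma fmem_feq_left: "feq f f' \<Longrightarrow> fmem f g \<Longrightarrow> fmem f' g"
  unfolding feq_def fmem_def by (erule AE_mono2, assumption) (intro dfn | simp)+

lemma fmem_feq_right: "feq g g' \<Longrightarrow> fmem f g \<Longrightarrow> fmem f g'"
  unfolding feq_def fmem_def by (erule AE_mono2, assumption) (intro dfn | simp)+

text \<open>An infinite \<^const>\<open>fmem\<close>-descending sequence would, by countable completeness, descend at
  some point of \<^term>\<open>\<delta>\<close>.\<close>

lemma wfon_fmem: "wfon fmem A"
  unfolding wfon_def
proof (intro allI impI, rule ccontr)
  fix S assume S: "elts S \<subseteq> elts A \<and> elts S \<noteq> {}" and n: "\<not> (\<exists>m\<in>elts S. \<forall>x\<in>elts S. \<not> fmem x m)"
  obtain w where w: "is_omega w" "w \<in> elts \<delta>"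
    using uncountable by (auto simp: uncountable_cardinal_def mem_elts)
  have "dfn2 (\<lambda>m x. fmem x m)" by (intro dfn)
  moreover have "\<exists>x\<in>elts S. fmem x m" if "m \<in> elts S" for m using n that by blast
  ultimately obtain c where c: "c \<in> elts (funs S S)" "\<And>m. m \<in> elts S \<Longrightarrow> fmem (app c m) m"
    by (rule choice_fun) blast+
  obtain s0 where "s0 \<in> elts S" using S by blast
  obtain s where s: "trm1 s" "\<And>n. n \<in> elts w \<Longrightarrow> s n \<in> elts S"
    "\<And>n. n \<in> elts w \<Longrightarrow> s (suc n) = app c (s n)"
    by (rule dependent_choice[OF w(1) app_in[OF c(1)] \<open>s0 \<in> elts S\<close>]) blast+
  note [dfn, simp] = trm1_subst[OF s(1)]
  define P where "P n x \<longleftrightarrow> \<not> app (s (suc n)) x \<in> elts (app (s n) x)" for n x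
  have P: "dfn2 P" unfolding P_def by (intro dfn)
  have "\<not> AE (P n)" if "n \<in> elts w" for n
  proof -
    have "AE (\<lambda>x. app (s (suc n)) x \<in> elts (app (s n) x))"
      using c(2)[OF s(2)[OF that]] s(3)[OF that] by (simp add: fmem_def)
    moreover have d: "dfn1 (\<lambda>x. app (s (suc n)) x \<in> elts (app (s n) x))" by (intro dfn)
    ultimately show ?thesis unfolding P_def AE_not[OF d] by blast
  qed
  then have "\<not> AE (\<lambda>x. \<exists>n\<in>elts w. P n x)"
    using AE_partition[OF w(2) P] by blast
  moreover have d: "dfn1 (\<lambda>x. \<exists>n\<in>elts w. P n x)" unfolding P_def by (intro dfn)
  ultimately have "AE (\<lambda>x. \<not> (\<exists>n\<in>elts w. P n x))"
    unfolding AE_not[OF d] by blast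
  from AE_ex[OF this dfn_not[OF d]] obtain x where x: "\<And>n. n \<in> elts w \<Longrightarrow> app (s (suc n)) x \<in> elts (app (s n) x)"
    unfolding P_def by blast
  have R: "elts (rep w (\<lambda>n. app (s n) x)) = (\<lambda>n. app (s n) x) ` elts w" by simp
  have "elts w \<noteq> {}" using w(1) by (simp add: is_omega_def limit_ordinal_def)
  then obtain n where "n \<in> elts w" "elts (app (s n) x) \<inter> (\<lambda>n. app (s n) x) ` elts w = {}"
    using foundation[of "rep w (\<lambda>n. app (s n) x)"] unfolding R by blast
  then show False using x omega_suc[OF w(1)] by blast
qed

text \<open>The ultrapower of the set \<open>T\<close>, collapsed. The operator \<open>SOME\<close>
  fixes one definable collapse; its values on the functions from \<delta> to \<open>T\<close> are
  determined by wellfounded recursion.\<close>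

definition PI :: "'v \<Rightarrow> 'v \<Rightarrow> 'v" where
  "PI T = (SOME F. trm1 F \<and> (\<forall>f\<in>elts (funs \<delta> T). elts (F f) = F ` {g \<in> elts (funs \<delta> T). fmem g f}))"

lemma PI:
  shows trm1_PI: "trm1 (PI T)"
    and elts_PI: "f \<in> elts (funs \<delta> T) \<Longrightarrow> elts (PI T f) = PI T ` {g \<in> elts (funs \<delta> T). fmem g f}"
proof -
  have "dfn2 fmem" by (intro dfn)
  obtain F where "trm1 F" "\<And>f. f \<in> elts (funs \<delta> T) \<Longrightarrow> elts (F f) = F ` {g \<in> elts (funs \<delta> T). fmem g f}"
    by (rule collapse[OF wfon_fmem \<open>dfn2 fmem\<close>]) blast
  then have "\<exists>F. trm1 F \<and> (\<forall>f\<in>elts (funs \<delta> T). elts (F f) = F ` {g \<in> elts (funs \<delta> T). fmem g f})"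
    by blast
  from someI_ex[OF this]
  show "trm1 (PI T)" "f \<in> elts (funs \<delta> T) \<Longrightarrow> elts (PI T f) = PI T ` {g \<in> elts (funs \<delta> T). fmem g f}"
    unfolding PI_def by blast+
qed

lemmas trm_PI [dfn, simp] = trm1_subst[OF trm1_PI]

lemma PI_memI: "f \<in> elts (funs \<delta> T) \<Longrightarrow> g \<in> elts (funs \<delta> T) \<Longrightarrow> fmem g f \<Longrightarrow> PI T g \<in> elts (PI T f)"
  by (simp add: elts_PI)

lemma PI_memE:
  assumes "f \<in> elts (funs \<delta> T)" "y \<in> elts (PI T f)"
  obtains g where "g \<in> elts (funs \<delta> T)" "fmem g f" "y = PI T g"
  using assms by (auto simp: elts_PI)

lemma PI_cong:
  assumes "f \<in> elts (funs \<delta> T)" "g \<in> elts (funs \<delta> T)" "feq f g"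
  shows "PI T f = PI T g"
proof -
  have "{h \<in> elts (funs \<delta> T). fmem h f} = {h \<in> elts (funs \<delta> T). fmem h g}"
    using fmem_feq_right[OF assms(3)] fmem_feq_right[OF feq_sym[OF assms(3)]] by blast
  then show ?thesis
    using elts_PI[OF assms(1)] elts_PI[OF assms(2)] by (intro extensionality) simp
qed

text \<open>The witnesses at the single points lie in \<open>T\<close> by transitivity, so they can
  be gathered into one function. This makes \<open>fmem\<close> extensional modulo
  \<open>feq\<close>.\<close>

lemma fun_memE:
  assumes T: "trans_set T" and f: "f \<in> elts (funs \<delta> T)" and g: "g \<in> elts (funs \<delta> T)"
    and AE: "AE (\<lambda>x. \<exists>y. y \<in> elts (app f x) \<and> y \<notin> elts (app g x))"
  obtains h where "h \<in> elts (funs \<delta> T)" "fmem h f" "\<not> fmem h g"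
proof -
  have d: "dfn1 (\<lambda>x. \<exists>y. y \<in> elts (app f x) \<and> y \<notin> elts (app g x))"
    "dfn1 (\<lambda>x. \<exists>y\<in>elts T. y \<in> elts (app f x) \<and> y \<notin> elts (app g x))"
    "dfn2 (\<lambda>y x. y \<in> elts (app f x) \<and> y \<notin> elts (app g x))"
    by (intro dfn)+
  have "AE (\<lambda>x. \<exists>y\<in>elts T. y \<in> elts (app f x) \<and> y \<notin> elts (app g x))"
    by (rule AE_mono[OF AE d(1,2)]) (use trans_setD[OF T app_in[OF f]] in blast)
  then obtain h where h: "h \<in> elts (funs \<delta> T)" "AE (\<lambda>x. app h x \<in> elts (app f x) \<and> app h x \<notin> elts (app g x))"
    by (rule AE_choice[OF d(3)])
  have d': "dfn1 (\<lambda>x. app h x \<in> elts (app f x) \<and> app h x \<notin> elts (app g x))"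
    "dfn1 (\<lambda>x. app h x \<in> elts (app f x))" "dfn1 (\<lambda>x. app h x \<in> elts (app g x))"
    "dfn1 (\<lambda>x. app h x \<notin> elts (app g x))"
    by (intro dfn)+
  have "fmem h f" unfolding fmem_def by (rule AE_mono[OF h(2) d'(1,2)]) blast
  moreover have "AE (\<lambda>x. app h x \<notin> elts (app g x))" by (rule AE_mono[OF h(2) d'(1,4)]) blast
  then have "\<not> fmem h g" using AE_not[OF d'(3)] unfolding fmem_def by blast
  ultimately show thesis using h(1) that by blast
qed

text \<open>Induction on f along \<open>fmem\<close>. If f and g differ almost everywhere, one of
  them has, almost everywhere, an element that the other lacks; such a witness has a counterpart
  with the same collapse on the other side.\<close>

lemma PI_eq_iff:
  assumes T: "trans_set T" and f: "f \<in> elts (funs \<delta> T)" and g: "g \<in> elts (funs \<delta> T)"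
  shows "PI T f = PI T g \<longleftrightarrow> feq f g"
proof
  define N where "N = funs \<delta> T"
  have "\<forall>g\<in>elts N. PI T f = PI T g \<longrightarrow> feq f g"
  proof (rule wfon_induct[OF wfon_fmem])
    show "f \<in> elts N" using f by (simp add: N_def)
    show "dfn1 (\<lambda>f. \<forall>g\<in>elts N. PI T f = PI T g \<longrightarrow> feq f g)" by (intro dfn)
  next
    fix f assume f: "f \<in> elts N"
      and IH: "\<And>h. h \<in> elts N \<Longrightarrow> fmem h f \<Longrightarrow> \<forall>g\<in>elts N. PI T h = PI T g \<longrightarrow> feq h g"
    show "\<forall>g\<in>elts N. PI T f = PI T g \<longrightarrow> feq f g"
    proof (intro ballI impI, rule ccontr)
      fix g assume g: "g \<in> elts N" and eq: "PI T f = PI T g" and ne: "\<not> feq f g"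
      have d: "dfn1 (\<lambda>x. app f x = app g x)" "dfn1 (\<lambda>x. app f x \<noteq> app g x)"
        "dfn1 (\<lambda>x. \<exists>y. y \<in> elts (app f x) \<and> y \<notin> elts (app g x))"
        "dfn1 (\<lambda>x. \<exists>y. y \<in> elts (app g x) \<and> y \<notin> elts (app f x))"
        by (intro dfn)+
      have "AE (\<lambda>x. app f x \<noteq> app g x)" using ne AE_not[OF d(1)] unfolding feq_def by blast
      then have "AE (\<lambda>x. (\<exists>y. y \<in> elts (app f x) \<and> y \<notin> elts (app g x)) \<or>
          (\<exists>y. y \<in> elts (app g x) \<and> y \<notin> elts (app f x)))"
        by (rule AE_mono[OF _ d(2) dfn_disj[OF d(3,4)]]) (use extensionality in blast)
      from AE_disj[OF this d(3,4)] show False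
      proof
        assume "AE (\<lambda>x. \<exists>y. y \<in> elts (app f x) \<and> y \<notin> elts (app g x))"
        then obtain h where h: "h \<in> elts N" "fmem h f" "\<not> fmem h g"
          unfolding N_def by (rule fun_memE[OF T f[unfolded N_def] g[unfolded N_def]])
        then have "PI T h \<in> elts (PI T g)" using PI_memI f eq unfolding N_def by metis
        then obtain h' where h': "h' \<in> elts N" "fmem h' g" "PI T h = PI T h'"
          using PI_memE g unfolding N_def by metis
        then have "feq h h'" using IH[OF h(1,2)] by blast
        then show False using fmem_feq_left[OF feq_sym] h' h(3) by blast
      next
        assume "AE (\<lambda>x. \<exists>y. y \<in> elts (app g x) \<and> y \<notin> elts (app f x))"
        then obtain h where h: "h \<in> elts N" "fmem h g" "\<not> fmem h f"
          unfolding N_def by (rule fun_memE[OF T g[unfolded N_def] f[unfolded N_def]])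
        then have "PI T h \<in> elts (PI T f)" using PI_memI g eq unfolding N_def by metis
        then obtain h' where h': "h' \<in> elts N" "fmem h' f" "PI T h = PI T h'"
          using PI_memE f unfolding N_def by metis
        \<comment> \<open>Now the predecessor of \<open>f\<close> is \<open>h'\<close>, so the
          hypothesis is applied to \<open>h'\<close> and not to \<open>h\<close>.\<close>
        then have "feq h' h" using IH[OF h'(1,2)] h(1) by metis
        then show False using fmem_feq_left h' h(3) by blast
      qed
    qed
  qed
  then show "PI T f = PI T g \<Longrightarrow> feq f g" using g by (simp add: N_def)
qed (rule PI_cong[OF f g])

lemma PI_mem_iff:
  assumes T: "trans_set T" and f: "f \<in> elts (funs \<delta> T)" and g: "g \<in> elts (funs \<delta> T)"
  shows "PI T f \<in> elts (PI T g) \<longleftrightarrow> fmem f g"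
proof
  assume "PI T f \<in> elts (PI T g)"
  then obtain h where h: "h \<in> elts (funs \<delta> T)" "fmem h g" "PI T f = PI T h"
    by (rule PI_memE[OF g])
  then have "feq h f" using PI_eq_iff[OF T f h(1)] feq_sym by blast
  then show "fmem f g" using h(2) by (rule fmem_feq_left)
qed (rule PI_memI[OF g f])

text \<open>In the bounded case the witnesses are elements of values in \<open>T\<close>, hence in
  \<open>T\<close> by transitivity; the witness of an unbounded quantifier could leave
  \<open>T\<close>.\<close>

theorem los_Delta0:
  assumes T: "trans_set T"
  shows "Delta0 \<phi> \<Longrightarrow> (\<And>i. s i \<in> elts (funs \<delta> T)) \<Longrightarrow>
    sat mem \<phi> (\<lambda>i. PI T (s i)) \<longleftrightarrow> AE (\<lambda>x. sat mem \<phi> (\<lambda>i. app (s i) x))"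
proof (induction \<phi> arbitrary: s rule: Delta0.induct)
  case (1 i j)
  show ?case
    using PI_mem_iff[OF T 1[of i] 1[of j]] by (simp add: fmem_def mem_elts)
next
  case (2 i j)
  show ?case
    using PI_eq_iff[OF T 2[of i] 2[of j]] by (simp add: feq_def)
next
  case (3 \<phi>)
  have "dfn1 (\<lambda>x. sat mem \<phi> (\<lambda>i. app (s i) x))" by (intro dfn)
  from AE_not[OF this] 3 show ?case by simp
next
  case (4 \<phi> \<psi>)
  have d: "dfn1 (\<lambda>x. sat mem \<phi> (\<lambda>i. app (s i) x))" "dfn1 (\<lambda>x. sat mem \<psi> (\<lambda>i. app (s i) x))"
    by (intro dfn)+
  have "AE (\<lambda>x. sat mem \<phi> (\<lambda>i. app (s i) x) \<and> sat mem \<psi> (\<lambda>i. app (s i) x)) \<longleftrightarrow>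
      AE (\<lambda>x. sat mem \<phi> (\<lambda>i. app (s i) x)) \<and> AE (\<lambda>x. sat mem \<psi> (\<lambda>i. app (s i) x))"
    using AE_conj[OF _ _ d] AE_mono[OF _ dfn_conj[OF d] d(1)] AE_mono[OF _ dfn_conj[OF d] d(2)]
    by blast
  with 4 show ?case by simp
next
  case (5 \<phi> i j)
  define Q where "Q y x \<longleftrightarrow> y \<in> elts (app (s j) x) \<and> sat mem \<phi> (\<lambda>k. if k = i then y else app (s k) x)" for y x
  have Q: "dfn2 Q" unfolding Q_def by (intro dfn)
  note [dfn] = dfn2_subst[OF Q]
  have upd: "(\<lambda>k. t k)(i := y) = (\<lambda>k. if k = i then y else t k)" for t :: "nat \<Rightarrow> 'v" and y
    by auto
  have R: "sat mem (Ex i (Conj (Mem i j) \<phi>)) (\<lambda>k. app (s k) x) \<longleftrightarrow> (\<exists>y. Q y x)" for x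
    using \<open>i \<noteq> j\<close> by (auto simp: Q_def upd mem_elts)
  have IH: "sat mem \<phi> (\<lambda>k. if k = i then PI T g else PI T (s k)) \<longleftrightarrow>
      AE (\<lambda>x. sat mem \<phi> (\<lambda>k. if k = i then app g x else app (s k) x))"
    if "g \<in> elts (funs \<delta> T)" for g
  proof -
    have "sat mem \<phi> (\<lambda>k. PI T (if k = i then g else s k)) \<longleftrightarrow>
        AE (\<lambda>x. sat mem \<phi> (\<lambda>k. app (if k = i then g else s k) x))"
      using that 5 by (intro 5) auto
    then show ?thesis by (simp add: if_distrib if_distribR)
  qed
  have L: "sat mem (Ex i (Conj (Mem i j) \<phi>)) (\<lambda>k. PI T (s k)) \<longleftrightarrow>
      (\<exists>y\<in>elts (PI T (s j)). sat mem \<phi> (\<lambda>k. if k = i then y else PI T (s k)))"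
    using \<open>i \<noteq> j\<close> by (auto simp: upd mem_elts)
  show ?case unfolding L R
  proof
    assume "\<exists>y\<in>elts (PI T (s j)). sat mem \<phi> (\<lambda>k. if k = i then y else PI T (s k))"
    then obtain g where g: "g \<in> elts (funs \<delta> T)" "fmem g (s j)"
      "sat mem \<phi> (\<lambda>k. if k = i then PI T g else PI T (s k))"
      using PI_memE[OF 5(4)[of j]] by metis
    have d: "dfn1 (\<lambda>x. app g x \<in> elts (app (s j) x))"
      "dfn1 (\<lambda>x. sat mem \<phi> (\<lambda>k. if k = i then app g x else app (s k) x))" "dfn1 (\<lambda>x. \<exists>y. Q y x)"
      by (intro dfn)+
    show "AE (\<lambda>x. \<exists>y. Q y x)"
      by (rule AE_mono2[OF g(2)[unfolded fmem_def] g(3)[unfolded IH[OF g(1)]] d]) (auto simp: Q_def)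
  next
    assume AE: "AE (\<lambda>x. \<exists>y. Q y x)"
    have d: "dfn1 (\<lambda>x. \<exists>y. Q y x)" "dfn1 (\<lambda>x. \<exists>y\<in>elts T. Q y x)" by (intro dfn)+
    have "AE (\<lambda>x. \<exists>y\<in>elts T. Q y x)"
      by (rule AE_mono[OF AE d]) (use trans_setD[OF T app_in[OF 5(4)[of j]]] in \<open>auto simp: Q_def\<close>)
    then obtain g where g: "g \<in> elts (funs \<delta> T)" "AE (\<lambda>x. Q (app g x) x)"
      by (rule AE_choice[OF Q])
    have d': "dfn1 (\<lambda>x. app g x \<in> elts (app (s j) x))"
      "dfn1 (\<lambda>x. sat mem \<phi> (\<lambda>k. if k = i then app g x else app (s k) x))" "dfn1 (\<lambda>x. Q (app g x) x)"
      by (intro dfn)+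
    have "fmem g (s j)" unfolding fmem_def
      by (rule AE_mono[OF g(2) d'(3,1)]) (simp add: Q_def)
    moreover have "AE (\<lambda>x. sat mem \<phi> (\<lambda>k. if k = i then app g x else app (s k) x))"
      by (rule AE_mono[OF g(2) d'(3,2)]) (simp add: Q_def)
    ultimately show "\<exists>y\<in>elts (PI T (s j)). sat mem \<phi> (\<lambda>k. if k = i then y else PI T (s k))"
      using IH[OF g(1)] PI_memI[OF 5(4)[of j] g(1)] by blast
  qed
qed

text \<open>A function into the larger set that is \<open>fmem\<close> below f takes values in
  \<open>T\<close> almost everywhere, hence equals a function into \<open>T\<close> modulo the
  measure. So no new elements appear.\<close>

lemma PI_extend:
  assumes T: "trans_set T" and T': "trans_set T'" and sub: "elts T \<subseteq> elts T'" and f: "f \<in> elts (funs \<delta> T)"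
  shows "PI T' f = PI T f"
proof (rule wfon_induct[OF wfon_fmem _ f])
  show "dfn1 (\<lambda>f. PI T' f = PI T f)" by (intro dfn)
  fix f assume f: "f \<in> elts (funs \<delta> T)"
    and IH: "\<And>g. g \<in> elts (funs \<delta> T) \<Longrightarrow> fmem g f \<Longrightarrow> PI T' g = PI T g"
  have f': "f \<in> elts (funs \<delta> T')" using funs_mono[OF f sub] .
  show "PI T' f = PI T f"
  proof (rule extensionality, rule equalityI; rule subsetI)
    fix y assume "y \<in> elts (PI T' f)"
    then obtain g where g: "g \<in> elts (funs \<delta> T')" "fmem g f" "y = PI T' g"
      by (rule PI_memE[OF f'])
    have d: "dfn1 (\<lambda>x. app g x \<in> elts (app f x))" "dfn1 (\<lambda>x. \<exists>y\<in>elts T. y = app g x)"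
      "dfn2 (\<lambda>y x. y = app g x)"
      by (intro dfn)+
    have "AE (\<lambda>x. \<exists>y\<in>elts T. y = app g x)"
      by (rule AE_mono[OF g(2)[unfolded fmem_def] d(1,2)]) (use trans_setD[OF T app_in[OF f]] in blast)
    then obtain h where h: "h \<in> elts (funs \<delta> T)" "feq h g"
      unfolding feq_def by (rule AE_choice[OF d(3)])
    have "fmem h f" using fmem_feq_left[OF feq_sym[OF h(2)] g(2)] .
    moreover have "y = PI T' h" using PI_cong[OF g(1) funs_mono[OF h(1) sub] feq_sym[OF h(2)]] g(3) by simp
    ultimately show "y \<in> elts (PI T f)" using IH h(1) PI_memI[OF f h(1)] by simp
  next
    fix y assume "y \<in> elts (PI T f)"
    then obtain g where g: "g \<in> elts (funs \<delta> T)" "fmem g f" "y = PI T g"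
      by (rule PI_memE[OF f])
    then show "y \<in> elts (PI T' f)"
      using IH PI_memI[OF f' funs_mono[OF g(1) sub]] by simp
  qed
qed

section \<open>The embedding and its elementary properties\<close>

definition cst :: "'v \<Rightarrow> 'v" where
  "cst x = lam \<delta> (\<lambda>_. x)"

lemma trm_cst [dfn, simp]: "trm t \<Longrightarrow> trm (\<lambda>e. cst (t e))"
  by (rule trm1_subst[of cst]) (unfold cst_def, intro dfn)

lemma app_cst [simp]: "\<xi> \<in> elts \<delta> \<Longrightarrow> app (cst x) \<xi> = x"
  by (simp add: cst_def)

lemma cst_in: "x \<in> elts B \<Longrightarrow> cst x \<in> elts (funs \<delta> B)"
  unfolding cst_def by (rule lam_in_funs) simp_all

text \<open>The ultrapower embedding, evaluated at one point at a time. The transitive set chosen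
  varies with \<open>x\<close>; by \<open>J_eq\<close> any other one gives the same value.\<close>

definition J :: "'v \<Rightarrow> 'v" where
  "J x = PI (SOME t. trans_set t \<and> x \<in> elts t) (cst x)"

lemma J_eq:
  assumes T: "trans_set T" "x \<in> elts T"
  shows "J x = PI T (cst x)"
proof -
  define t where "t = (SOME t. trans_set t \<and> x \<in> elts t)"
  have t: "trans_set t" "x \<in> elts t"
    unfolding t_def using someI[of "\<lambda>t. trans_set t \<and> x \<in> elts t" T] T by blast+
  define u where "u = vun t T"
  have u: "trans_set u" "elts t \<subseteq> elts u" "elts T \<subseteq> elts u"
    using t(1) T(1) by (auto simp: u_def trans_set_def)
  have "PI t (cst x) = PI T (cst x)"
    using PI_extend[OF t(1) u(1,2) cst_in[OF t(2)]] PI_extend[OF T(1) u(1,3) cst_in[OF T(2)]] by simp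
  then show ?thesis by (simp add: J_def t_def)
qed

text \<open>A function with values in x almost everywhere can be changed on a null set to one into
  x. The size of \<open>J x\<close> is thereby bounded by the number of functions from \<delta> to
  x.\<close>

lemma elts_J:
  assumes T: "trans_set T" "x \<in> elts T"
  shows "elts (J x) = PI T ` elts (funs \<delta> x)"
proof -
  have sub: "elts x \<subseteq> elts T" using T unfolding trans_set_def by blast
  have "\<exists>h\<in>elts (funs \<delta> x). PI T g = PI T h" if g: "g \<in> elts (funs \<delta> T)" "fmem g (cst x)" for g
  proof -
    have d: "dfn1 (\<lambda>\<xi>. app g \<xi> \<in> elts (app (cst x) \<xi>))" "dfn1 (\<lambda>\<xi>. \<exists>y\<in>elts x. y = app g \<xi>)"
      "dfn2 (\<lambda>y \<xi>. y = app g \<xi>)"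
      by (intro dfn)+
    have "AE (\<lambda>\<xi>. \<exists>y\<in>elts x. y = app g \<xi>)"
      by (rule AE_mono[OF g(2)[unfolded fmem_def] d(1,2)]) simp
    then obtain h where h: "h \<in> elts (funs \<delta> x)" "feq h g"
      unfolding feq_def by (rule AE_choice[OF d(3)])
    then show ?thesis using PI_cong[OF g(1) funs_mono[OF h(1) sub] feq_sym[OF h(2)]] by blast
  qed
  moreover have "fmem h (cst x)" if "h \<in> elts (funs \<delta> x)" for h
    unfolding fmem_def using app_in[OF that] by (intro AE_True) simp
  ultimately show ?thesis
    using funs_mono[OF _ sub] unfolding J_eq[OF T] elts_PI[OF cst_in[OF T(2)]] by blast
qed

lemma ex_trans_set_mem: "finite S \<Longrightarrow> \<exists>t. trans_set t \<and> S \<subseteq> elts t"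
  using ex_trans_set[of "mk S"] small_finite[of S] by auto

lemma J_mem_iff: "J x \<in> elts (J y) \<longleftrightarrow> x \<in> elts y"
proof -
  obtain T where T: "trans_set T" "x \<in> elts T" "y \<in> elts T"
    using ex_trans_set_mem[of "{x, y}"] by auto
  have "AE (\<lambda>\<xi>. app (cst x) \<xi> \<in> elts (app (cst y) \<xi>)) \<longleftrightarrow> AE (\<lambda>\<xi>. x \<in> elts y)"
    by (rule AE_cong) simp
  then show ?thesis
    using PI_mem_iff[OF T(1) cst_in[OF T(2)] cst_in[OF T(3)]] J_eq[OF T(1)] T(2,3)
    by (simp add: fmem_def)
qed

lemma J_eq_iff: "J x = J y \<longleftrightarrow> x = y"
proof -
  obtain T where T: "trans_set T" "x \<in> elts T" "y \<in> elts T"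
    using ex_trans_set_mem[of "{x, y}"] by auto
  have "AE (\<lambda>\<xi>. app (cst x) \<xi> = app (cst y) \<xi>) \<longleftrightarrow> AE (\<lambda>\<xi>. x = y)"
    by (rule AE_cong) simp
  then show ?thesis
    using PI_eq_iff[OF T(1) cst_in[OF T(2)] cst_in[OF T(3)]] J_eq[OF T(1)] T(2,3)
    by (simp add: feq_def)
qed

lemma J_mono: "elts x \<subseteq> elts y \<Longrightarrow> elts (J x) \<subseteq> elts (J y)"
proof -
  assume sub: "elts x \<subseteq> elts y"
  obtain T where T: "trans_set T" "x \<in> elts T" "y \<in> elts T"
    using ex_trans_set_mem[of "{x, y}"] by auto
  show ?thesis
    unfolding elts_J[OF T(1,2)] elts_J[OF T(1,3)] using funs_mono[OF _ sub] by blast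
qed

text \<open>A witness x is carried to \<open>J x\<close>, and the matrix is handled by
  \<open>los_Delta0\<close>. Finite range of the assignment lets one transitive set contain all its
  values.\<close>

theorem Sigma1_upward:
  "Sigma1 \<phi> \<Longrightarrow> finite (range s) \<Longrightarrow> sat mem \<phi> s \<Longrightarrow> sat mem \<phi> (\<lambda>i. J (s i))"
proof (induction \<phi> arbitrary: s rule: Sigma1.induct)
  case (1 \<phi>)
  obtain T where T: "trans_set T" "range s \<subseteq> elts T"
    using ex_trans_set_mem[OF 1(2)] by blast
  then have sT: "s i \<in> elts T" for i by blast
  have "AE (\<lambda>x. sat mem \<phi> (\<lambda>i. app (cst (s i)) x))"
    by (rule AE_True) (simp add: 1)
  then have "sat mem \<phi> (\<lambda>i. PI T (cst (s i)))"
    using los_Delta0[OF T(1) 1(1), of "\<lambda>i. cst (s i)"] cst_in[OF sT] by blast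
  then show ?case using J_eq[OF T(1) sT] by simp
next
  case (2 \<phi> i)
  then obtain x where x: "sat mem \<phi> (s(i := x))" by auto
  have "range (s(i := x)) \<subseteq> insert x (range s)" by auto
  then have "finite (range (s(i := x)))"
    using 2(3) finite_subset by blast
  from 2(2)[OF this x] have "sat mem \<phi> (\<lambda>k. J ((s(i := x)) k))" .
  moreover have "(\<lambda>k. J ((s(i := x)) k)) = (\<lambda>k. J (s k))(i := J x)" by auto
  ultimately show ?case by auto
qed

lemma PI_trans_set:
  assumes T: "trans_set T" and f: "f \<in> elts (funs \<delta> T)" and AE: "AE (\<lambda>x. trans_set (app f x))"
  shows "trans_set (PI T f)"
  unfolding trans_set_def
proof (intro ballI subsetI)
  fix y z assume "y \<in> elts (PI T f)" "z \<in> elts y"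
  then obtain g where g: "g \<in> elts (funs \<delta> T)" "fmem g f" "z \<in> elts (PI T g)"
    using PI_memE[OF f] by metis
  then obtain h where h: "h \<in> elts (funs \<delta> T)" "fmem h g" "z = PI T h"
    using PI_memE by metis
  have d: "dfn1 (\<lambda>x. trans_set (app f x))" "dfn1 (\<lambda>x. app g x \<in> elts (app f x))"
    "dfn1 (\<lambda>x. app h x \<in> elts (app g x))" "dfn1 (\<lambda>x. app h x \<in> elts (app f x))"
    by (intro dfn)+
  have "fmem h f" unfolding fmem_def
    by (rule AE_mono2[OF AE_conj[OF AE g(2)[unfolded fmem_def] d(1,2)] h(2)[unfolded fmem_def]
          dfn_conj[OF d(1,2)] d(3,4)])
      (use trans_setD in blast)
  then show "z \<in> elts (PI T f)" using PI_memI[OF f h(1)] h(3) by simp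
qed

lemma PI_ordinal:
  assumes T: "trans_set T" and f: "f \<in> elts (funs \<delta> T)" and AE: "AE (\<lambda>x. ordinal (app f x))"
  shows "ordinal (PI T f)"
  unfolding ordinal_iff
proof (intro conjI ballI)
  have d: "dfn1 (\<lambda>x. ordinal (app f x))" "dfn1 (\<lambda>x. trans_set (app f x))" by (intro dfn)+
  show "trans_set (PI T f)"
    by (rule PI_trans_set[OF T f], rule AE_mono[OF AE d]) (simp add: ordinal_iff)
  fix y assume "y \<in> elts (PI T f)"
  then obtain g where g: "g \<in> elts (funs \<delta> T)" "fmem g f" "y = PI T g"
    by (rule PI_memE[OF f])
  have d': "dfn1 (\<lambda>x. app g x \<in> elts (app f x))" "dfn1 (\<lambda>x. trans_set (app g x))" by (intro dfn)+
  have "AE (\<lambda>x. trans_set (app g x))"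
    by (rule AE_mono2[OF AE g(2)[unfolded fmem_def] d(1) d']) (simp add: ordinal_iff)
  then show "trans_set y" using PI_trans_set[OF T g(1)] g(3) by simp
qed

lemma J_ordinal: "ordinal \<alpha> \<Longrightarrow> ordinal (J \<alpha>)"
proof -
  assume "ordinal \<alpha>"
  obtain T where T: "trans_set T" "\<alpha> \<in> elts T"
    using ex_trans_set_mem[of "{\<alpha>}"] by auto
  then show ?thesis
    using PI_ordinal[OF T(1) cst_in[OF T(2)]] J_eq[OF T] \<open>ordinal \<alpha>\<close> AE_True[of "\<lambda>x. ordinal (app (cst \<alpha>) x)"]
    by simp
qed

text \<open>To take a least failure of \<open>F x\<close> being a subset of \<open>J (F x)\<close>,
  the failures must form a set of the model. With a fixed \<open>T\<close> the embedding becomes the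
  definable \<open>PI T (cst x)\<close>.\<close>

lemma ex_set_not_subset_J:
  assumes "trans_set T" "\<And>x. x \<in> elts A \<Longrightarrow> F x \<in> elts T" "trm1 F"
  shows "\<exists>S. elts S = {x \<in> elts A. \<not> elts (F x) \<subseteq> elts (J (F x))}"
proof -
  note [dfn, simp] = trm1_subst[OF assms(3)]
  have "elts (sep A (\<lambda>x. \<not> elts (F x) \<subseteq> elts (PI T (cst (F x))))) =
      {x \<in> elts A. \<not> elts (F x) \<subseteq> elts (PI T (cst (F x)))}"
    by (rule elts_sep) (intro dfn)
  also have "\<dots> = {x \<in> elts A. \<not> elts (F x) \<subseteq> elts (J (F x))}"
    using J_eq[OF assms(1) assms(2)] by auto
  finally show ?thesis by blast
qed

text \<open>At a least failure \<beta>, some \<gamma> < \<beta> is not in J \<beta>. But \<gamma>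
  \<le> J \<gamma> by minimality, and J \<gamma> is an element of the ordinal J \<beta>.\<close>

lemma ordinal_subset_J:
  assumes \<alpha>: "ordinal \<alpha>"
  shows "elts \<alpha> \<subseteq> elts (J \<alpha>)"
proof (rule ccontr)
  assume n: "\<not> elts \<alpha> \<subseteq> elts (J \<alpha>)"
  have oS: "ordinal (suc \<alpha>)" using ordinal_suc[OF \<alpha>] .
  then have "trans_set (suc \<alpha>)" by (simp add: ordinal_iff)
  then obtain S where S: "elts S = {x \<in> elts (suc \<alpha>). \<not> elts x \<subseteq> elts (J x)}"
    using ex_set_not_subset_J[of "suc \<alpha>" "suc \<alpha>" "\<lambda>x. x"] by (auto intro: dfn)
  then have "elts S \<noteq> {}" using n by auto
  then obtain \<beta> where \<beta>: "\<beta> \<in> elts S" "elts \<beta> \<inter> elts S = {}" using foundation by blast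
  then have \<beta>': "\<beta> \<in> elts (suc \<alpha>)" "\<not> elts \<beta> \<subseteq> elts (J \<beta>)" unfolding S by blast+
  then obtain \<gamma> where \<gamma>: "\<gamma> \<in> elts \<beta>" "\<gamma> \<notin> elts (J \<beta>)" by blast
  have o: "ordinal \<beta>" "ordinal \<gamma>" using ordinal_mem[OF oS \<beta>'(1)] ordinal_mem \<gamma>(1) by blast+
  have "\<gamma> \<in> elts (suc \<alpha>)" using ordinal_mem_trans[OF oS \<beta>'(1) \<gamma>(1)] .
  then have "elts \<gamma> \<subseteq> elts (J \<gamma>)" using \<gamma>(1) \<beta>(2) unfolding S by blast
  moreover have "J \<gamma> \<in> elts (J \<beta>)" using J_mem_iff \<gamma>(1) by blast
  ultimately have "\<gamma> \<in> elts (J \<beta>)"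
    using ordinal_subset_mem_trans[OF o(2) J_ordinal[OF o(1)] _ J_ordinal[OF o(2)]] by blast
  with \<gamma>(2) show False ..
qed

section \<open>Cardinals fixed by the ultrapower embedding\<close>

text \<open>If no map from \<delta> is cofinal in \<sigma>, then f itself is bounded. Otherwise, the
  cofinality not being \<delta>, some \<beta> < \<delta> carries a cofinal map, and by completeness
  one of its values bounds f almost everywhere.\<close>

lemma AE_bounded:
  assumes \<sigma>: "cardinal \<sigma>" "elts \<delta> \<subseteq> elts \<sigma>" and cof: "\<not> cofinality \<sigma> \<delta>" and f: "f \<in> elts (funs \<delta> \<sigma>)"
  shows "\<exists>\<alpha>\<in>elts \<sigma>. AE (\<lambda>\<xi>. app f \<xi> \<in> elts \<alpha>)"
proof (cases "\<exists>g. cofinal_map g \<delta> \<sigma>")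
  case False
  have "f = lam \<delta> (app f)" using f by (simp add: elts_funs)
  moreover have "function_between (lam \<delta> (app f)) \<delta> \<sigma>"
    by (rule function_between_lam) (use app_in[OF f] in \<open>auto intro: dfn\<close>)
  ultimately have fb: "function_between f \<delta> \<sigma>" by simp
  moreover have "\<not> cofinal_map f \<delta> \<sigma>" using False by blast
  ultimately obtain \<alpha> where \<alpha>: "\<alpha> \<in> elts \<sigma>"
    "\<And>\<xi> b. \<xi> \<in> elts \<delta> \<Longrightarrow> rel f \<xi> b \<Longrightarrow> \<not> ord_le \<alpha> b"
    unfolding cofinal_map_def by blast
  have "app f \<xi> \<in> elts \<alpha>" if \<xi>: "\<xi> \<in> elts \<delta>" for \<xi>
  proof -
    have "\<not> ord_le \<alpha> (app f \<xi>)" using \<alpha>(2)[OF \<xi>] function_between_app(1)[OF fb \<xi>] by blast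
    then show ?thesis
      using ordinal_linear[of \<alpha> "app f \<xi>"] ordinal_mem[OF cardinal_ordinal[OF \<sigma>(1)]] \<alpha>(1) app_in[OF f \<xi>]
      by (auto simp: ord_le_def mem_elts)
  qed
  then have "AE (\<lambda>\<xi>. app f \<xi> \<in> elts \<alpha>)" by (rule AE_True)
  with \<alpha>(1) show ?thesis by blast
next
  case True
  with cof obtain \<beta> h where \<beta>: "\<beta> \<in> elts \<delta>" and h: "cofinal_map h \<beta> \<sigma>"
    unfolding cofinality_def using ordinal_\<delta> by blast
  then have hb: "function_between h \<beta> \<sigma>"
    "\<And>\<alpha>. \<alpha> \<in> elts \<sigma> \<Longrightarrow> \<exists>\<xi>\<in>elts \<beta>. \<exists>b. rel h \<xi> b \<and> ord_le \<alpha> b"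
    unfolding cofinal_map_def by blast+
  have "AE (\<lambda>\<xi>. \<exists>i\<in>elts \<beta>. app f \<xi> \<in> elts (suc (app h i)))"
  proof (rule AE_True)
    fix \<xi> assume "\<xi> \<in> elts \<delta>"
    from hb(2)[OF app_in[OF f this]] obtain i b where i: "i \<in> elts \<beta>" "rel h i b" "ord_le (app f \<xi>) b" by blast
    then have "app f \<xi> \<in> elts (suc (app h i))"
      using function_between_app[OF hb(1)] by (auto simp: ord_le_def mem_elts)
    with i(1) show "\<exists>i\<in>elts \<beta>. app f \<xi> \<in> elts (suc (app h i))" by blast
  qed
  then obtain i where i: "i \<in> elts \<beta>" "AE (\<lambda>\<xi>. app f \<xi> \<in> elts (suc (app h i)))"
    using AE_partition[OF \<beta>, of "\<lambda>i \<xi>. app f \<xi> \<in> elts (suc (app h i))"] by (auto intro: dfn)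
  have "suc (app h i) \<in> elts \<sigma>"
    using cardinal_suc[OF \<sigma>] function_between_app(2)[OF hb(1) i(1)] by blast
  with i(2) show ?thesis by blast
qed

lemma J_bounded:
  assumes \<sigma>: "cardinal \<sigma>" "elts \<delta> \<subseteq> elts \<sigma>" "\<not> cofinality \<sigma> \<delta>" and x: "x \<in> elts (J \<sigma>)"
  shows "\<exists>\<alpha>\<in>elts \<sigma>. x \<in> elts (J \<alpha>)"
proof -
  obtain T where T: "trans_set T" "\<sigma> \<in> elts T"
    using ex_trans_set_mem[of "{\<sigma>}"] by auto
  obtain f where f: "f \<in> elts (funs \<delta> \<sigma>)" "x = PI T f"
    using x unfolding elts_J[OF T] by blast
  obtain \<alpha> where \<alpha>: "\<alpha> \<in> elts \<sigma>" "AE (\<lambda>\<xi>. app f \<xi> \<in> elts \<alpha>)"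
    using AE_bounded[OF \<sigma> f(1)] by blast
  have \<alpha>T: "\<alpha> \<in> elts T" using trans_setD[OF T \<alpha>(1)] .
  have "elts \<sigma> \<subseteq> elts T" using T unfolding trans_set_def by blast
  from funs_mono[OF f(1) this] have fT: "f \<in> elts (funs \<delta> T)" .
  have "AE (\<lambda>\<xi>. app f \<xi> \<in> elts (app (cst \<alpha>) \<xi>)) \<longleftrightarrow> AE (\<lambda>\<xi>. app f \<xi> \<in> elts \<alpha>)"
    by (rule AE_cong) simp
  then have "fmem f (cst \<alpha>)" using \<alpha>(2) by (simp add: fmem_def)
  then have "x \<in> elts (J \<alpha>)"
    using PI_memI[OF cst_in[OF \<alpha>T] fT] J_eq[OF T(1) \<alpha>T] f(2) by simp
  with \<alpha>(1) show ?thesis by blast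
qed

lemma ex_cardinal_above:
  assumes \<sigma>: "cardinal \<sigma>" "\<delta> \<in> elts \<sigma>" and \<alpha>: "\<alpha> \<in> elts \<sigma>"
  obtains \<theta> where "cardinal \<theta>" "elts \<delta> \<subseteq> elts \<theta>" "\<theta> \<in> elts \<sigma>" "lep \<alpha> \<theta>"
proof -
  note o\<sigma> = cardinal_ordinal[OF \<sigma>(1)]
  define \<beta> where "\<beta> = vun \<alpha> \<delta>"
  have \<beta>\<sigma>: "\<beta> \<in> elts \<sigma>"
    using ordinal_vun[OF ordinal_mem[OF o\<sigma> \<alpha>] ordinal_\<delta>] \<alpha> \<sigma>(2) unfolding \<beta>_def by metis
  obtain \<theta> where \<theta>: "cardinal \<theta>" "elts \<theta> \<subseteq> elts \<beta>" "lep \<beta> \<theta>"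
    using ex_cardinality[OF ordinal_mem[OF o\<sigma> \<beta>\<sigma>]] by blast
  have "lep \<delta> \<beta>" "lep \<alpha> \<beta>" by (rule lep_subset, simp add: \<beta>_def)+
  then have le: "lep \<delta> \<theta>" "lep \<alpha> \<theta>" using \<theta>(3) lep_trans by blast+
  have "elts \<delta> \<subseteq> elts \<theta>"
    using cardinal_lep_iff[OF cardinal_\<delta> cardinal_ordinal[OF \<theta>(1)] le(1)] .
  moreover have "\<theta> \<in> elts \<sigma>"
    using ordinal_subset_mem_trans[OF cardinal_ordinal[OF \<theta>(1)] o\<sigma> \<theta>(2) ordinal_mem[OF o\<sigma> \<beta>\<sigma>] \<beta>\<sigma>] .
  ultimately show thesis using that \<theta>(1) le(2) by blast
qed

text \<open>|J \<alpha>| \<le> |\<alpha>|^\<delta> \<le> \<theta>^\<delta> \<le>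
  (2^\<theta>)^\<delta> \<le> 2^\<theta>.\<close>

lemma lep_J_pow:
  assumes \<theta>: "cardinal \<theta>" "elts \<delta> \<subseteq> elts \<theta>" and "lep \<alpha> \<theta>"
  shows "lep (J \<alpha>) (pow \<theta>)"
proof -
  obtain T where T: "trans_set T" "\<alpha> \<in> elts T"
    using ex_trans_set_mem[of "{\<alpha>}"] by auto
  have "lep (J \<alpha>) (funs \<delta> \<alpha>)"
    by (rule lep_surj[OF trm1_PI[of T]]) (simp add: elts_J[OF T])
  also have "lep (funs \<delta> \<alpha>) (funs \<delta> \<theta>)" by (rule lep_funs[OF assms(3)])
  also have "lep (funs \<delta> \<theta>) (funs \<delta> (pow \<theta>))"
  proof (rule lep_subset, rule subsetI, rule funs_mono, assumption)
    show "elts \<theta> \<subseteq> elts (pow \<theta>)"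
      using ordinal_mem_subset[OF cardinal_ordinal[OF \<theta>(1)]] by auto
  qed
  also have "lep (funs \<delta> (pow \<theta>)) (pow \<theta>)" by (rule lep_funs_pow[OF \<theta>])
  finally show ?thesis .
qed

text \<open>Representing functions are composed with an injection of \<alpha> into \<theta>. In
  \<open>J_fixed\<close> the ordinal \<alpha> may be larger than \<theta> while having at most its
  cardinality, where \<open>J_mono\<close> gives nothing.\<close>

lemma lep_J:
  assumes "lep \<alpha> \<theta>"
  shows "lep (J \<alpha>) (J \<theta>)"
proof -
  obtain T where T: "trans_set T" "\<alpha> \<in> elts T" "\<theta> \<in> elts T"
    using ex_trans_set_mem[of "{\<alpha>, \<theta>}"] by auto
  have sub: "elts \<alpha> \<subseteq> elts T" "elts \<theta> \<subseteq> elts T" using T unfolding trans_set_def by blast+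
  obtain h where h: "\<And>x. x \<in> elts \<alpha> \<Longrightarrow> app h x \<in> elts \<theta>"
    "\<And>x y. x \<in> elts \<alpha> \<Longrightarrow> y \<in> elts \<alpha> \<Longrightarrow> app h x = app h y \<Longrightarrow> x = y"
    by (rule lepE[OF assms]) blast
  have "dfn2 (\<lambda>x f. x = PI T f)" by (intro dfn)
  moreover have "\<exists>f\<in>elts (funs \<delta> \<alpha>). x = PI T f" if "x \<in> elts (J \<alpha>)" for x
    using that unfolding elts_J[OF T(1,2)] by blast
  ultimately obtain c where c: "c \<in> elts (funs (J \<alpha>) (funs \<delta> \<alpha>))"
    "\<And>x. x \<in> elts (J \<alpha>) \<Longrightarrow> x = PI T (app c x)"
    by (rule choice_fun) blast+
  define comp where "comp f = lam \<delta> (\<lambda>\<xi>. app h (app f \<xi>))" for f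
  have "trm1 comp" unfolding comp_def by (intro dfn)
  note [dfn, simp] = trm1_subst[OF this]
  have comp: "comp f \<in> elts (funs \<delta> \<theta>)" if f: "f \<in> elts (funs \<delta> \<alpha>)" for f
    unfolding comp_def by (rule lam_in_funs) (use h(1) app_in[OF f] in \<open>auto intro: dfn\<close>)
  show ?thesis
  proof (rule lepI[of "\<lambda>x. PI T (comp (app c x))"])
    show "trm1 (\<lambda>x. PI T (comp (app c x)))" by (intro dfn)
    show "PI T (comp (app c x)) \<in> elts (J \<theta>)" if "x \<in> elts (J \<alpha>)" for x
      unfolding elts_J[OF T(1,3)] using comp[OF app_in[OF c(1) that]] by blast
    show "x = y" if x: "x \<in> elts (J \<alpha>)" and y: "y \<in> elts (J \<alpha>)"
      and eq: "PI T (comp (app c x)) = PI T (comp (app c y))" for x y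
    proof -
      note cx = app_in[OF c(1) x] and cy = app_in[OF c(1) y]
      have AE: "AE (\<lambda>\<xi>. app (comp (app c x)) \<xi> = app (comp (app c y)) \<xi>)"
        using PI_eq_iff[OF T(1) funs_mono[OF comp[OF cx] sub(2)] funs_mono[OF comp[OF cy] sub(2)]] eq
        by (simp add: feq_def)
      have d: "dfn1 (\<lambda>\<xi>. app (comp (app c x)) \<xi> = app (comp (app c y)) \<xi>)"
        "dfn1 (\<lambda>\<xi>. app (app c x) \<xi> = app (app c y) \<xi>)" by (intro dfn)+
      have "feq (app c x) (app c y)" unfolding feq_def
      proof (rule AE_mono[OF AE d])
        fix \<xi> assume \<xi>: "\<xi> \<in> elts \<delta>" and "app (comp (app c x)) \<xi> = app (comp (app c y)) \<xi>"
        then have "app h (app (app c x) \<xi>) = app h (app (app c y) \<xi>)"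
          by (simp add: comp_def)
        then show "app (app c x) \<xi> = app (app c y) \<xi>"
          by (rule h(2)[OF app_in[OF cx \<xi>] app_in[OF cy \<xi>]])
      qed
      then have "PI T (app c x) = PI T (app c y)"
        by (rule PI_cong[OF funs_mono[OF cx sub(1)] funs_mono[OF cy sub(1)]])
      then show "x = y" using c(2)[OF x] c(2)[OF y] by simp
    qed
  qed
qed

text \<open>Statement (i) for \<kappa>. Its failure is used at two instances of \<nu>: at \<kappa>
  itself, and at \<theta> when \<kappa> = \<theta>^+.\<close>

definition near_cofinality_\<delta> :: "'v \<Rightarrow> bool" where
  "near_cofinality_\<delta> \<kappa> \<longleftrightarrow> (\<exists>\<nu>. cardinal \<nu> \<and> cofinality \<nu> \<delta> \<and> ord_le \<nu> \<kappa> \<and>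
     (\<exists>\<mu>. successor_cardinal \<mu> \<nu> \<and> ord_le \<kappa> \<mu>))"

text \<open>If J \<kappa> exceeds \<kappa>, continuity at \<kappa> puts \<kappa> into J \<alpha> for
  some \<alpha> < \<kappa>, and the GCH forces \<kappa> = \<theta>^+ with |\<alpha>| \<le> \<theta>.
  Continuity at \<theta> then gives |J \<theta>| \<le> \<theta>, while \<kappa> \<le> |J \<alpha>|
  \<le> |J \<theta>|.\<close>

theorem J_fixed:
  assumes GCH: "\<And>\<theta>. cardinal \<theta> \<Longrightarrow> elts \<delta> \<subseteq> elts \<theta> \<Longrightarrow> GCH_at \<theta>"
    and \<kappa>: "cardinal \<kappa>" "\<delta> \<in> elts \<kappa>" and not_near: "\<not> near_cofinality_\<delta> \<kappa>"
  shows "J \<kappa> = \<kappa>"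
proof (rule ccontr)
  assume ne: "J \<kappa> \<noteq> \<kappa>"
  note o\<kappa> = cardinal_ordinal[OF \<kappa>(1)]
  have \<delta>\<kappa>: "elts \<delta> \<subseteq> elts \<kappa>" using ordinal_mem_subset[OF o\<kappa> \<kappa>(2)] .
  have not_cof: "\<not> cofinality \<nu> \<delta>"
    if "cardinal \<nu>" "ord_le \<nu> \<kappa>" "successor_cardinal \<mu> \<nu>" "ord_le \<kappa> \<mu>" for \<nu> \<mu>
    using that not_near unfolding near_cofinality_\<delta>_def by blast
  have "\<not> cofinality \<kappa> \<delta>"
  proof -
    obtain \<mu> where \<mu>: "successor_cardinal \<mu> \<kappa>"
      using GCH_atE[OF GCH[OF \<kappa>(1) \<delta>\<kappa>]] by blast
    show ?thesis
      by (rule not_cof[OF \<kappa>(1) _ \<mu>]) (use \<mu> in \<open>simp_all add: ord_le_def successor_cardinal_def\<close>)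
  qed
  moreover have "\<kappa> \<in> elts (J \<kappa>)"
    using ordinal_subset_iff[OF o\<kappa> J_ordinal[OF o\<kappa>]] ordinal_subset_J[OF o\<kappa>] ne by metis
  ultimately obtain \<alpha> where \<alpha>: "\<alpha> \<in> elts \<kappa>" "\<kappa> \<in> elts (J \<alpha>)"
    using J_bounded[OF \<kappa>(1) \<delta>\<kappa>] by blast
  have o\<alpha>: "ordinal \<alpha>" using ordinal_mem[OF o\<kappa> \<alpha>(1)] .
  have le1: "lep \<kappa> (J \<alpha>)"
    by (rule lep_subset[OF ordinal_mem_subset[OF J_ordinal[OF o\<alpha>] \<alpha>(2)]])
  obtain \<theta> where \<theta>: "cardinal \<theta>" "elts \<delta> \<subseteq> elts \<theta>" "\<theta> \<in> elts \<kappa>" "lep \<alpha> \<theta>"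
    by (rule ex_cardinal_above[OF \<kappa> \<alpha>(1)])
  obtain \<mu> where \<mu>: "successor_cardinal \<mu> \<theta>" "lep (pow \<theta>) \<mu>"
    using GCH_atE[OF GCH[OF \<theta>(1,2)]] by blast
  have o\<mu>: "ordinal \<mu>" using \<mu>(1) cardinal_ordinal by (simp add: successor_cardinal_def)
  have "lep \<kappa> \<mu>"
    using lep_trans[OF lep_trans[OF le1 lep_J_pow[OF \<theta>(1,2,4)]] \<mu>(2)] .
  then have "\<mu> \<notin> elts \<kappa>" using cardinal_not_lep[OF \<kappa>(1)] by blast
  then have "\<mu> = \<kappa>"
    using successor_cardinal_le[OF \<mu>(1) \<kappa>(1) \<theta>(3)] ordinal_subset_iff[OF o\<mu> o\<kappa>] by blast
  then have succ: "successor_cardinal \<kappa> \<theta>" using \<mu>(1) by simp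
  have cof_\<theta>: "\<not> cofinality \<theta> \<delta>"
    by (rule not_cof[OF \<theta>(1) _ succ]) (use \<theta>(3) in \<open>simp_all add: ord_le_def mem_elts\<close>)
  then have "\<theta> \<noteq> \<delta>" using cofinality_\<delta> by blast
  then have \<delta>\<theta>: "\<delta> \<in> elts \<theta>"
    using \<theta>(2) ordinal_subset_iff[OF ordinal_\<delta> cardinal_ordinal[OF \<theta>(1)]] by blast
  obtain T where T: "trans_set T" "\<theta> \<in> elts T"
    using ex_trans_set_mem[of "{\<theta>}"] by auto
  \<comment> \<open>\<open>lep_UN\<close> wants a definable family, so \<open>J i\<close> is written
    with a single \<open>T\<close> for all i below \<theta>.\<close>
  have J_T: "PI T (cst i) = J i" if "i \<in> elts \<theta>" for i
    using J_eq[OF T(1) trans_setD[OF T that]] by simp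
  have "lep (J \<theta>) \<theta>"
  proof (rule lep_UN[OF \<theta>(1,2)])
    show "trm1 (\<lambda>i. PI T (cst i))" by (intro dfn)
    show "lep \<theta> \<theta>" by (rule lep_subset) simp
    \<comment> \<open>As \<sigma> < \<theta>, the GCH at \<sigma> gives |J i| \<le> 2^\<sigma> =
      \<sigma>^+ \<le> \<theta>.\<close>
    show "lep (PI T (cst i)) \<theta>" if i: "i \<in> elts \<theta>" for i
    proof -
      obtain \<sigma> where \<sigma>: "cardinal \<sigma>" "elts \<delta> \<subseteq> elts \<sigma>" "\<sigma> \<in> elts \<theta>" "lep i \<sigma>"
        by (rule ex_cardinal_above[OF \<theta>(1) \<delta>\<theta> i])
      obtain \<rho> where \<rho>: "successor_cardinal \<rho> \<sigma>" "lep (pow \<sigma>) \<rho>"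
        using GCH_atE[OF GCH[OF \<sigma>(1,2)]] by blast
      have "lep \<rho> \<theta>" by (rule lep_subset[OF successor_cardinal_le[OF \<rho>(1) \<theta>(1) \<sigma>(3)]])
      then show ?thesis
        unfolding J_T[OF i] using lep_J_pow[OF \<sigma>(1,2,4)] \<rho>(2) lep_trans by blast
    qed
    show "\<exists>i\<in>elts \<theta>. x \<in> elts (PI T (cst i))" if "x \<in> elts (J \<theta>)" for x
      using J_bounded[OF \<theta>(1,2) cof_\<theta> that] J_T by auto
  qed
  then have "lep \<kappa> \<theta>"
    using lep_trans[OF lep_trans[OF le1 lep_J[OF \<theta>(4)]]] by blast
  with cardinal_not_lep[OF \<kappa>(1) \<theta>(3)] show False ..
qed

section \<open>Subsets of the fixed cardinal outside the ultrapower\<close>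

text \<open>Given \<^term>\<open>\<delta>\<close> many functions, diagonalisation yields one that eventually differs from each
  of them.\<close>

lemma not_lep_J_\<delta>: "\<not> lep (J \<delta>) \<delta>"
proof
  assume "lep (J \<delta>) \<delta>"
  then obtain h where h: "\<And>x. x \<in> elts (J \<delta>) \<Longrightarrow> app h x \<in> elts \<delta>"
    "\<And>x y. x \<in> elts (J \<delta>) \<Longrightarrow> y \<in> elts (J \<delta>) \<Longrightarrow> app h x = app h y \<Longrightarrow> x = y"
    by (rule lepE) blast
  obtain T where T: "trans_set T" "\<delta> \<in> elts T"
    using ex_trans_set_mem[of "{\<delta>}"] by auto
  have sub: "elts \<delta> \<subseteq> elts T" using T unfolding trans_set_def by blast
  have PI_J: "PI T f \<in> elts (J \<delta>)" if "f \<in> elts (funs \<delta> \<delta>)" for f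
    using that unfolding elts_J[OF T] by blast
  define R where "R i g \<longleftrightarrow> (\<forall>f\<in>elts (funs \<delta> \<delta>). app h (PI T f) = i \<longrightarrow> PI T f = PI T g)" for i g
  have "dfn2 R" unfolding R_def by (intro dfn)
  have "\<exists>g\<in>elts (funs \<delta> \<delta>). R i g" for i
  proof (cases "\<exists>g\<in>elts (funs \<delta> \<delta>). app h (PI T g) = i")
    case True
    then obtain g where g: "g \<in> elts (funs \<delta> \<delta>)" "app h (PI T g) = i" by blast
    then have "R i g" unfolding R_def using h(2)[OF PI_J PI_J[OF g(1)]] by simp
    with g(1) show ?thesis by blast
  next
    case False
    have "lam \<delta> (\<lambda>x. x) \<in> elts (funs \<delta> \<delta>)" by (rule lam_in_funs) (auto intro: dfn)
    with False show ?thesis unfolding R_def by blast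
  qed
  then obtain G where G: "\<And>i. i \<in> elts \<delta> \<Longrightarrow> app G i \<in> elts (funs \<delta> \<delta>)" "\<And>i. i \<in> elts \<delta> \<Longrightarrow> R i (app G i)"
    using choice_fun[OF \<open>dfn2 R\<close>, of \<delta> "funs \<delta> \<delta>"] app_in by metis
  define Q where "Q \<xi> y \<longleftrightarrow> (\<forall>i\<in>elts \<xi>. app (app G i) \<xi> \<noteq> y)" for \<xi> y
  have "dfn2 Q" unfolding Q_def by (intro dfn)
  have "\<exists>y\<in>elts \<delta>. Q \<xi> y" if \<xi>: "\<xi> \<in> elts \<delta>" for \<xi>
  proof (rule ccontr)
    assume "\<not> (\<exists>y\<in>elts \<delta>. Q \<xi> y)"
    then have *: "\<exists>i\<in>elts \<xi>. y = app (app G i) \<xi>" if "y \<in> elts \<delta>" for y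
      using that unfolding Q_def by metis
    have "elts \<delta> \<subseteq> (\<lambda>i. app (app G i) \<xi>) ` elts \<xi>"
      using * unfolding image_def by blast
    moreover have "trm1 (\<lambda>i. app (app G i) \<xi>)" by (intro dfn)
    ultimately have "lep \<delta> \<xi>" by (intro lep_surj)
    with cardinal_not_lep[OF cardinal_\<delta> \<xi>] show False ..
  qed
  then obtain f where f: "f \<in> elts (funs \<delta> \<delta>)" "\<And>\<xi>. \<xi> \<in> elts \<delta> \<Longrightarrow> Q \<xi> (app f \<xi>)"
    using choice_fun[OF \<open>dfn2 Q\<close>, of \<delta> \<delta>] by metis
  define i where "i = app h (PI T f)"
  have i: "i \<in> elts \<delta>" using h(1)[OF PI_J[OF f(1)]] by (simp add: i_def)
  have "PI T f = PI T (app G i)"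
    using G(2)[OF i] f(1) unfolding R_def i_def by blast
  then have AE: "AE (\<lambda>\<xi>. app f \<xi> = app (app G i) \<xi>)"
    using PI_eq_iff[OF T(1) funs_mono[OF f(1) sub] funs_mono[OF G(1)[OF i] sub]] by (simp add: feq_def)
  have d: "dfn1 (\<lambda>\<xi>. app f \<xi> = app (app G i) \<xi>)" "dfn1 (\<lambda>\<xi>. i \<in> elts \<xi>)" by (intro dfn)+
  obtain \<xi> where "\<xi> \<in> elts \<delta>" "app f \<xi> = app (app G i) \<xi>" "i \<in> elts \<xi>"
    using AE_ex[OF AE_conj[OF AE AE_above[OF i] d] dfn_conj[OF d]] by blast
  with f(2) show False unfolding Q_def by metis
qed

text \<open>J \<delta> reaches up to \<mu> = \<delta>^+ by \<open>not_lep_J_\<delta>\<close>, so a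
  subset of \<mu> in the ultrapower is represented by a function into P(\<delta>). By the GCH at
  \<delta> these functions can be coded below \<mu>, and y diagonalises against them.\<close>

lemma ex_subset_not_PI:
  assumes GCH: "GCH_at \<delta>" and \<kappa>: "cardinal \<kappa>" "\<delta> \<in> elts \<kappa>"
    and T: "trans_set T" "elts (pow \<kappa>) \<subseteq> elts T"
  shows "\<exists>y\<in>elts (pow \<kappa>). y \<notin> PI T ` elts (funs \<delta> (pow \<kappa>))"
proof -
  obtain \<mu> where \<mu>: "successor_cardinal \<mu> \<delta>" "lep (pow \<delta>) \<mu>"
    using GCH_atE[OF GCH] by blast
  have \<mu>\<kappa>: "elts \<mu> \<subseteq> elts \<kappa>" using successor_cardinal_le[OF \<mu>(1) \<kappa>] .
  have \<delta>\<kappa>: "elts \<delta> \<subseteq> elts \<kappa>" using ordinal_mem_subset[OF cardinal_ordinal[OF \<kappa>(1)] \<kappa>(2)] .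
  have \<delta>T: "\<delta> \<in> elts T" using T(2) \<delta>\<kappa> by auto
  have o\<mu>: "ordinal \<mu>" using \<mu>(1) cardinal_ordinal by (simp add: successor_cardinal_def)
  have "J \<delta> \<notin> elts \<mu>"
    using successor_cardinal_lep[OF \<mu>(1) cardinal_\<delta>] not_lep_J_\<delta> by blast
  then have \<mu>J: "elts \<mu> \<subseteq> elts (J \<delta>)"
    using ordinal_not_mem_iff[OF o\<mu> J_ordinal[OF ordinal_\<delta>]] by blast
  define N where "N = funs \<delta> (pow \<delta>)"
  have "lep N \<mu>"
    unfolding N_def using lep_trans[OF lep_funs_pow[OF cardinal_\<delta> subset_refl] \<mu>(2)] .
  then obtain K where K: "\<And>f. f \<in> elts N \<Longrightarrow> app K f \<in> elts \<mu>"
    "\<And>f g. f \<in> elts N \<Longrightarrow> g \<in> elts N \<Longrightarrow> app K f = app K g \<Longrightarrow> f = g"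
    by (rule lepE) blast
  \<comment> \<open>The code \<alpha> of f is put into y exactly when it is not in the set that f
    represents; points that code nothing are put in as well.\<close>
  define y where "y = sep \<mu> (\<lambda>\<alpha>. \<forall>f\<in>elts N. app K f = \<alpha> \<longrightarrow> \<alpha> \<notin> elts (PI T f))"
  have y: "elts y = {\<alpha> \<in> elts \<mu>. \<forall>f\<in>elts N. app K f = \<alpha> \<longrightarrow> \<alpha> \<notin> elts (PI T f)}"
    unfolding y_def by (rule elts_sep) (intro dfn)
  have yP: "y \<in> elts (pow \<kappa>)" using y \<mu>\<kappa> by auto
  have "y \<noteq> PI T f" if f: "f \<in> elts (funs \<delta> (pow \<kappa>))" for f
  proof
    assume eq: "y = PI T f"
    have fT: "f \<in> elts (funs \<delta> T)" using funs_mono[OF f T(2)] .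
    have cT: "cst \<delta> \<in> elts (funs \<delta> T)" using cst_in[OF \<delta>T] .
    define P where "P \<xi> \<longleftrightarrow> (\<exists>z. z \<in> elts (app f \<xi>) \<and> z \<notin> elts (app (cst \<delta>) \<xi>))" for \<xi>
    have P: "dfn1 P" unfolding P_def by (intro dfn)
    have "\<not> AE P"
    proof
      assume "AE P"
      then obtain h where h: "h \<in> elts (funs \<delta> T)" "fmem h f" "\<not> fmem h (cst \<delta>)"
        unfolding P_def by (rule fun_memE[OF T(1) fT cT])
      have "PI T h \<in> elts y" using PI_memI[OF fT h(1,2)] eq by simp
      then have "PI T h \<in> elts (PI T (cst \<delta>))" using y \<mu>J J_eq[OF T(1) \<delta>T] by auto
      with h(3) show False using PI_mem_iff[OF T(1) h(1) cT] by blast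
    qed
    then have AE: "AE (\<lambda>\<xi>. \<not> P \<xi>)" using AE_not[OF P] by blast
    have d: "dfn1 (\<lambda>\<xi>. \<exists>z\<in>elts (pow \<delta>). z = app f \<xi>)" "dfn2 (\<lambda>z \<xi>. z = app f \<xi>)" by (intro dfn)+
    \<comment> \<open>Since y is a subset of J \<delta>, almost all values of f are subsets of
      \<delta>; so f can be exchanged for some g in \<open>N\<close>, which has a code.\<close>
    have "AE (\<lambda>\<xi>. \<exists>z\<in>elts (pow \<delta>). z = app f \<xi>)"
      by (rule AE_mono[OF AE dfn_not[OF P] d(1)]) (auto simp: P_def)
    then obtain g where g: "g \<in> elts N" "feq g f"
      unfolding N_def feq_def by (rule AE_choice[OF d(2)])
    have "elts (pow \<delta>) \<subseteq> elts (pow \<kappa>)" using \<delta>\<kappa> by auto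
    then have "g \<in> elts (funs \<delta> T)" using funs_mono g(1) T(2) unfolding N_def by blast
    then have eq': "PI T g = y" using PI_cong[OF _ fT g(2)] eq by simp
    have "app K g \<in> elts y \<longleftrightarrow> app K g \<notin> elts y"
    proof
      assume "app K g \<in> elts y"
      then have "app K g \<notin> elts (PI T g)" using g(1) unfolding y by blast
      then show "app K g \<notin> elts y" using eq' by simp
    next
      assume n: "app K g \<notin> elts y"
      have "app K g \<notin> elts (PI T f')" if "f' \<in> elts N" "app K f' = app K g" for f'
        using K(2)[OF that(1) g(1) that(2)] n eq' by simp
      then show "app K g \<in> elts y" unfolding y using K(1)[OF g(1)] by blast
    qed
    then show False by blast
  qed
  with yP show ?thesis by blast
qed

text \<open>Complements can be formed pointwise: since \<kappa> is represented by
  \<open>cst \<kappa>\<close>, a function for the complement of y yields one for y.\<close>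

lemma diff_not_PI:
  assumes fixed: "J \<kappa> = \<kappa>" and T: "trans_set T" "elts (pow \<kappa>) \<subseteq> elts T"
    and y: "y \<in> elts (pow \<kappa>)" "y \<notin> PI T ` elts (funs \<delta> (pow \<kappa>))"
  shows "diff \<kappa> y \<notin> PI T ` elts (funs \<delta> (pow \<kappa>))"
proof
  assume "diff \<kappa> y \<in> PI T ` elts (funs \<delta> (pow \<kappa>))"
  then obtain f where f: "f \<in> elts (funs \<delta> (pow \<kappa>))" "PI T f = diff \<kappa> y" by force
  have \<kappa>T: "\<kappa> \<in> elts T" using T(2) by auto
  define g where "g = lam \<delta> (\<lambda>\<xi>. diff \<kappa> (app f \<xi>))"
  have g: "g \<in> elts (funs \<delta> (pow \<kappa>))"
    unfolding g_def by (rule lam_in_funs) (auto intro: dfn)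
  have app_g: "app g \<xi> = diff \<kappa> (app f \<xi>)" if "\<xi> \<in> elts \<delta>" for \<xi>
    unfolding g_def using that by simp
  have fT: "f \<in> elts (funs \<delta> T)" and gT: "g \<in> elts (funs \<delta> T)"
    using funs_mono[OF f(1) T(2)] funs_mono[OF g T(2)] .
  have cT: "cst \<kappa> \<in> elts (funs \<delta> T)" using cst_in[OF \<kappa>T] .
  have \<kappa>_PI: "PI T (cst \<kappa>) = \<kappa>" using J_eq[OF T(1) \<kappa>T] fixed by simp
  have key: "fmem h g \<longleftrightarrow> fmem h (cst \<kappa>) \<and> \<not> fmem h f" for h
  proof -
    have d: "dfn1 (\<lambda>\<xi>. app h \<xi> \<in> elts (app f \<xi>))" "dfn1 (\<lambda>\<xi>. app h \<xi> \<in> elts (app (cst \<kappa>) \<xi>))"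
      "dfn1 (\<lambda>\<xi>. app h \<xi> \<in> elts (app g \<xi>))" by (intro dfn)+
    show ?thesis
    proof
      assume "fmem h g"
      then have AE: "AE (\<lambda>\<xi>. app h \<xi> \<in> elts (app g \<xi>))" by (simp add: fmem_def)
      have "AE (\<lambda>\<xi>. app h \<xi> \<notin> elts (app f \<xi>))"
        by (rule AE_mono[OF AE d(3) dfn_not[OF d(1)]]) (simp add: app_g)
      moreover have "AE (\<lambda>\<xi>. app h \<xi> \<in> elts (app (cst \<kappa>) \<xi>))"
        by (rule AE_mono[OF AE d(3,2)]) (simp add: app_g)
      ultimately show "fmem h (cst \<kappa>) \<and> \<not> fmem h f"
        unfolding fmem_def AE_not[OF d(1)] by blast
    next
      assume "fmem h (cst \<kappa>) \<and> \<not> fmem h f"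
      then have "AE (\<lambda>\<xi>. app h \<xi> \<in> elts (app (cst \<kappa>) \<xi>))" "AE (\<lambda>\<xi>. app h \<xi> \<notin> elts (app f \<xi>))"
        unfolding fmem_def AE_not[OF d(1)] by blast+
      then show "fmem h g"
        unfolding fmem_def by (rule AE_mono2[OF _ _ d(2) dfn_not[OF d(1)] d(3)]) (simp add: app_g)
    qed
  qed
  have "PI T g = y"
  proof (rule extensionality, rule equalityI; rule subsetI)
    fix x assume "x \<in> elts (PI T g)"
    then obtain h where h: "h \<in> elts (funs \<delta> T)" "fmem h g" "x = PI T h"
      by (rule PI_memE[OF gT])
    then have "x \<in> elts \<kappa>" "x \<notin> elts (diff \<kappa> y)"
      using key PI_mem_iff[OF T(1) h(1) cT] PI_mem_iff[OF T(1) h(1) fT] \<kappa>_PI f(2) by simp_all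
    then show "x \<in> elts y" by simp
  next
    fix x assume x: "x \<in> elts y"
    then have "x \<in> elts (PI T (cst \<kappa>))" "x \<notin> elts (PI T f)" using y(1) \<kappa>_PI f(2) by auto
    then obtain h where h: "h \<in> elts (funs \<delta> T)" "fmem h (cst \<kappa>)" "x = PI T h"
      using PI_memE[OF cT] by metis
    then have "\<not> fmem h f" using \<open>x \<notin> elts (PI T f)\<close> PI_memI[OF fT] by blast
    then show "x \<in> elts (PI T g)" using key h PI_memI[OF gT h(1)] by blast
  qed
  with y(2) g show False by blast
qed

section \<open>Good wellorderings\<close>

theorem no_good_wellordering:
  assumes GCH: "GCH_at \<delta>" and \<kappa>: "cardinal \<kappa>" "\<delta> \<in> elts \<kappa>" and fixed: "J \<kappa> = \<kappa>"
  shows "\<not> good_Sigma1_wellordering [\<kappa>] r (pow \<kappa>)"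
proof
  assume good: "good_Sigma1_wellordering [\<kappa>] r (pow \<kappa>)"
  define P where "P = pow \<kappa>"
  have wo: "wellorders (rel r) P" and def: "Sigma1_definable [\<kappa>] (initial_segments r P)"
    using good by (simp_all add: good_Sigma1_wellordering_def wellordering_of_def P_def)
  have irrefl: "\<not> rel r x x" if "x \<in> elts P" for x
    using wo that by (simp add: wellorders_def irreflp_on_def)
  have trans: "rel r x z" if "rel r x y" "rel r y z" "x \<in> elts P" "y \<in> elts P" "z \<in> elts P" for x y z
    using wo that unfolding wellorders_def transp_on_def by blast
  have total: "rel r x y \<or> x = y \<or> rel r y x" if "x \<in> elts P" "y \<in> elts P" for x y
    using wo that unfolding wellorders_def totalp_on_def by blast
  have least: "\<exists>m\<in>elts S. \<forall>x\<in>elts S. \<not> rel r x m" if "elts S \<subseteq> elts P" "elts S \<noteq> {}" for S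
    using wo that unfolding wellorders_def by blast
  define seg where "seg y = sep P (\<lambda>x. rel r x y)" for y
  have seg: "elts (seg y) = {x \<in> elts P. rel r x y}" for y
    unfolding seg_def by (rule elts_sep) (intro dfn)
  have "trm1 seg" unfolding seg_def by (intro dfn)
  have J_seg: "\<exists>z\<in>elts P. J (seg y) = seg z" if y: "y \<in> elts P" for y
  proof -
    obtain \<phi> where \<phi>: "Sigma1 \<phi>" "free_vars \<phi> \<subseteq> {0..1}"
      "initial_segments r P = {x. sat mem \<phi> (\<lambda>i. [x, \<kappa>] ! i)}"
      using def unfolding Sigma1_definable_def by auto
    \<comment> \<open>Lookups beyond the list are unspecified; replacing them by \<kappa> gives an
      assignment of finite range that \<open>J\<close> maps to one of the same shape.\<close>
    have cong: "sat mem \<phi> (\<lambda>i. [x, \<kappa>] ! i) \<longleftrightarrow> sat mem \<phi> (\<lambda>i. if i = 0 then x else \<kappa>)" for x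
      by (rule sat_cong_free_vars) (use \<phi>(2) in \<open>auto simp: nth_Cons'\<close>)
    have "seg y \<in> initial_segments r P"
      using y by (auto simp: initial_segments_def seg)
    then have s: "sat mem \<phi> (\<lambda>i. if i = 0 then seg y else \<kappa>)" unfolding \<phi>(3) using cong by simp
    have "range (\<lambda>i::nat. if i = 0 then seg y else \<kappa>) \<subseteq> {seg y, \<kappa>}" by auto
    then have "finite (range (\<lambda>i::nat. if i = 0 then seg y else \<kappa>))"
      by (rule finite_subset) simp
    from Sigma1_upward[OF \<phi>(1) this s]
    have "sat mem \<phi> (\<lambda>i. if i = 0 then J (seg y) else \<kappa>)"
      by (simp add: if_distrib fixed cong: if_cong)
    then have "J (seg y) \<in> initial_segments r P" unfolding \<phi>(3) using cong by simp
    then obtain z where "z \<in> elts P" "elts (J (seg y)) = elts (seg z)"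
      unfolding initial_segments_def seg by blast
    then show ?thesis using extensionality by blast
  qed
  \<comment> \<open>With the power set of \<open>P\<close> as an element, the transitive
    \<open>T\<close> contains all initial segments.\<close>
  obtain T where T: "trans_set T" "pow P \<in> elts T"
    using ex_trans_set_mem[of "{pow P}"] by auto
  have PT: "P \<in> elts T" by (rule trans_setD[OF T]) simp
  have PT': "elts P \<subseteq> elts T" using trans_setD[OF T(1) PT] by blast
  have segT: "seg y \<in> elts T" for y
    by (rule trans_setD[OF T]) (use seg in auto)
  have sub: "elts (seg y) \<subseteq> elts (J (seg y))" if "y \<in> elts P" for y
  proof (rule ccontr)
    assume n: "\<not> elts (seg y) \<subseteq> elts (J (seg y))"
    obtain S where S: "elts S = {x \<in> elts P. \<not> elts (seg x) \<subseteq> elts (J (seg x))}"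
      using ex_set_not_subset_J[OF T(1) segT \<open>trm1 seg\<close>, of P] by blast
    then have "elts S \<subseteq> elts P" "elts S \<noteq> {}" using n that by auto
    from least[OF this] obtain m where m: "m \<in> elts S" "\<And>x. x \<in> elts S \<Longrightarrow> \<not> rel r x m" by blast
    then have mP: "m \<in> elts P" and m': "\<not> elts (seg m) \<subseteq> elts (J (seg m))" unfolding S by blast+
    \<comment> \<open>A least failure m would have to be mapped to a smaller z. Minimality and
      monotonicity then give J (seg z) = seg z = J (seg m), which contradicts injectivity of
      \<open>J\<close>.\<close>
    obtain z where z: "z \<in> elts P" "J (seg m) = seg z" using J_seg[OF mP] by blast
    have "elts (seg m) \<subseteq> elts (seg z)" if "m = z \<or> rel r m z"
      using that trans[OF _ _ _ mP z(1)] unfolding seg by blast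
    then have zm: "rel r z m" using total[OF mP z(1)] m' z(2) by auto
    then have "z \<notin> elts S" using m(2) by blast
    then have 1: "elts (seg z) \<subseteq> elts (J (seg z))" using z(1) unfolding S by blast
    have "elts (seg z) \<subseteq> elts (seg m)"
      using trans[OF _ zm _ z(1) mP] unfolding seg by blast
    from J_mono[OF this] have "elts (J (seg z)) \<subseteq> elts (seg z)" using z(2) by simp
    with 1 have "J (seg z) = seg z" by (intro extensionality) blast
    then have "seg z = seg m" using z(2) J_eq_iff by metis
    moreover have "z \<in> elts (seg m)" using z(1) zm unfolding seg by blast
    ultimately show False using irrefl[OF z(1)] seg[of z] by simp
  qed
  have PI: "x \<in> PI T ` elts (funs \<delta> (pow \<kappa>))" if x: "x \<in> elts P" and y: "y \<in> elts P" and "rel r x y" for x y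
  proof -
    have "x \<in> elts (J (seg y))" using sub[OF y] that(3) x unfolding seg by blast
    then have "x \<in> PI T ` elts (funs \<delta> (seg y))" unfolding elts_J[OF T(1) segT] .
    moreover have "elts (seg y) \<subseteq> elts (pow \<kappa>)" unfolding seg P_def by blast
    ultimately show ?thesis using funs_mono by blast
  qed
  obtain y where y: "y \<in> elts P" "y \<notin> PI T ` elts (funs \<delta> (pow \<kappa>))"
    using ex_subset_not_PI[OF GCH \<kappa> T(1)] PT' unfolding P_def by blast
  have dP: "diff \<kappa> y \<in> elts P" by (auto simp: P_def)
  have d: "diff \<kappa> y \<notin> PI T ` elts (funs \<delta> (pow \<kappa>))"
    using diff_not_PI[OF fixed T(1)] PT' y unfolding P_def by blast
  have "y \<noteq> diff \<kappa> y"
  proof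
    assume "y = diff \<kappa> y"
    then have "elts y = elts \<kappa> - elts y" by (metis elts_diff)
    then show False using \<kappa>(2) by blast
  qed
  \<comment> \<open>Whichever of the two sets comes earlier lies in a proper initial segment, hence
    would be represented.\<close>
  with total[OF y(1) dP] PI[OF y(1) dP] PI[OF dP y(1)] y(2) d show False by blast
qed

theorem good_wellordering_near_cofinality:
  assumes GCH: "\<And>\<theta>. cardinal \<theta> \<Longrightarrow> elts \<delta> \<subseteq> elts \<theta> \<Longrightarrow> GCH_at \<theta>"
    and \<kappa>: "cardinal \<kappa>" "ord_le \<delta> \<kappa>" and good: "good_Sigma1_wellordering [\<kappa>] r (pow \<kappa>)"
  shows "near_cofinality_\<delta> \<kappa>"
proof (cases "\<delta> = \<kappa>")
  case True
  obtain \<mu> where "successor_cardinal \<mu> \<delta>"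
    using GCH_atE[OF GCH[OF cardinal_\<delta>]] by blast
  then have "ord_le \<delta> \<delta>" "ord_le \<delta> \<mu>"
    by (simp_all add: ord_le_def successor_cardinal_def)
  with \<open>successor_cardinal \<mu> \<delta>\<close> show ?thesis
    using cardinal_\<delta> cofinality_\<delta> unfolding near_cofinality_\<delta>_def True[symmetric] by blast
next
  case False
  then have "\<delta> \<in> elts \<kappa>" using \<kappa>(2) by (simp add: ord_le_def mem_elts)
  then show ?thesis
    using no_good_wellordering[OF GCH[OF cardinal_\<delta> subset_refl] \<kappa>(1)] J_fixed[OF GCH \<kappa>(1)] good
    by blast
qed

end

section \<open>Comparison of two measurable cardinals\<close>

context ZFC_model
begin

lemma measurable_cardinalE:
  assumes "measurable_cardinal \<delta>"
  obtains U where "measure_model mem \<delta> U"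
  using assms unfolding measurable_cardinal_def
  by (meson measure_model.intro measure_model_axioms.intro ZFC_model_axioms)

lemma cofinality_le:
  assumes "ordinal \<nu>" "cofinality \<nu> \<gamma>"
  shows "elts \<gamma> \<subseteq> elts \<nu>"
proof (rule ccontr)
  assume "\<not> elts \<gamma> \<subseteq> elts \<nu>"
  moreover have "ordinal \<gamma>" using assms(2) by (simp add: cofinality_def)
  ultimately have "\<nu> \<in> elts \<gamma>"
    using ordinal_not_mem_iff assms(1) by blast
  have "function_between (lam \<nu> (\<lambda>x. x)) \<nu> \<nu>"
    by (rule function_between_lam) (auto intro: dfn)
  moreover have "rel (lam \<nu> (\<lambda>x. x)) \<alpha> \<alpha>" if "\<alpha> \<in> elts \<nu>" for \<alpha>
    using that by (simp add: rel_iff)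
  ultimately have "cofinal_map (lam \<nu> (\<lambda>x. x)) \<nu> \<nu>"
    unfolding cofinal_map_def ord_le_def by blast
  with \<open>\<nu> \<in> elts \<gamma>\<close> show False using assms(2) unfolding cofinality_def by blast
qed

lemma cofinality_unique:
  assumes "cofinality \<nu> \<gamma>" "cofinality \<nu> \<gamma>'"
  shows "\<gamma> = \<gamma>'"
  using assms ordinal_linear[of \<gamma> \<gamma>'] unfolding cofinality_def by blast

lemma successor_cardinal_unique:
  assumes "successor_cardinal \<mu> \<theta>" "successor_cardinal \<mu>' \<theta>"
  shows "\<mu> = \<mu>'"
proof -
  have "cardinal \<mu>" "\<theta> \<in> elts \<mu>" "cardinal \<mu>'" "\<theta> \<in> elts \<mu>'"
    using assms by (simp_all add: successor_cardinal_def mem_elts)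
  then show ?thesis
    using successor_cardinal_le[OF assms(1)] successor_cardinal_le[OF assms(2)]
    by (intro extensionality) blast
qed

text \<open>If \<nu> = \<nu>', then \<delta> = \<mu> by uniqueness of the cofinality. If \<nu> <
  \<nu>', then \<nu>' = \<nu>^+ is regular, so \<mu> = \<nu>^+ \<le> 2^\<nu>, impossible for a
  measurable cardinal. If \<nu>' < \<nu>, then \<nu> = \<nu>'^+ is regular but has cofinality
  \<delta> < \<nu>.\<close>

lemma no_second_measurable:
  assumes \<delta>: "measurable_cardinal \<delta>" and \<mu>: "measurable_cardinal \<mu>" and \<delta>\<mu>: "\<delta> \<in> elts \<mu>"
    and GCH: "\<And>\<theta>. cardinal \<theta> \<Longrightarrow> elts \<delta> \<subseteq> elts \<theta> \<Longrightarrow> GCH_at \<theta>"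
    and \<nu>: "cardinal \<nu>" "cofinality \<nu> \<delta>" "ord_le \<nu> \<kappa>" "successor_cardinal \<rho> \<nu>" "ord_le \<kappa> \<rho>"
    and \<nu>': "cardinal \<nu>'" "cofinality \<nu>' \<mu>" "ord_le \<nu>' \<kappa>" "successor_cardinal \<rho>' \<nu>'" "ord_le \<kappa> \<rho>'"
    and \<kappa>: "cardinal \<kappa>"
  shows False
proof -
  obtain U where "measure_model mem \<delta> U" by (rule measurable_cardinalE[OF \<delta>])
  then interpret D: measure_model mem \<delta> U .
  obtain W where "measure_model mem \<mu> W" by (rule measurable_cardinalE[OF \<mu>])
  then interpret M: measure_model mem \<mu> W .
  have \<rho>: "cardinal \<rho>" "\<nu> \<in> elts \<rho>" "cardinal \<rho>'" "\<nu>' \<in> elts \<rho>'"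
    using \<nu>(4) \<nu>'(4) by (simp_all add: successor_cardinal_def mem_elts)
  note o = cardinal_ordinal[OF \<nu>(1)] cardinal_ordinal[OF \<nu>'(1)] cardinal_ordinal[OF \<kappa>]
    cardinal_ordinal[OF \<rho>(1)] cardinal_ordinal[OF \<rho>(3)]
  have le: "elts \<nu> \<subseteq> elts \<kappa>" "elts \<kappa> \<subseteq> elts \<rho>" "elts \<nu>' \<subseteq> elts \<kappa>" "elts \<kappa> \<subseteq> elts \<rho>'"
    using \<nu>(3,5) \<nu>'(3,5) ord_le_iff o by blast+
  have \<delta>\<nu>: "elts \<delta> \<subseteq> elts \<nu>" and \<mu>\<nu>': "elts \<mu> \<subseteq> elts \<nu>'"
    using cofinality_le o \<nu>(2) \<nu>'(2) by blast+
  consider "\<nu> = \<nu>'" | "\<nu> \<in> elts \<nu>'" | "\<nu>' \<in> elts \<nu>"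
    using ordinal_linear[OF o(1,2)] by blast
  then show False
  proof cases
    case 1
    then have "\<delta> = \<mu>" using cofinality_unique \<nu>(2) \<nu>'(2) by blast
    with \<delta>\<mu> show False using not_mem_self by blast
  next
    case 2
    have "\<nu>' = \<rho>"
      using successor_cardinal_le[OF \<nu>(4) \<nu>'(1) 2] le by (intro extensionality) blast
    with \<nu>'(2) have cof: "cofinality \<rho> \<mu>" and \<mu>\<rho>: "elts \<mu> \<subseteq> elts \<rho>" using \<mu>\<nu>' by simp_all
    have "\<mu> \<notin> elts \<rho>"
      using D.successor_regular[OF \<nu>(4,1) \<delta>\<nu>] cof unfolding cofinality_def by blast
    then have "\<mu> = \<rho>" using ordinal_subset_iff[OF M.ordinal_\<delta> o(4)] \<mu>\<rho> by blast
    obtain \<sigma> where "successor_cardinal \<sigma> \<nu>" "lep \<sigma> (pow \<nu>)"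
      using GCH_atE[OF GCH[OF \<nu>(1) \<delta>\<nu>]] by blast
    then have "lep \<mu> (pow \<nu>)" using successor_cardinal_unique \<nu>(4) \<open>\<mu> = \<rho>\<close> by blast
    then show False using M.not_lep_pow_below \<rho>(2) \<open>\<mu> = \<rho>\<close> by blast
  next
    case 3
    have "\<nu> = \<rho>'"
      using successor_cardinal_le[OF \<nu>'(4) \<nu>(1) 3] le by (intro extensionality) blast
    with \<nu>(2) have "cofinality \<rho>' \<delta>" by simp
    moreover have \<delta>\<nu>': "\<delta> \<in> elts \<nu>'" using \<mu>\<nu>' \<delta>\<mu> by blast
    moreover have "elts \<delta> \<subseteq> elts \<nu>'" using ordinal_mem_subset[OF o(2) \<delta>\<nu>'] .
    moreover have "\<delta> \<in> elts \<rho>'" using ordinal_mem_trans[OF o(5) \<rho>(4) \<delta>\<nu>'] .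
    ultimately show False
      using D.successor_regular[OF \<nu>'(4,1)] unfolding cofinality_def by blast
  qed
qed

end

section \<open>Both statements in an arbitrary model of ZFC\<close>

theorem corollary1p4:
  fixes mem :: "'v \<Rightarrow> 'v \<Rightarrow> bool" and \<delta> \<kappa> :: 'v
  assumes "ZFC_model mem"
    and "set_structure.measurable_cardinal mem \<delta>"
    and "\<forall>\<theta>. set_structure.cardinal mem \<theta> \<and> set_structure.ord_le mem \<delta> \<theta> \<longrightarrow>
           set_structure.GCH_at mem \<theta>"
    and "set_structure.cardinal mem \<kappa>"
    and "set_structure.ord_le mem \<delta> \<kappa>"
    and "\<exists>P r. set_structure.powerset mem P \<kappa> \<and>
           set_structure.good_Sigma1_wellordering mem [\<kappa>] r P"
  shows "(\<exists>\<nu>. set_structure.cardinal mem \<nu> \<and> set_structure.cofinality mem \<nu> \<delta> \<and>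
            set_structure.ord_le mem \<nu> \<kappa> \<and>
            (\<exists>\<mu>. set_structure.successor_cardinal mem \<mu> \<nu> \<and> set_structure.ord_le mem \<kappa> \<mu>))
       \<and> (\<nexists>\<mu>. set_structure.measurable_cardinal mem \<mu> \<and> mem \<delta> \<mu> \<and>
            set_structure.ord_le mem \<mu> \<kappa>)"
proof -
  interpret ZFC_model mem by (rule assms(1))
  obtain P r where P: "powerset P \<kappa>" "good_Sigma1_wellordering [\<kappa>] r P"
    using assms(6) by blast
  have "P = pow \<kappa>"
    using P(1) by (intro extensionality) (simp add: powerset_def)
  with P(2) have good: "good_Sigma1_wellordering [\<kappa>] r (pow \<kappa>)" by simp
  \<comment> \<open>The GCH from \<delta> on holds in particular from \<mu> on, so (i) is available
    for every measurable \<mu> between \<delta> and \<kappa>; it is used for \<delta> and for a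
    supposed second one.\<close>
  have near: "\<exists>\<nu>. cardinal \<nu> \<and> cofinality \<nu> \<mu> \<and> ord_le \<nu> \<kappa> \<and>
      (\<exists>\<rho>. successor_cardinal \<rho> \<nu> \<and> ord_le \<kappa> \<rho>)"
    if \<mu>: "measurable_cardinal \<mu>" "elts \<delta> \<subseteq> elts \<mu>" "ord_le \<mu> \<kappa>"
      and \<delta>: "ordinal \<delta>" for \<mu>
  proof -
    obtain U where "measure_model mem \<mu> U" by (rule measurable_cardinalE[OF \<mu>(1)])
    then interpret M: measure_model mem \<mu> U .
    have "GCH_at \<theta>" if "cardinal \<theta>" "elts \<mu> \<subseteq> elts \<theta>" for \<theta>
    proof -
      have "ord_le \<delta> \<theta>"
        using ord_le_iff[OF \<delta> cardinal_ordinal[OF that(1)]] \<mu>(2) that(2) by blast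
      with that(1) assms(3) show ?thesis by blast
    qed
    then show ?thesis
      using M.good_wellordering_near_cofinality[OF _ assms(4) \<mu>(3) good]
      unfolding M.near_cofinality_\<delta>_def by blast
  qed
  have \<delta>: "ordinal \<delta>"
    using assms(2) cardinal_ordinal by (simp add: measurable_cardinal_def uncountable_cardinal_def)
  have GCH: "GCH_at \<theta>" if "cardinal \<theta>" "elts \<delta> \<subseteq> elts \<theta>" for \<theta>
    using assms(3) that ord_le_iff[OF \<delta> cardinal_ordinal[OF that(1)]] by blast
  note i = near[OF assms(2) subset_refl assms(5) \<delta>]
  have "False" if \<mu>: "measurable_cardinal \<mu>" "mem \<delta> \<mu>" "ord_le \<mu> \<kappa>" for \<mu>
  proof -
    have \<delta>\<mu>: "\<delta> \<in> elts \<mu>" using \<mu>(2) by (simp add: mem_elts)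
    have "ordinal \<mu>"
      using \<mu>(1) cardinal_ordinal by (simp add: measurable_cardinal_def uncountable_cardinal_def)
    then have "elts \<delta> \<subseteq> elts \<mu>" using ordinal_mem_subset \<delta>\<mu> by blast
    from near[OF \<mu>(1) this \<mu>(3) \<delta>] i show False
      using no_second_measurable[OF assms(2) \<mu>(1) \<delta>\<mu> GCH _ _ _ _ _ _ _ _ _ _ assms(4)] by blast
  qed
  with i show ?thesis by blast
qed

end
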